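(* Let $n\ge 2$ and let $k$ be an integer with $0<k\le n/2$. Consider the diagonal element of order 2 $$C_{n-k,k}=(\underbrace{1,\dots,1}_{n-k},\underbrace{-1,\dots,-1}_{k})\in \mathrm{GL}(n,\mathbb{C}).$$ Let $S_{(\underline{\lambda})}\mathbb{C}^n$ be the highest weight representation of $\mathrm{GL}(n,\mathbb{C})$ with highest weight $\underline{\lambda}=(\lambda_1\ge\lambda_2\ge\cdots\ge\lambda_n)$, and let $\Theta_{\underline{\lambda}}$ be its character. Write $\underline{\lambda}+\rho_n=(l_1,\dots,l_n)$ with $l_i=\lambda_i+n-i$, and for $i\in\{0,1\}$ let $\eta_i(\underline{\lambda})=\{l_j : l_j\equiv i \bmod 2\}$. Assume (as may be arranged by multiplying $S_{(\underline\lambda)}\mathbb{C}^n$ by the determinant character) that $\#\eta_0(\underline{\lambda})\ge\#\eta_1(\underline{\lambda})$. Then: A. If $\#\eta_0(\underline{\lambda})>n-k$, then $\Theta_{\underline{\lambda}}(C_{n-k,k})=0$. B. If $\#\eta_0(\underline{\lambda})=n-k$, then $$\Theta_{\underline{\lambda}}(C_{n-k,k})=\pm 2^{c(k)}\cdot\dim\big(S_{(\lambda^0)}\mathbb{C}^{n-k}\otimes S_{(\lambda^1)}\mathbb{C}^{k}\big),\qquad c(k)=\binom{n-2k}{2},$$ where the highest weights $\lambda^0$ of $\mathrm{GL}(n-k,\mathbb{C})$ and $\lambda^1$ of $\mathrm{GL}(k,\mathbb{C})$ are given by $\lambda^0+\rho_{n-k}=\eta_0(\underline{\lambda})/2$ and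 $\lambda^1+\rho_k=[\eta_1(\underline{\lambda})-1]/2$. C. If $\#\eta_0(\underline{\lambda})<n-k$, then $$\Theta_{\underline{\lambda}}(C_{n-k,k})=\pm\frac{\sum_{S\in I}\epsilon_S\cdot\dim\big(S_{(\lambda_S)}\mathbb{C}^k\otimes S_{(\lambda_{S'})}\mathbb{C}^{n-k}\big)}{2^{k(n-k-1)}},$$ where $I$ is the set of all $k$-element subsets $S=\{i_1,\dots,i_k\}\subset[n]$ such that $l_{i_j}\in\eta_1(\underline{\lambda})$ for all $1\le j\le k$, $S'=[n]\setminus S$, $\epsilon_S$ is the sign of the shuffle permutation corresponding to $S$ and $S'$, and the highest weights $\lambda_S$ of $\mathrm{GL}(k,\mathbb{C})$ and $\lambda_{S'}$ of $\mathrm{GL}(n-k,\mathbb{C})$ are given by $\lambda_S+\rho_k=(l_s\mid s\in S)$ and $\lambda_{S'}+\rho_{n-k}=(l_s\mid s\in S')$. The sum has $\binom{\#\eta_1(\underline{\lambda})}{k}$ terms.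
   Context: $[n]=\{1,\dots,n\}$. For a positive integer $m$, $\rho_m=(m-1,m-2,\dots,0)$. Highest weights of $\mathrm{GL}(m,\mathbb{C})$ are weakly decreasing integer $m$-tuples $\mu$, and $S_{(\mu)}\mathbb{C}^m$ denotes the irreducible representation with highest weight $\mu$. $\eta_0/2=\{a/2: a\in\eta_0\}$ and $[\eta_1-1]/2=\{(b-1)/2: b\in\eta_1\}$; such finite sets are viewed as tuples by listing their elements in decreasing order, and $(l_s\mid s\in S)$ is the tuple of the $l_s$ in decreasing order (equivalently, in increasing order of $s$). For $S=\{r_1<\cdots<r_k\}$ and $S'=[n]\setminus S=\{t_1<\cdots<t_{n-k}\}$, the shuffle sign $\epsilon_S\in\{\pm1\}$ is defined by $\epsilon_S\,(e_1\wedge\cdots\wedge e_n)=e_{r_1}\wedge\cdots\wedge e_{r_k}\wedge e_{t_1}\wedge\cdots\wedge e_{t_{n-k}}$. The symbol $\pm$ means that the equality holds for one of the two choices of a single overall sign (which may depend on $n,k,\underline\lambda$). *)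

theory Defs
  imports
    Complex_Main
    "HOL-Combinatorics.Permutations"
    "Jordan_Normal_Form.VS_Connect"
begin

subsection \<open>Finite-dimensional representations in coordinates\<close>

definition GL :: "nat \<Rightarrow> complex mat monoid" where
  "GL m = units_of (ring_mat TYPE(complex) m ())"

text \<open>A representation on \<open>\<complex>\<^sup>d\<close>: the dimension \<open>d\<close> together with the acting matrices. Only the
  values of \<open>action\<close> on the carrier of the group are meaningful.\<close>

datatype 'g rep = Rep (degree: nat) (action: "'g \<Rightarrow> complex mat")

hide_const (open) degree

definition character :: "'g rep \<Rightarrow> 'g \<Rightarrow> complex" where
  "character V g = (\<Sum>i<rep.degree V. action V g $$ (i, i))"

definition kronecker :: "complex mat \<Rightarrow> complex mat \<Rightarrow> complex mat" where
  "kronecker A B = mat (dim_row A * dim_row B) (dim_col A * dim_col B)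
     (\<lambda>(i, j). A $$ (i div dim_row B, j div dim_col B) * B $$ (i mod dim_row B, j mod dim_col B))"

text \<open>External tensor product, a representation of the product group. The space
  \<open>\<complex>\<^sup>d \<otimes> \<complex>\<^sup>e\<close> is identified with \<open>\<complex>\<^sup>d\<^sup>e\<close> through its basis \<open>e\<^sub>i \<otimes> e\<^sub>j\<close>, at position \<open>i * e + j\<close>.\<close>

definition tensor_rep :: "'g rep \<Rightarrow> 'h rep \<Rightarrow> ('g \<times> 'h) rep" where
  "tensor_rep V W = Rep (rep.degree V * rep.degree W)
     (\<lambda>(g, h). kronecker (action V g) (action W h))"

text \<open>The coordinate ring \<open>\<complex>[x\<^sub>i\<^sub>j, det\<^sup>-\<^sup>1]\<close> of \<open>GL(m, \<complex>)\<close>, as functions on matrices.\<close>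

inductive_set regular_funs :: "nat \<Rightarrow> (complex mat \<Rightarrow> complex) set" for m where
  const: "(\<lambda>g. c) \<in> regular_funs m"
| entry: "\<lbrakk>i < m; j < m\<rbrakk> \<Longrightarrow> (\<lambda>g. g $$ (i, j)) \<in> regular_funs m"
| inverse_det: "(\<lambda>g. inverse (det g)) \<in> regular_funs m"
| add: "\<lbrakk>f \<in> regular_funs m; h \<in> regular_funs m\<rbrakk> \<Longrightarrow> (\<lambda>g. f g + h g) \<in> regular_funs m"
| mult: "\<lbrakk>f \<in> regular_funs m; h \<in> regular_funs m\<rbrakk> \<Longrightarrow> (\<lambda>g. f g * h g) \<in> regular_funs m"

definition algebraic_rep :: "nat \<Rightarrow> complex mat rep \<Rightarrow> bool" where
  "algebraic_rep m V \<longleftrightarrow>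
     action V \<in> hom (GL m) (GL (rep.degree V)) \<and>
     (\<forall>i < rep.degree V. \<forall>j < rep.degree V.
        \<exists>f \<in> regular_funs m. \<forall>g \<in> carrier (GL m). action V g $$ (i, j) = f g)"

definition irreducible_rep :: "nat \<Rightarrow> complex mat rep \<Rightarrow> bool" where
  "irreducible_rep m V \<longleftrightarrow>
     rep.degree V > 0 \<and>
     (\<forall>W. VectorSpace.subspace class_ring W (module_vec TYPE(complex) (rep.degree V)) \<and>
          (\<forall>g \<in> carrier (GL m). \<forall>w \<in> W. action V g *\<^sub>v w \<in> W)
        \<longrightarrow> W = {0\<^sub>v (rep.degree V)} \<or> W = carrier_vec (rep.degree V))"

text \<open>The highest weight vector is taken with respect to the upper triangular Borel subgroup
  \<open>B = TN\<close>: the unipotent part \<open>N\<close> fixes it, and \<open>diag(t\<^sub>1, \<dots>, t\<^sub>m)\<close> scales it by the product of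
  the \<open>t\<^sub>i\<close> to the power \<open>\<mu>\<^sub>i\<close>.\<close>

definition has_highest_weight :: "nat \<Rightarrow> int list \<Rightarrow> complex mat rep \<Rightarrow> bool" where
  "has_highest_weight m \<mu> V \<longleftrightarrow>
     length \<mu> = m \<and>
     (\<exists>v \<in> carrier_vec (rep.degree V). v \<noteq> 0\<^sub>v (rep.degree V) \<and>
        (\<forall>b \<in> carrier (GL m). upper_triangular b \<longrightarrow>
           action V b *\<^sub>v v = (\<Prod>i<m. (b $$ (i, i)) powi (\<mu> ! i)) \<cdot>\<^sub>v v))"

text \<open>\<open>highest_weight_rep m \<mu> V\<close> says that \<open>V\<close> is a realization of the irreducible representation
  of \<open>GL(m, \<complex>)\<close> with highest weight \<open>\<mu>\<close>, which is unique up to isomorphism.\<close>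

definition highest_weight_rep :: "nat \<Rightarrow> int list \<Rightarrow> complex mat rep \<Rightarrow> bool" where
  "highest_weight_rep m \<mu> V \<longleftrightarrow>
     algebraic_rep m V \<and> irreducible_rep m V \<and> has_highest_weight m \<mu> V"


subsection \<open>Weights\<close>

text \<open>Weights are lists, so their entries are indexed from 0: the entry \<open>l\<^sub>i\<close> of the mathematical
  notation is \<open>l ! (i - 1)\<close>, and the index set \<open>[n]\<close> becomes \<open>{..<n}\<close>.\<close>

definition rho :: "nat \<Rightarrow> int list" where
  "rho m = rev (map int [0..<m])"

definition plus_rho :: "int list \<Rightarrow> int list" where
  "plus_rho \<mu> = map2 (+) \<mu> (rho (length \<mu>))"

definition minus_rho :: "int list \<Rightarrow> int list" where
  "minus_rho l = map2 (-) l (rho (length l))"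

lemma length_rho [simp]: "length (rho m) = m"
  by (simp add: rho_def)

lemma plus_rho_eq_iff: "plus_rho \<mu> = l \<longleftrightarrow> \<mu> = minus_rho l"
proof
  assume "plus_rho \<mu> = l"
  then show "\<mu> = minus_rho l"
    by (auto simp: plus_rho_def minus_rho_def intro!: nth_equalityI)
next
  assume "\<mu> = minus_rho l"
  then show "plus_rho \<mu> = l"
    by (auto simp: plus_rho_def minus_rho_def intro!: nth_equalityI)
qed

definition decreasing_list :: "int set \<Rightarrow> int list" where
  "decreasing_list A = rev (sorted_list_of_set A)"

definition eta :: "int \<Rightarrow> int list \<Rightarrow> int set" where
  "eta i \<mu> = {a \<in> set (plus_rho \<mu>). a mod 2 = i}"

text \<open>The divisions in the next two definitions are exact.\<close>

definition weight0 :: "int list \<Rightarrow> int list" where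
  "weight0 \<mu> = minus_rho (decreasing_list ((\<lambda>a. a div 2) ` eta 0 \<mu>))"

definition weight1 :: "int list \<Rightarrow> int list" where
  "weight1 \<mu> = minus_rho (decreasing_list ((\<lambda>b. (b - 1) div 2) ` eta 1 \<mu>))"

definition odd_subsets :: "nat \<Rightarrow> int list \<Rightarrow> nat set set" where
  "odd_subsets k \<mu> =
     {S. S \<subseteq> {..<length \<mu>} \<and> card S = k \<and> (\<forall>s \<in> S. plus_rho \<mu> ! s \<in> eta 1 \<mu>)}"

text \<open>\<open>nths l S\<close> lists the entries of \<open>l\<close> at positions in \<open>S\<close>, in increasing order of position;
  for \<open>l = plus_rho \<mu>\<close> with \<open>\<mu>\<close> dominant this is the decreasing order of the entries.\<close>

definition subset_weight :: "int list \<Rightarrow> nat set \<Rightarrow> int list" where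
  "subset_weight \<mu> S = minus_rho (nths (plus_rho \<mu>) S)"

text \<open>The permutation listing first \<open>S\<close> and then its complement, both in increasing order.\<close>

definition shuffle_perm :: "nat \<Rightarrow> nat set \<Rightarrow> nat \<Rightarrow> nat" where
  "shuffle_perm n S i =
     (if i < n then (sorted_list_of_set S @ sorted_list_of_set ({..<n} - S)) ! i else i)"

lemma shuffle_perm_permutes:
  assumes "S \<subseteq> {..<n}"
  shows "shuffle_perm n S permutes {..<n}"
proof -
  let ?xs = "sorted_list_of_set S @ sorted_list_of_set ({..<n} - S)"
  have fin: "finite S"
    using assms finite_subset by blast
  have d: "distinct ?xs" and s: "set ?xs = {..<n}"
    using fin assms by auto
  then have len: "length ?xs = n"
    by (metis card_lessThan distinct_card)
  have "bij_betw ((!) ?xs) {..<n} {..<n}"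
    using bij_betw_nth[OF d, of "{..<n}" "{..<n}"] len s by simp
  then have "bij_betw (shuffle_perm n S) {..<n} {..<n}"
    by (rule bij_betw_cong[THEN iffD1, rotated]) (simp add: shuffle_perm_def)
  then show ?thesis
    by (rule bij_imp_permutes) (simp add: shuffle_perm_def)
qed

definition shuffle_sign :: "nat \<Rightarrow> nat set \<Rightarrow> int" where
  "shuffle_sign n S = sign (shuffle_perm n S)"

text \<open>The diagonal element with \<open>m\<close> entries 1 followed by \<open>k\<close> entries -1.\<close>

definition diag_invol :: "nat \<Rightarrow> nat \<Rightarrow> complex mat" where
  "diag_invol m k = mat_diag (m + k) (\<lambda>i. if i < m then 1 else -1)"

end

theory Submission
  imports Defs "HOL-Library.Poly_Mapping" "HOL-Library.Function_Algebras" "Jordan_Normal_Form.Determinant"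
begin

text \<open>
  Weyl's character formula says that, with \<open>l = \<lambda> + \<rho>\<close>,
  the character of \<open>V\<close> at \<open>diag(t\<^sub>1, \<dots>, t\<^sub>n)\<close> times \<open>\<Prod>\<^sub>i\<^sub><\<^sub>j (t\<^sub>i - t\<^sub>j)\<close> is the determinant of
  the matrix \<open>t\<^sub>i\<close> to the power \<open>l\<^sub>j\<close>. At the involution both sides vanish as soon as \<open>n > 2\<close>, so it
  is approached along the curve
  \<open>t(q) = (-q\<^sup>k\<^sup>-\<^sup>1, \<dots>, -q, -1, q\<^sup>n\<^sup>-\<^sup>k\<^sup>-\<^sup>1, \<dots>, q, 1)\<close> as \<open>q\<close> tends to 1. Because \<open>k \<le> n - k\<close>, every
  one of the first \<open>k\<close> entries is, up to sign, also one of the last \<open>n - k\<close> entries.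
  Subtracting the corresponding rows multiplies the entry of a sign row in column \<open>j\<close> by \<open>-2\<close> if \<open>l\<^sub>j\<close> is
  odd and kills it if \<open>l\<^sub>j\<close> is even. A Laplace expansion along these \<open>k\<close> rows
  (\<open>Laplace_expansion_rows\<close>) therefore only involves sets \<open>S\<close> of columns with odd \<open>l\<^sub>j\<close>, and both
  minors are Vandermonde determinants in powers of \<open>q\<close>. Dividing by the right power of \<open>q - 1\<close> and
  letting \<open>q\<close> tend to 1 turns them into products of differences of the \<open>l\<^sub>j\<close>, that is, into the
  dimensions of Weyl's formula. This is \<open>character_involution\<close>: up to one sign, the
  character value is \<open>2\<close> to the power \<open>-k(n - k - 1)\<close> times the sum over odd \<open>S\<close>. The three parts
  of the theorem are the cases of no odd set, exactly one odd set, and several; in the second case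
  halving the entries \<open>l\<^sub>j\<close> pulls a power of 2 out of each of the two dimensions.

  Weyl's formula is proved for an arbitrary algebraic irreducible representation with a highest
  weight vector, in the locale \<open>highest_weight_GL_rep\<close>, by the Casimir method.
  The derivative of the representation at the identity gives operators \<open>E i j\<close>, and
  \<open>\<Sum>\<^sub>i\<^sub>j E i j * E j i\<close> commutes with the group, so it is a scalar by Schur's lemma. Moving a torus
  element past \<open>E i j\<close> under the trace expresses \<open>tr (T E i j E j i)\<close> through first derivatives
  of the character \<open>\<chi>\<close> along the torus. The outcome is a differential equation for \<open>\<chi>\<close>; after
  multiplication by the Vandermonde product it says that only exponents of length \<open>|\<lambda> + \<rho>|\<close>
  occur in the Laurent polynomial \<open>J = \<Prod>\<^sub>i\<^sub><\<^sub>j (t\<^sub>i - t\<^sub>j) \<chi>\<close>. On the other hand \<open>V\<close> is spanned by the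
  orbit of the highest weight vector under lower unitriangular matrices, since the products
  \<open>LU\<close> are dense, and so \<open>J\<close> has leading exponent \<open>\<lambda> + \<rho>\<close> with coefficient 1 in the dominance
  order. A strictly decreasing exponent that is dominated by \<open>\<lambda> + \<rho>\<close> and has the same length is
  equal to it, and an alternating Laurent polynomial is determined by its coefficients at strictly
  decreasing exponents. Hence \<open>J\<close> is the alternant of \<open>\<lambda> + \<rho>\<close>.
\<close>

section \<open>Laurent polynomials as functions on the torus\<close>

abbreviation coef :: "('a \<Rightarrow>\<^sub>0 'b::zero) \<Rightarrow> 'a \<Rightarrow> 'b" where
  "coef \<equiv> Poly_Mapping.lookup"

abbreviation supp :: "('a \<Rightarrow>\<^sub>0 'b::zero) \<Rightarrow> 'a set" where
  "supp \<equiv> Poly_Mapping.keys"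

text \<open>Exponents are functions on all of \<open>\<nat>\<close>, which are an additive group pointwise, so that
  finitely supported coefficient functions on them form a commutative ring. The number of
  variables only enters through the evaluation; \<open>bounded_exp\<close> below confines exponents to the
  first \<open>n\<close> variables.\<close>

type_synonym laurent = "(nat \<Rightarrow> int) \<Rightarrow>\<^sub>0 complex"

definition mono_at :: "nat \<Rightarrow> (nat \<Rightarrow> int) \<Rightarrow> (nat \<Rightarrow> complex) \<Rightarrow> complex" where
  "mono_at n \<nu> t = (\<Prod>i<n. t i powi \<nu> i)"

definition leval :: "nat \<Rightarrow> laurent \<Rightarrow> (nat \<Rightarrow> complex) \<Rightarrow> complex" where
  "leval n p t = (\<Sum>\<nu>\<in>supp p. coef p \<nu> * mono_at n \<nu> t)"

definition torus :: "nat \<Rightarrow> (nat \<Rightarrow> complex) set" where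
  "torus n = {t. \<forall>i<n. t i \<noteq> 0}"

text \<open>The points at which the denominators \<open>t\<^sub>i - t\<^sub>j\<close> of the radial equation make sense.\<close>

definition regular :: "nat \<Rightarrow> (nat \<Rightarrow> complex) set" where
  "regular n = {t \<in> torus n. inj_on t {..<n}}"

lemma leval_superset:
  assumes "finite N" "supp p \<subseteq> N"
  shows "leval n p t = (\<Sum>\<nu>\<in>N. coef p \<nu> * mono_at n \<nu> t)"
  unfolding leval_def
  by (rule sum.mono_neutral_left) (use assms in \<open>auto simp: in_keys_iff\<close>)

lemma leval_zero [simp]: "leval n 0 t = 0"
  by (simp add: leval_def)

lemma leval_single [simp]: "leval n (Poly_Mapping.single \<nu> c) t = c * mono_at n \<nu> t"
  by (subst leval_superset[of "{\<nu>}"]) (auto simp: lookup_single)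

lemma leval_add [simp]: "leval n (p + q) t = leval n p t + leval n q t"
proof -
  have "leval n (p + q) t
      = (\<Sum>\<nu>\<in>supp p \<union> supp q. coef (p + q) \<nu> * mono_at n \<nu> t)"
    by (rule leval_superset) (auto simp: keys_add)
  also have "\<dots> = leval n p t + leval n q t"
    by (simp add: leval_superset[of "supp p \<union> supp q" p] leval_superset[of "supp p \<union> supp q" q]
        lookup_add algebra_simps sum.distrib)
  finally show ?thesis .
qed

lemma leval_diff [simp]: "leval n (p - q) t = leval n p t - leval n q t"
  using leval_add[of n "p - q" q t] by simp

lemma leval_sum [simp]: "leval n (\<Sum>x\<in>X. f x) t = (\<Sum>x\<in>X. leval n (f x) t)"
  by (induction X rule: infinite_finite_induct) auto

lemma leval_one [simp]: "leval n 1 t = 1"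
  unfolding single_one[symmetric] leval_single by (simp add: mono_at_def)

lemma mono_at_add:
  "t \<in> torus n \<Longrightarrow> mono_at n (\<nu> + \<mu>) t = mono_at n \<nu> t * mono_at n \<mu> t"
  unfolding mono_at_def prod.distrib[symmetric]
  by (rule prod.cong) (auto simp: torus_def power_int_add)

lemma mono_at_nonzero: "t \<in> torus n \<Longrightarrow> mono_at n \<nu> t \<noteq> 0"
  by (auto simp: mono_at_def torus_def)

lemma laurent_sum_singles:
  "(p :: laurent) = (\<Sum>\<nu>\<in>supp p. Poly_Mapping.single \<nu> (coef p \<nu>))"
proof (rule poly_mapping_eqI)
  fix \<mu>
  have "(\<Sum>\<nu>\<in>supp p. coef (Poly_Mapping.single \<nu> (coef p \<nu>)) \<mu>)
      = (\<Sum>\<nu>\<in>supp p. if \<nu> = \<mu> then coef p \<mu> else 0)"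
    by (rule sum.cong) (auto simp: lookup_single when_def)
  also have "\<dots> = coef p \<mu>"
    by (simp add: in_keys_iff)
  finally show "coef p \<mu> = coef (\<Sum>\<nu>\<in>supp p. Poly_Mapping.single \<nu> (coef p \<nu>)) \<mu>"
    by (simp add: lookup_sum)
qed

lemma laurent_mult_expand:
  "(p :: laurent) * q = (\<Sum>\<nu>\<in>supp p. \<Sum>\<mu>\<in>supp q.
      Poly_Mapping.single (\<nu> + \<mu>) (coef p \<nu> * coef q \<mu>))"
proof -
  have "p * q = (\<Sum>\<nu>\<in>supp p. Poly_Mapping.single \<nu> (coef p \<nu>)) *
      (\<Sum>\<mu>\<in>supp q. Poly_Mapping.single \<mu> (coef q \<mu>))"
    by (rule arg_cong2[where f = "(*)", OF laurent_sum_singles laurent_sum_singles])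
  then show ?thesis
    by (simp only: sum_product mult_single)
qed

lemma leval_mult [simp]:
  assumes "t \<in> torus n"
  shows "leval n (p * q) t = leval n p t * leval n q t"
  unfolding laurent_mult_expand[of p q] leval_sum leval_single mono_at_add[OF assms]
  unfolding leval_def sum_product by (simp add: mult_ac)

lemma leval_prod [simp]:
  assumes "t \<in> torus n"
  shows "leval n (\<Prod>x\<in>X. f x) t = (\<Prod>x\<in>X. leval n (f x) t)"
  by (induction X rule: infinite_finite_induct) (auto simp: assms)

text \<open>The operator \<open>t\<^sub>k \<partial>/\<partial>t\<^sub>k\<close>, which is a derivation and multiplies each monomial by its \<open>k\<close>-th
  exponent.\<close>

definition ldiff :: "nat \<Rightarrow> laurent \<Rightarrow> laurent" where
  "ldiff k p = Poly_Mapping.mapp (\<lambda>\<nu> c. of_int (\<nu> k) * c) p"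

lemma coef_ldiff [simp]: "coef (ldiff k p) \<nu> = of_int (\<nu> k) * coef p \<nu>"
  by (simp add: ldiff_def lookup_mapp when_def in_keys_iff)

lemma ldiff_add: "ldiff k (p + q) = ldiff k p + ldiff k q"
  by (rule poly_mapping_eqI) (simp add: lookup_add algebra_simps)

lemma ldiff_zero [simp]: "ldiff k 0 = 0"
  by (rule poly_mapping_eqI) simp

lemma ldiff_sum: "ldiff k (\<Sum>x\<in>X. f x) = (\<Sum>x\<in>X. ldiff k (f x))"
  by (induction X rule: infinite_finite_induct) (auto simp: ldiff_add)

lemma ldiff_single:
  "ldiff k (Poly_Mapping.single \<nu> c) = Poly_Mapping.single \<nu> (of_int (\<nu> k) * c)"
  by (rule poly_mapping_eqI) (simp add: lookup_single when_def)

lemma keys_ldiff: "supp (ldiff k p) \<subseteq> supp p"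
  by (auto simp: in_keys_iff)

lemma ldiff_mult: "ldiff k (p * q) = ldiff k p * q + p * ldiff k q"
proof -
  have 1: "ldiff k p = (\<Sum>\<nu>\<in>supp p. Poly_Mapping.single \<nu> (of_int (\<nu> k) * coef p \<nu>))" for p
    by (subst laurent_sum_singles[of p]) (simp only: ldiff_sum ldiff_single)
  have l: "ldiff k p * q = (\<Sum>\<nu>\<in>supp p. \<Sum>\<mu>\<in>supp q.
      Poly_Mapping.single (\<nu> + \<mu>) (of_int (\<nu> k) * coef p \<nu> * coef q \<mu>))"
    by (subst 1, subst laurent_sum_singles[of q]) (simp only: sum_product mult_single)
  have r: "p * ldiff k q = (\<Sum>\<nu>\<in>supp p. \<Sum>\<mu>\<in>supp q.
      Poly_Mapping.single (\<nu> + \<mu>) (coef p \<nu> * (of_int (\<mu> k) * coef q \<mu>)))"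
    by (subst 1, subst laurent_sum_singles[of p]) (simp only: sum_product mult_single)
  show ?thesis
    unfolding laurent_mult_expand[of p q] l r ldiff_sum ldiff_single
    by (simp add: sum.distrib[symmetric] single_add[symmetric] algebra_simps)
qed

text \<open>Scaling the variable \<open>t\<^sub>k\<close> by \<open>1 + s\<close> is how a diagonal one-parameter subgroup moves
  a torus element; this links \<open>ldiff\<close> to derivatives of characters.\<close>

lemma leval_ldiff:
  assumes t: "t \<in> torus n" and k: "k < n"
  shows "((\<lambda>s. leval n p (t(k := t k * (1 + s)))) has_field_derivative leval n (ldiff k p) t) (at 0)"
proof -
  have m: "mono_at n \<nu> (t(k := t k * (1 + s))) = mono_at n \<nu> t * (1 + s) powi \<nu> k" for \<nu> s
  proof -
    have "mono_at n \<nu> (t(k := t k * (1 + s)))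
       = (\<Prod>i<n. t i powi \<nu> i * (if i = k then (1 + s) powi \<nu> k else 1))"
      unfolding mono_at_def by (rule prod.cong) (auto simp: power_int_mult_distrib)
    also have "\<dots> = mono_at n \<nu> t * (1 + s) powi \<nu> k"
      using k by (simp add: prod.distrib mono_at_def)
    finally show ?thesis .
  qed
  have "((\<lambda>s. \<Sum>\<nu>\<in>supp p. coef p \<nu> * (mono_at n \<nu> t * (1 + s) powi \<nu> k)) has_field_derivative
      (\<Sum>\<nu>\<in>supp p. coef p \<nu> * (mono_at n \<nu> t * of_int (\<nu> k)))) (at 0)"
    by (auto intro!: derivative_eq_intros sum.cong simp: mult_ac)
  also have "(\<Sum>\<nu>\<in>supp p. coef p \<nu> * (mono_at n \<nu> t * of_int (\<nu> k))) = leval n (ldiff k p) t"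
    unfolding leval_superset[OF finite_keys keys_ldiff] by (rule sum.cong) (auto simp: mult_ac)
  finally show ?thesis
    by (simp add: leval_def m)
qed

lemma regular_torus: "t \<in> regular n \<Longrightarrow> t \<in> torus n"
  by (simp add: regular_def)

lemma eventually_regular_scale:
  assumes t: "t \<in> regular n" and i: "i < n"
  shows "\<forall>\<^sub>F s in nhds 0. t(i := t i * (1 + s)) \<in> regular n"
proof -
  have ti: "t i \<noteq> 0"
    using t i by (auto simp: regular_def torus_def)
  have lim: "((\<lambda>s. t i * (1 + s)) \<longlongrightarrow> t i) (nhds 0)"
    by (rule tendsto_eq_intros filterlim_ident | simp)+
  have "\<forall>\<^sub>F s in nhds 0. t i * (1 + s) \<noteq> 0 \<and> (\<forall>j\<in>{..<n} - {i}. t i * (1 + s) \<noteq> t j)"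
  proof (intro eventually_conj eventually_ball_finite ballI)
    show "\<forall>\<^sub>F s in nhds 0. t i * (1 + s) \<noteq> 0"
      by (rule tendsto_imp_eventually_ne[OF lim ti])
    fix j assume "j \<in> {..<n} - {i}"
    then have "t i \<noteq> t j"
      using t i by (auto simp: regular_def inj_on_def)
    then show "\<forall>\<^sub>F s in nhds 0. t i * (1 + s) \<noteq> t j"
      by (rule tendsto_imp_eventually_ne[OF lim])
  qed auto
  then show ?thesis
  proof (rule eventually_mono)
    fix s assume "t i * (1 + s) \<noteq> 0 \<and> (\<forall>j\<in>{..<n} - {i}. t i * (1 + s) \<noteq> t j)"
    with t i show "t(i := t i * (1 + s)) \<in> regular n"
      by (auto simp: regular_def torus_def inj_on_def) (metis DiffI lessThan_iff singletonD)+
  qed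
qed

definition bounded_exp :: "nat \<Rightarrow> (nat \<Rightarrow> int) \<Rightarrow> bool" where
  "bounded_exp n \<nu> \<longleftrightarrow> (\<forall>i\<ge>n. \<nu> i = 0)"

text \<open>Regular points form an open set, so vanishing on them passes to derivatives.\<close>

lemma leval_ldiff_zero:
  assumes "\<And>t. t \<in> regular n \<Longrightarrow> leval n p t = 0" and t: "t \<in> regular n" and i: "i < n"
  shows "leval n (ldiff i p) t = 0"
proof -
  have "((\<lambda>s. leval n p (t(i := t i * (1 + s)))) has_field_derivative 0) (at 0)"
  proof (subst DERIV_cong_ev[OF refl _ refl])
    show "\<forall>\<^sub>F s in nhds 0. leval n p (t(i := t i * (1 + s))) = 0"
      using eventually_regular_scale[OF t i] by (rule eventually_mono) (rule assms(1))
  qed simp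
  with leval_ldiff[OF regular_torus[OF t] i] show ?thesis
    by (rule DERIV_unique)
qed

text \<open>Artin's argument for the independence of characters: if two exponents differ in position \<open>i\<close>,
  then \<open>ldiff i p - \<nu>\<^sub>i p\<close> still vanishes at all regular points and has fewer terms than \<open>p\<close>.\<close>

lemma laurent_eq_0_if_vanishing:
  assumes "\<And>t. t \<in> regular n \<Longrightarrow> leval n p t = 0"
    and "\<And>\<nu>. \<nu> \<in> supp p \<Longrightarrow> bounded_exp n \<nu>"
  shows "p = 0"
  using assms
proof (induction "card (supp p)" arbitrary: p rule: less_induct)
  case less
  show ?case
  proof (rule ccontr)
    assume "p \<noteq> 0"
    then obtain \<nu> where \<nu>: "\<nu> \<in> supp p"
      by fastforce
    show False
    proof (cases "supp p = {\<nu>}")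
      case True
      define t :: "nat \<Rightarrow> complex" where "t i = of_nat (Suc i)" for i
      have t: "t \<in> regular n"
        unfolding regular_def torus_def inj_on_def t_def mem_Collect_eq of_nat_eq_iff of_nat_eq_0_iff
        by auto
      then have "coef p \<nu> * mono_at n \<nu> t = 0"
        using less.prems(1)[OF t] True by (simp add: leval_def)
      with mono_at_nonzero[OF regular_torus[OF t]] \<nu> show False
        by (simp add: in_keys_iff)
    next
      case False
      then obtain \<mu> where \<mu>: "\<mu> \<in> supp p" "\<mu> \<noteq> \<nu>"
        using \<nu> by auto
      then obtain i where i: "\<mu> i \<noteq> \<nu> i"
        by blast
      have "i < n"
        using less.prems(2)[OF \<nu>] less.prems(2)[OF \<mu>(1)] i by (auto simp: bounded_exp_def not_le[symmetric])
      define q where "q = ldiff i p - Poly_Mapping.single 0 (of_int (\<nu> i)) * p"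
      have c: "coef q \<kappa> = of_int (\<kappa> i - \<nu> i) * coef p \<kappa>" for \<kappa>
        unfolding q_def mult_map_scale_conv_mult[symmetric]
        by (simp add: lookup_minus map.rep_eq when_def algebra_simps)
      have sub: "supp q \<subseteq> supp p - {\<nu>}"
        by (auto simp: in_keys_iff c)
      then have "card (supp q) < card (supp p)"
        using \<nu> by (intro psubset_card_mono) auto
      then have "q = 0"
      proof (rule less.hyps)
        fix t assume t: "t \<in> regular n"
        then show "leval n q t = 0"
          using leval_ldiff_zero[OF less.prems(1) t \<open>i < n\<close>] less.prems(1)[OF t] regular_torus[OF t]
          by (simp add: q_def)
      qed (use sub less.prems(2) in auto)
      then have "coef q \<mu> = 0"
        by simp
      with c[of \<mu>] i \<mu> show False
        by (simp add: in_keys_iff)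
    qed
  qed
qed

section \<open>Alternating Laurent polynomials and leading exponents\<close>

definition strictly_decreasing :: "nat \<Rightarrow> (nat \<Rightarrow> int) \<Rightarrow> bool" where
  "strictly_decreasing n \<nu> \<longleftrightarrow> (\<forall>i. Suc i < n \<longrightarrow> \<nu> (Suc i) < \<nu> i)"

lemma strictly_decreasing_less:
  assumes "strictly_decreasing n \<nu>" "i < j" "j < n"
  shows "\<nu> j < \<nu> i"
  using assms(2,3)
proof (induction j)
  case (Suc j)
  have "\<nu> (Suc j) < \<nu> j"
    using assms(1) Suc.prems by (simp add: strictly_decreasing_def)
  with Suc show ?case
    by (cases "i = j") auto
qed simp

abbreviation adjacent_swap :: "nat \<Rightarrow> nat \<Rightarrow> nat" where
  "adjacent_swap i \<equiv> Transposition.transpose i (Suc i)"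

lemma adjacent_swap_permutes: "Suc i < n \<Longrightarrow> adjacent_swap i permutes {..<n}"
  by (rule permutes_swap_id) auto

lemma adjacent_swap_bound: "Suc i < n \<Longrightarrow> adjacent_swap i j < n \<longleftrightarrow> j < n"
  by (auto simp: transpose_def)

text \<open>Adjacent transpositions generate the symmetric group, so they suffice to express that a
  polynomial changes by the sign of a permutation of the variables.\<close>

definition alternating :: "nat \<Rightarrow> laurent \<Rightarrow> bool" where
  "alternating n p \<longleftrightarrow> (\<forall>i t. Suc i < n \<longrightarrow> t \<in> regular n \<longrightarrow> leval n p (t \<circ> adjacent_swap i) = - leval n p t)"

lemma alternating_coef:
  assumes a: "alternating n p" and b: "\<And>\<nu>. \<nu> \<in> supp p \<Longrightarrow> bounded_exp n \<nu>" and i: "Suc i < n"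
  shows "coef p (\<nu> \<circ> adjacent_swap i) = - coef p \<nu>"
proof -
  let ?f = "\<lambda>\<nu> :: nat \<Rightarrow> int. \<nu> \<circ> adjacent_swap i"
  have ff: "?f (?f \<nu>) = \<nu>" for \<nu>
    by (simp add: comp_assoc)
  then have inj: "inj ?f"
    by (metis injI)
  have m: "mono_at n (?f \<nu>) t = mono_at n \<nu> (t \<circ> adjacent_swap i)" for \<nu> t
    unfolding mono_at_def
    by (subst prod.permute[OF adjacent_swap_permutes[OF i]]) (simp add: comp_def)
  let ?q = "Poly_Mapping.map_key ?f p"
  have c: "coef ?q \<nu> = coef p (?f \<nu>)" for \<nu>
    by (simp add: map_key.rep_eq[OF inj])
  have s: "supp ?q = ?f ` supp p"
    using ff by (force simp: in_keys_iff c image_iff)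
  have e: "leval n ?q t = leval n p (t \<circ> adjacent_swap i)" for t
    unfolding leval_def s
    by (subst sum.reindex) (auto intro: inj_on_subset[OF inj] simp: c m comp_assoc)
  have "p + ?q = 0"
  proof (rule laurent_eq_0_if_vanishing)
    show "leval n (p + ?q) t = 0" if "t \<in> regular n" for t
    proof -
      have "leval n p (t \<circ> adjacent_swap i) = - leval n p t"
        using a that i by (simp only: alternating_def)
      then show ?thesis
        by (simp only: leval_add e) simp
    qed
    show "bounded_exp n \<nu>" if "\<nu> \<in> supp (p + ?q)" for \<nu>
    proof -
      consider "\<nu> \<in> supp p" | \<mu> where "\<mu> \<in> supp p" "\<nu> = ?f \<mu>"
        using keys_add[of p ?q] \<open>\<nu> \<in> supp (p + ?q)\<close> unfolding s by blast
      then show ?thesis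
      proof cases
        case 2
        then have "bounded_exp n \<mu>"
          using b by simp
        then show ?thesis
          unfolding 2(2) bounded_exp_def using i by (auto simp: transpose_def)
      qed (rule b)
    qed
  qed
  then have "coef (p + ?q) \<nu> = 0"
    by simp
  then have "coef p \<nu> + coef p (?f \<nu>) = 0"
    by (simp only: lookup_add c)
  then show ?thesis
    by (rule minus_unique[symmetric])
qed

text \<open>Among all exponents that occur take one which maximizes the linear functional
  \<open>\<Sum>\<^sub>j (n - j) \<nu>\<^sub>j\<close>. Swapping two adjacent entries in the wrong order would increase it, and two
  equal adjacent entries would force the coefficient to be its own negative.\<close>

lemma alternating_eq_0_if_no_strictly_decreasing:
  assumes a: "alternating n p" and b: "\<And>\<nu>. \<nu> \<in> supp p \<Longrightarrow> bounded_exp n \<nu>"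
    and no: "\<And>\<nu>. \<nu> \<in> supp p \<Longrightarrow> \<not> strictly_decreasing n \<nu>"
  shows "p = 0"
proof (rule ccontr)
  assume "p \<noteq> 0"
  then have ne: "supp p \<noteq> {}"
    by auto
  define ht where "ht \<nu> = (\<Sum>j<n. (int n - int j) * \<nu> j)" for \<nu> :: "nat \<Rightarrow> int"
  have "Max (ht ` supp p) \<in> ht ` supp p"
    using ne by (intro Max_in) auto
  then obtain \<nu> where \<nu>: "\<nu> \<in> supp p" and eq: "ht \<nu> = Max (ht ` supp p)"
    by auto
  then have max: "ht \<mu> \<le> ht \<nu>" if "\<mu> \<in> supp p" for \<mu>
    using that by simp
  obtain i where i: "Suc i < n" "\<nu> i \<le> \<nu> (Suc i)"
    using no[OF \<nu>] by (auto simp: strictly_decreasing_def not_less)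
  have c: "coef p (\<nu> \<circ> adjacent_swap i) = - coef p \<nu>"
    by (rule alternating_coef[OF a b i(1)])
  then have "\<nu> \<circ> adjacent_swap i \<in> supp p"
    using \<nu> by (simp add: in_keys_iff)
  then have le: "ht (\<nu> \<circ> adjacent_swap i) \<le> ht \<nu>"
    by (rule max)
  have "ht (\<nu> \<circ> adjacent_swap i) - ht \<nu> = (\<Sum>j<n. (int n - int j) * (\<nu> (adjacent_swap i j) - \<nu> j))"
    by (simp add: ht_def sum_subtractf algebra_simps)
  also have "\<dots> = (\<Sum>j\<in>{i, Suc i}. (int n - int j) * (\<nu> (adjacent_swap i j) - \<nu> j))"
    using i(1) by (intro sum.mono_neutral_right) (auto simp: transpose_def)
  also have "\<dots> = (int n - int i) * (\<nu> (Suc i) - \<nu> i) + (int n - int (Suc i)) * (\<nu> i - \<nu> (Suc i))"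
    by simp
  also have "\<dots> = \<nu> (Suc i) - \<nu> i"
    by (simp add: algebra_simps)
  finally have "\<nu> (Suc i) = \<nu> i"
    using le i by simp
  then have "\<nu> \<circ> adjacent_swap i = \<nu>"
    by (auto simp: transpose_def fun_eq_iff)
  with c \<nu> show False
    by (simp add: in_keys_iff)
qed

definition partial_sum :: "nat \<Rightarrow> (nat \<Rightarrow> int) \<Rightarrow> int" where
  "partial_sum p \<nu> = (\<Sum>i<p. \<nu> i)"

text \<open>The dominance order, in terms of partial sums: \<open>\<nu> - \<kappa>\<close> is a sum of positive roots.\<close>

definition lower :: "nat \<Rightarrow> (nat \<Rightarrow> int) \<Rightarrow> (nat \<Rightarrow> int) \<Rightarrow> bool" where
  "lower n \<nu> \<kappa> \<longleftrightarrow> bounded_exp n \<kappa> \<and> (\<forall>p\<le>n. partial_sum p \<kappa> \<le> partial_sum p \<nu>) \<and> partial_sum n \<kappa> = partial_sum n \<nu>"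

definition strictly_lower :: "nat \<Rightarrow> (nat \<Rightarrow> int) \<Rightarrow> (nat \<Rightarrow> int) \<Rightarrow> bool" where
  "strictly_lower n \<nu> \<kappa> \<longleftrightarrow> lower n \<nu> \<kappa> \<and> (\<exists>p\<le>n. partial_sum p \<kappa> < partial_sum p \<nu>)"

definition leading :: "nat \<Rightarrow> (nat \<Rightarrow> int) \<Rightarrow> laurent \<Rightarrow> bool" where
  "leading n \<nu> p \<longleftrightarrow> bounded_exp n \<nu> \<and> (\<forall>\<kappa>\<in>supp (p - Poly_Mapping.single \<nu> 1). strictly_lower n \<nu> \<kappa>)"

lemma partial_sum_add [simp]: "partial_sum p (\<nu> + \<mu>) = partial_sum p \<nu> + partial_sum p \<mu>"
  by (simp add: partial_sum_def sum.distrib)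

lemma bounded_exp_add: "bounded_exp n \<nu> \<Longrightarrow> bounded_exp n \<mu> \<Longrightarrow> bounded_exp n (\<nu> + \<mu>)"
  by (simp add: bounded_exp_def)

lemma lower_refl: "bounded_exp n \<nu> \<Longrightarrow> lower n \<nu> \<nu>"
  by (simp add: lower_def)

lemma strictly_lower_add: "strictly_lower n \<nu> \<kappa> \<Longrightarrow> lower n \<nu>' \<kappa>' \<Longrightarrow> strictly_lower n (\<nu> + \<nu>') (\<kappa> + \<kappa>')"
  unfolding strictly_lower_def lower_def partial_sum_add
  by (metis add_less_le_mono add_mono bounded_exp_add)

lemma strictly_lower_irrefl: "\<not> strictly_lower n \<nu> \<nu>"
  by (simp add: strictly_lower_def)

lemma leading_coef: "leading n \<nu> p \<Longrightarrow> coef p \<nu> = 1"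
proof -
  assume "leading n \<nu> p"
  then have "\<nu> \<notin> supp (p - Poly_Mapping.single \<nu> 1)"
    using strictly_lower_irrefl by (auto simp: leading_def)
  then show ?thesis
    by (simp add: in_keys_iff lookup_minus)
qed

lemma leading_lower:
  assumes "leading n \<nu> p" "\<kappa> \<in> supp p"
  shows "lower n \<nu> \<kappa>"
proof (cases "\<kappa> = \<nu>")
  case True
  then show ?thesis using assms by (simp add: leading_def lower_refl)
next
  case False
  then have "\<kappa> \<in> supp (p - Poly_Mapping.single \<nu> 1)"
    using assms(2) by (simp add: in_keys_iff lookup_minus lookup_single)
  then show ?thesis
    using assms(1) by (auto simp: leading_def strictly_lower_def)
qed

lemma leading_mult:
  assumes "leading n \<nu> p" "leading n \<mu> q"
  shows "leading n (\<nu> + \<mu>) (p * q)"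
proof -
  let ?p = "p - Poly_Mapping.single \<nu> 1" and ?q = "q - Poly_Mapping.single \<mu> 1"
  have e: "p * q - Poly_Mapping.single (\<nu> + \<mu>) 1 = ?p * q + Poly_Mapping.single \<nu> 1 * ?q"
    by (simp only: left_diff_distrib right_diff_distrib mult_single mult_1_left add_diff_eq diff_add_cancel)
  show ?thesis
    unfolding leading_def e
  proof (intro conjI ballI)
    show "bounded_exp n (\<nu> + \<mu>)"
      using assms by (simp add: leading_def bounded_exp_add)
    fix \<kappa> assume "\<kappa> \<in> supp (?p * q + Poly_Mapping.single \<nu> 1 * ?q)"
    then have "\<kappa> \<in> supp (?p * q) \<or> \<kappa> \<in> supp (Poly_Mapping.single \<nu> 1 * ?q)"
      using keys_add[of "?p * q" "Poly_Mapping.single \<nu> 1 * ?q"] by blast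
    then show "strictly_lower n (\<nu> + \<mu>) \<kappa>"
    proof
      assume "\<kappa> \<in> supp (?p * q)"
      then obtain a b where "a \<in> supp ?p" "b \<in> supp q" and \<kappa>: "\<kappa> = a + b"
        using keys_mult[of ?p q] by blast
      then have "strictly_lower n \<nu> a" "lower n \<mu> b"
        using assms(1) leading_lower[OF assms(2)] unfolding leading_def by blast+
      then show ?thesis
        unfolding \<kappa> by (rule strictly_lower_add)
    next
      assume "\<kappa> \<in> supp (Poly_Mapping.single \<nu> 1 * ?q)"
      then obtain a b where a: "a \<in> supp (Poly_Mapping.single \<nu> (1::complex))"
          and b: "b \<in> supp ?q" and \<kappa>: "\<kappa> = a + b"
        using keys_mult[of "Poly_Mapping.single \<nu> 1" ?q] by blast
      have "a = \<nu>"
        using a by simp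
      then have \<kappa>': "\<kappa> = b + \<nu>"
        unfolding \<kappa> by (simp only: add.commute)
      have "strictly_lower n \<mu> b" "lower n \<nu> \<nu>"
        using assms b by (auto simp: leading_def intro: lower_refl)
      then have "strictly_lower n (\<mu> + \<nu>) \<kappa>"
        unfolding \<kappa>' by (rule strictly_lower_add)
      then show ?thesis
        by (simp only: add.commute)
    qed
  qed
qed

lemma leading_one: "leading n 0 1"
  unfolding leading_def bounded_exp_def single_one by (metis diff_self empty_iff keys_zero zero_fun_apply)

lemma leading_prod:
  assumes "finite X" "\<And>x. x \<in> X \<Longrightarrow> leading n (\<nu> x) (f x)"
  shows "leading n (\<Sum>x\<in>X. \<nu> x) (\<Prod>x\<in>X. f x)"
  using assms
proof (induction X rule: finite_induct)
  case empty
  show ?case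
    unfolding sum.empty prod.empty by (rule leading_one)
next
  case (insert x X)
  show ?case
    unfolding sum.insert[OF insert.hyps] prod.insert[OF insert.hyps]
    by (rule leading_mult) (use insert in auto)
qed

section \<open>Alternants and the Vandermonde product\<close>

lemma alternating_diff: "alternating n p \<Longrightarrow> alternating n q \<Longrightarrow> alternating n (p - q)"
  unfolding alternating_def by simp

definition alternant :: "nat \<Rightarrow> (nat \<Rightarrow> int) \<Rightarrow> laurent" where
  "alternant n l = (\<Sum>\<sigma> | \<sigma> permutes {..<n}. Poly_Mapping.single (l \<circ> \<sigma>) (of_int (sign \<sigma>)))"

lemma leval_alternant:
  "leval n (alternant n l) t = (\<Sum>\<sigma> | \<sigma> permutes {..<n}. of_int (sign \<sigma>) * (\<Prod>i<n. t i powi l (\<sigma> i)))"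
  by (simp add: alternant_def mono_at_def)

lemma leval_alternant_det:
  "leval n (alternant n l) t = det (mat n n (\<lambda>(i, j). t i powi l j))"
  unfolding leval_alternant by (subst det_def'[of _ n]) (auto simp: atLeast0LessThan intro!: sum.cong prod.cong)

lemma supp_alternant: "\<nu> \<in> supp (alternant n l) \<Longrightarrow> \<exists>\<sigma>. \<sigma> permutes {..<n} \<and> \<nu> = l \<circ> \<sigma>"
proof -
  assume "\<nu> \<in> supp (alternant n l)"
  then have "coef (alternant n l) \<nu> \<noteq> 0"
    by (simp add: in_keys_iff)
  then obtain \<sigma> where "\<sigma> \<in> {\<sigma>. \<sigma> permutes {..<n}}"
    "coef (Poly_Mapping.single (l \<circ> \<sigma>) (of_int (sign \<sigma>) :: complex)) \<nu> \<noteq> 0"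
    unfolding alternant_def lookup_sum by (rule sum.not_neutral_contains_not_neutral)
  then show ?thesis
    by (auto simp: lookup_single when_def split: if_splits)
qed

lemma strictly_decreasing_comp_permutes:
  assumes "strictly_decreasing n l" "\<sigma> permutes {..<n}" "strictly_decreasing n (l \<circ> \<sigma>)"
  shows "\<sigma> = id"
proof (rule permutes_natset_ge[OF assms(2)], rule ballI)
  have lt: "\<sigma> i < \<sigma> (Suc i)" if "Suc i < n" for i
  proof (rule ccontr)
    assume "\<not> \<sigma> i < \<sigma> (Suc i)"
    moreover have "\<sigma> i \<noteq> \<sigma> (Suc i)"
      using permutes_inj[OF assms(2)] by (metis injD n_not_Suc_n)
    ultimately have "\<sigma> (Suc i) < \<sigma> i"
      by simp
    moreover have "\<sigma> i < n"
      using permutes_in_image[OF assms(2), of i] that by simp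
    ultimately have "l (\<sigma> i) < l (\<sigma> (Suc i))"
      using strictly_decreasing_less[OF assms(1)] by blast
    moreover have "l (\<sigma> (Suc i)) < l (\<sigma> i)"
      using assms(3) that by (simp add: strictly_decreasing_def)
    ultimately show False
      by simp
  qed
  fix i assume "i \<in> {..<n}"
  then have "i < n" by simp
  then show "i \<le> \<sigma> i"
  proof (induction i)
    case (Suc i)
    then show ?case
      using lt[of i] by simp
  qed simp
qed

lemma coef_alternant:
  assumes "strictly_decreasing n l"
  shows "coef (alternant n l) l = 1"
proof -
  have "coef (alternant n l) l
      = (\<Sum>\<sigma> | \<sigma> permutes {..<n}. if \<sigma> = id then 1 else 0)"
    unfolding alternant_def lookup_sum
  proof (rule sum.cong[OF refl])
    fix \<sigma> assume "\<sigma> \<in> {\<sigma>. \<sigma> permutes {..<n}}"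
    then have "l \<circ> \<sigma> = l \<Longrightarrow> \<sigma> = id"
      using strictly_decreasing_comp_permutes[OF assms, of \<sigma>] assms by simp
    then show "coef (Poly_Mapping.single (l \<circ> \<sigma>) (of_int (sign \<sigma>))) l = (if \<sigma> = id then 1 else 0 :: complex)"
      by (auto simp: lookup_single when_def)
  qed
  also have "\<dots> = 1"
    by (simp add: finite_permutations permutes_id)
  finally show ?thesis .
qed

lemma bounded_exp_permutes:
  "bounded_exp n l \<Longrightarrow> \<sigma> permutes {..<n} \<Longrightarrow> bounded_exp n (l \<circ> \<sigma>)"
  unfolding bounded_exp_def by (simp add: permutes_not_in)

lemma alternating_alternant: "alternating n (alternant n l)"
  unfolding alternating_def
proof (intro allI impI)
  fix i t assume i: "Suc i < n"
  note s = adjacent_swap_permutes[OF i]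
  have "leval n (alternant n l) (t \<circ> adjacent_swap i)
      = (\<Sum>\<sigma> | \<sigma> permutes {..<n}. of_int (sign (\<sigma> \<circ> adjacent_swap i)) * (\<Prod>j<n. t (adjacent_swap i j) powi l (\<sigma> (adjacent_swap i j))))"
    unfolding leval_alternant
    by (subst sum_permutations_compose_right[OF s]) simp
  also have "\<dots> = (\<Sum>\<sigma> | \<sigma> permutes {..<n}. - (of_int (sign \<sigma>) * (\<Prod>j<n. t j powi l (\<sigma> j))))"
  proof (rule sum.cong[OF refl])
    fix \<sigma> assume "\<sigma> \<in> {\<sigma>. \<sigma> permutes {..<n}}"
    then have "permutation \<sigma>"
      using permutation_permutes by blast
    then have "sign (\<sigma> \<circ> adjacent_swap i) = - sign \<sigma>"
      by (simp add: sign_compose permutation_swap_id sign_swap_id)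
    moreover have "(\<Prod>j<n. t (adjacent_swap i j) powi l (\<sigma> (adjacent_swap i j))) = (\<Prod>j<n. t j powi l (\<sigma> j))"
      using prod.permute[OF s, of "\<lambda>j. t j powi l (\<sigma> j)"] by (simp add: comp_def)
    ultimately show "of_int (sign (\<sigma> \<circ> adjacent_swap i)) * (\<Prod>j<n. t (adjacent_swap i j) powi l (\<sigma> (adjacent_swap i j)))
        = - (of_int (sign \<sigma>) * (\<Prod>j<n. t j powi l (\<sigma> j)))"
      by simp
  qed
  also have "\<dots> = - leval n (alternant n l) t"
    unfolding leval_alternant by (rule sum_negf)
  finally show "leval n (alternant n l) (t \<circ> adjacent_swap i) = - leval n (alternant n l) t" .
qed

text \<open>The difference of the two sides is alternating. A strictly decreasing exponent in its support
  must be \<open>l\<close>, where both sides have coefficient 1.\<close>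

lemma alternating_eq_alternant:
  assumes lead: "leading n l p" and a: "alternating n p" and l: "strictly_decreasing n l"
    and only: "\<And>\<nu>. \<nu> \<in> supp p \<Longrightarrow> strictly_decreasing n \<nu> \<Longrightarrow> \<nu> = l"
  shows "p = alternant n l"
proof -
  have bl: "bounded_exp n l"
    using lead by (simp add: leading_def)
  have supp: "\<nu> \<in> supp p \<or> \<nu> \<in> supp (alternant n l)" if "\<nu> \<in> supp (p - alternant n l)" for \<nu>
    using that by (auto simp: in_keys_iff lookup_minus)
  have "p - alternant n l = 0"
  proof (rule alternating_eq_0_if_no_strictly_decreasing)
    show "alternating n (p - alternant n l)"
      by (rule alternating_diff[OF a alternating_alternant])
    fix \<nu> assume \<nu>: "\<nu> \<in> supp (p - alternant n l)"
    show "bounded_exp n \<nu>"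
      using supp[OF \<nu>]
    proof
      assume "\<nu> \<in> supp p"
      then show ?thesis
        using leading_lower[OF lead] unfolding lower_def by blast
    next
      assume "\<nu> \<in> supp (alternant n l)"
      then show ?thesis
        using supp_alternant bounded_exp_permutes[OF bl] by blast
    qed
    show "\<not> strictly_decreasing n \<nu>"
    proof
      assume d: "strictly_decreasing n \<nu>"
      have "\<nu> = l"
        using supp[OF \<nu>]
      proof
        assume "\<nu> \<in> supp (alternant n l)"
        then obtain \<sigma> where \<sigma>: "\<sigma> permutes {..<n}" "\<nu> = l \<circ> \<sigma>"
          using supp_alternant by blast
        then have "\<sigma> = id"
          using strictly_decreasing_comp_permutes[OF l \<sigma>(1)] d by simp
        with \<sigma> show ?thesis by simp
      qed (use only d in blast)
      then have "coef (p - alternant n l) \<nu> = 0"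
        by (simp add: lookup_minus leading_coef[OF lead] coef_alternant[OF l])
      then show False
        using \<nu> by (simp add: in_keys_iff)
    qed
  qed
  then show ?thesis
    by simp
qed

definition unit_exp :: "nat \<Rightarrow> nat \<Rightarrow> int" where
  "unit_exp i = (\<lambda>k. if k = i then 1 else 0)"

definition pairs :: "nat \<Rightarrow> (nat \<times> nat) set" where
  "pairs n = {(i, j). i < j \<and> j < n}"

lemma finite_pairs [simp]: "finite (pairs n)"
  by (rule finite_subset[of _ "{..<n} \<times> {..<n}"]) (auto simp: pairs_def)

definition vandermonde :: "nat \<Rightarrow> laurent" where
  "vandermonde n = (\<Prod>(i, j)\<in>pairs n. Poly_Mapping.single (unit_exp i) 1 - Poly_Mapping.single (unit_exp j) 1)"

definition rho_exp :: "nat \<Rightarrow> nat \<Rightarrow> int" where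
  "rho_exp n i = (if i < n then int (n - 1 - i) else 0)"

lemma mono_at_unit_exp: "i < n \<Longrightarrow> mono_at n (unit_exp i) t = t i"
proof -
  assume i: "i < n"
  have "mono_at n (unit_exp i) t = (\<Prod>k<n. if k = i then t i else 1)"
    unfolding mono_at_def unit_exp_def by (rule prod.cong) auto
  also have "\<dots> = t i"
    using i by simp
  finally show ?thesis .
qed

lemma leval_vandermonde:
  assumes "t \<in> torus n"
  shows "leval n (vandermonde n) t = (\<Prod>(i, j)\<in>pairs n. t i - t j)"
  unfolding vandermonde_def leval_prod[OF assms]
  by (rule prod.cong) (auto simp: pairs_def mono_at_unit_exp)

lemma sum_fun_apply: "(\<Sum>x\<in>X. f x) k = (\<Sum>x\<in>X. f x k)"
  for f :: "'a \<Rightarrow> 'b \<Rightarrow> 'c::comm_monoid_add"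
  by (induction X rule: infinite_finite_induct) auto

lemma sum_unit_exp_pairs: "(\<Sum>x\<in>pairs n. unit_exp (fst x)) = rho_exp n"
proof
  fix k
  have "(\<Sum>x\<in>pairs n. unit_exp (fst x) k) = (\<Sum>x\<in>pairs n. if fst x = k then 1 else 0)"
    by (rule sum.cong) (auto simp: unit_exp_def)
  also have "\<dots> = int (card {x \<in> pairs n. fst x = k})"
    by (simp add: sum.If_cases Int_def)
  also have "{x \<in> pairs n. fst x = k} = Pair k ` {Suc k..<n}"
    by (auto simp: pairs_def)
  also have "card \<dots> = n - Suc k"
    by (subst card_image) (auto simp: inj_on_def)
  finally show "(\<Sum>x\<in>pairs n. unit_exp (fst x)) k = rho_exp n k"
    by (simp add: sum_fun_apply rho_exp_def)
qed

lemma partial_sum_unit_exp: "partial_sum p (unit_exp i) = (if i < p then 1 else 0)"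
  by (simp add: partial_sum_def unit_exp_def)

lemma leading_vandermonde: "leading n (rho_exp n) (vandermonde n)"
  unfolding vandermonde_def sum_unit_exp_pairs[symmetric]
proof (rule leading_prod[OF finite_pairs])
  fix x assume "x \<in> pairs n"
  then obtain i j where x: "x = (i, j)" "i < j" "j < n"
    by (auto simp: pairs_def)
  have *: "strictly_lower n (unit_exp i) (unit_exp j)"
    unfolding strictly_lower_def lower_def partial_sum_unit_exp
  proof (intro conjI exI)
    show "bounded_exp n (unit_exp j)"
      using x by (simp add: bounded_exp_def unit_exp_def)
    show "Suc i \<le> n" "(if j < Suc i then 1 else 0) < (if i < Suc i then 1 else (0::int))"
      using x by auto
  qed (use x in auto)
  have s: "supp (- Poly_Mapping.single (unit_exp j) (1::complex)) = {unit_exp j}"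
    unfolding single_uminus[symmetric] by simp
  show "leading n (unit_exp (fst x)) (case x of (i, j) \<Rightarrow>
      Poly_Mapping.single (unit_exp i) 1 - Poly_Mapping.single (unit_exp j) 1)"
    using * x by (simp add: leading_def s) (simp add: bounded_exp_def unit_exp_def)
qed

lemma alternating_vandermonde: "alternating n (vandermonde n)"
  unfolding alternating_def
proof (intro allI impI)
  fix i t assume i: "Suc i < n" and t: "t \<in> regular n"
  have t2: "t \<circ> adjacent_swap i \<in> torus n"
    using regular_torus[OF t] i by (simp add: torus_def adjacent_swap_bound)
  let ?P = "pairs n - {(i, Suc i)}"
  have mem: "(i, Suc i) \<in> pairs n"
    using i by (simp add: pairs_def)
  let ?m = "map_prod (adjacent_swap i) (adjacent_swap i)"
  have "bij_betw ?m ?P ?P"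
  proof (rule bij_betwI[where g = ?m])
    show "?m \<in> ?P \<rightarrow> ?P"
      using i by (auto simp: pairs_def transpose_def split: if_splits)
    then show "?m \<in> ?P \<rightarrow> ?P" .
  qed auto
  then have r: "(\<Prod>x\<in>?P. (\<lambda>(a, b). t a - t b) (?m x)) = (\<Prod>(a, b)\<in>?P. t a - t b)"
    by (rule prod.reindex_bij_betw)
  have "leval n (vandermonde n) (t \<circ> adjacent_swap i) = (t (Suc i) - t i) * (\<Prod>x\<in>?P. (\<lambda>(a, b). t a - t b) (?m x))"
    unfolding leval_vandermonde[OF t2]
    by (subst prod.remove[OF finite_pairs mem]) (auto intro!: prod.cong)
  also have "\<dots> = - leval n (vandermonde n) t"
    unfolding r leval_vandermonde[OF regular_torus[OF t]]
      prod.remove[OF finite_pairs mem, of "\<lambda>(i, j). t i - t j"]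
    by (simp add: algebra_simps)
  finally show "leval n (vandermonde n) (t \<circ> adjacent_swap i) = - leval n (vandermonde n) t" .
qed

lemma strictly_decreasing_rho_exp: "strictly_decreasing n (rho_exp n)"
  unfolding strictly_decreasing_def rho_exp_def by auto

text \<open>The Vandermonde identity is another instance of this uniqueness principle. Dominance by \<open>\<rho>\<close>
  makes the last entry of an exponent nonnegative; a strictly decreasing exponent is then at least
  \<open>\<rho>\<close> in every entry, and both have the same sum.\<close>

theorem vandermonde_eq_alternant: "vandermonde n = alternant n (rho_exp n)"
proof (rule alternating_eq_alternant[OF leading_vandermonde alternating_vandermonde strictly_decreasing_rho_exp])
  fix \<nu> assume "\<nu> \<in> supp (vandermonde n)" and d: "strictly_decreasing n \<nu>"
  then have low: "lower n (rho_exp n) \<nu>"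
    using leading_lower[OF leading_vandermonde] by blast
  show "\<nu> = rho_exp n"
  proof (cases n)
    case 0
    then show ?thesis
      using low by (auto simp: lower_def bounded_exp_def rho_exp_def)
  next
    case (Suc m)
    \<comment> \<open>Induction from the last entry to the first.\<close>
    have ge: "rho_exp n (m - i) \<le> \<nu> (m - i)" for i
    proof (induction i)
      case 0
      have "partial_sum m \<nu> \<le> partial_sum m (rho_exp n)" "partial_sum (Suc m) \<nu> = partial_sum (Suc m) (rho_exp n)"
        using low Suc by (auto simp: lower_def)
      then show ?case
        by (simp add: partial_sum_def)
    next
      case (Suc i)
      show ?case
      proof (cases "i < m")
        case True
        then have "\<nu> (Suc (m - Suc i)) < \<nu> (m - Suc i)"
          using d \<open>n = Suc m\<close> by (simp add: strictly_decreasing_def)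
        with True Suc \<open>n = Suc m\<close> show ?thesis
          by (simp add: Suc_diff_Suc rho_exp_def less_Suc_eq_le)
      next
        case False
        with Suc show ?thesis by simp
      qed
    qed
    have ge': "rho_exp n i \<le> \<nu> i" if "i < n" for i
      using ge[of "m - i"] that Suc by simp
    have "\<nu> i = rho_exp n i" if i: "i < n" for i
    proof (rule ccontr)
      assume "\<nu> i \<noteq> rho_exp n i"
      then have "partial_sum n (rho_exp n) < partial_sum n \<nu>"
        unfolding partial_sum_def using ge' i by (intro sum_strict_mono_ex1) (auto intro!: bexI[of _ i] simp: less_le)
      then show False
        using low by (simp add: lower_def)
    qed
    moreover have "\<nu> i = rho_exp n i" if "\<not> i < n" for i
      using low that by (simp add: lower_def bounded_exp_def rho_exp_def)
    ultimately show ?thesis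
      by blast
  qed
qed

lemma vandermonde_det:
  assumes "t \<in> torus n"
  shows "det (mat n n (\<lambda>(i, j). t i ^ (n - 1 - j))) = (\<Prod>(i, j)\<in>pairs n. t i - t j)"
proof -
  have "det (mat n n (\<lambda>(i, j). t i ^ (n - 1 - j))) = leval n (alternant n (rho_exp n)) t"
    unfolding leval_alternant_det by (rule arg_cong[where f = det], rule eq_matI) (auto simp: rho_exp_def simp del: of_nat_diff)
  then show ?thesis
    by (simp only: vandermonde_eq_alternant[symmetric] leval_vandermonde[OF assms])
qed

section \<open>Derivatives of matrix valued and of regular functions\<close>

lemma in_GL_iff: "g \<in> carrier (GL n) \<longleftrightarrow> g \<in> carrier_mat n n \<and> det g \<noteq> 0"
proof
  assume "g \<in> carrier (GL n)"
  then have u: "g \<in> Units (ring_mat TYPE(complex) n ())"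
    by (simp add: GL_def units_of_carrier)
  then have "g \<in> carrier_mat n n"
    by (simp add: Units_def ring_mat_def)
  with unit_imp_det_non_zero[OF u] show "g \<in> carrier_mat n n \<and> det g \<noteq> 0"
    by simp
next
  assume "g \<in> carrier_mat n n \<and> det g \<noteq> 0"
  then show "g \<in> carrier (GL n)"
    using det_non_zero_imp_unit[of g n "()"] by (simp add: GL_def units_of_carrier)
qed

lemma GL_inverse:
  assumes "g \<in> carrier (GL n)"
  obtains h where "h \<in> carrier (GL n)" "g * h = 1\<^sub>m n" "h * g = 1\<^sub>m n"
proof -
  have "g \<in> Units (ring_mat TYPE(complex) n ())"
    using assms by (simp add: GL_def units_of_carrier)
  then obtain h where h: "h \<in> carrier_mat n n" "g * h = 1\<^sub>m n" "h * g = 1\<^sub>m n"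
    by (auto simp: Units_def ring_mat_def)
  have "det g * det h = 1"
    using det_mult[of g n h] h assms by (simp add: in_GL_iff)
  then have "h \<in> carrier (GL n)"
    using h by (auto simp: in_GL_iff)
  with h that show thesis by blast
qed

lemma one_in_GL: "1\<^sub>m n \<in> carrier (GL n)"
  by (simp add: in_GL_iff)

lemma mult_in_GL: "g \<in> carrier (GL n) \<Longrightarrow> h \<in> carrier (GL n) \<Longrightarrow> g * h \<in> carrier (GL n)"
  by (auto simp: in_GL_iff det_mult)

definition tr :: "complex mat \<Rightarrow> complex" where
  "tr A = (\<Sum>i<dim_row A. A $$ (i, i))"

lemma index_mult_sum:
  assumes "A \<in> carrier_mat m k" "B \<in> carrier_mat k l" "a < m" "b < l"
  shows "(A * B) $$ (a, b) = (\<Sum>c<k. A $$ (a, c) * B $$ (c, b))"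
  using assms by (auto simp: scalar_prod_def atLeast0LessThan intro!: sum.cong)

lemma tr_comm:
  assumes A: "A \<in> carrier_mat d d" and B: "B \<in> carrier_mat d d"
  shows "tr (A * B) = tr (B * A)"
proof -
  have "tr (A * B) = (\<Sum>i<d. \<Sum>c<d. A $$ (i, c) * B $$ (c, i))"
    unfolding tr_def using A B by (auto simp: index_mult_sum[OF A B] intro!: sum.cong simp del: index_mult_mat(1))
  also have "\<dots> = (\<Sum>c<d. \<Sum>i<d. B $$ (c, i) * A $$ (i, c))"
    by (subst sum.swap) (simp add: mult.commute)
  also have "\<dots> = tr (B * A)"
    unfolding tr_def using A B by (auto simp: index_mult_sum[OF B A] intro!: sum.cong simp del: index_mult_mat(1))
  finally show ?thesis .
qed

lemma tr_add: "A \<in> carrier_mat d d \<Longrightarrow> B \<in> carrier_mat d d \<Longrightarrow> tr (A + B) = tr A + tr B"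
  by (simp add: tr_def sum.distrib)

lemma tr_minus: "A \<in> carrier_mat d d \<Longrightarrow> B \<in> carrier_mat d d \<Longrightarrow> tr (A - B) = tr A - tr B"
  by (simp add: tr_def sum_subtractf)

lemma tr_smult: "A \<in> carrier_mat d d \<Longrightarrow> tr (c \<cdot>\<^sub>m A) = c * tr A"
  by (simp add: tr_def sum_distrib_left)

text \<open>Entrywise derivative at 0. The values of a representation are meaningful only on invertible
  matrices, hence only for parameters near 0; this is why the dimensions are required
  eventually.\<close>

definition mderiv :: "nat \<Rightarrow> (complex \<Rightarrow> complex mat) \<Rightarrow> complex mat \<Rightarrow> bool" where
  "mderiv d F D \<longleftrightarrow> (\<forall>\<^sub>F s in nhds 0. F s \<in> carrier_mat d d) \<and> D \<in> carrier_mat d d \<and>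
     (\<forall>a<d. \<forall>b<d. ((\<lambda>s. F s $$ (a, b)) has_field_derivative D $$ (a, b)) (at 0))"

lemma mderiv_carrier: "mderiv d F D \<Longrightarrow> D \<in> carrier_mat d d"
  by (simp add: mderiv_def)

lemma mderiv_at: "mderiv d F D \<Longrightarrow> F 0 \<in> carrier_mat d d"
  unfolding mderiv_def by (auto dest: eventually_nhds_x_imp_x)

lemma mderiv_unique: "mderiv d F D \<Longrightarrow> mderiv d F D' \<Longrightarrow> D = D'"
proof (rule eq_matI)
  assume *: "mderiv d F D" "mderiv d F D'"
  then show "dim_row D = dim_row D'" "dim_col D = dim_col D'"
    by (auto simp: mderiv_def)
  fix i j assume "i < dim_row D'" "j < dim_col D'"
  with * have "((\<lambda>s. F s $$ (i, j)) has_field_derivative D $$ (i, j)) (at 0)"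
    "((\<lambda>s. F s $$ (i, j)) has_field_derivative D' $$ (i, j)) (at 0)"
    by (auto simp: mderiv_def)
  then show "D $$ (i, j) = D' $$ (i, j)"
    by (rule DERIV_unique)
qed

lemma DERIV_eventually_eq:
  "(f has_field_derivative D) (at x) \<Longrightarrow> \<forall>\<^sub>F s in nhds x. g s = f s \<Longrightarrow> (g has_field_derivative D) (at x)"
  using DERIV_cong_ev[of x x g f D D] by simp

lemma mderiv_cong:
  assumes ev: "\<forall>\<^sub>F s in nhds 0. F s = G s" and F: "mderiv d F D"
  shows "mderiv d G D"
  unfolding mderiv_def
proof (intro conjI allI impI)
  have "\<forall>\<^sub>F s in nhds 0. F s \<in> carrier_mat d d"
    using F by (simp add: mderiv_def)
  with ev show "\<forall>\<^sub>F s in nhds 0. G s \<in> carrier_mat d d"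
    by eventually_elim simp
  show "D \<in> carrier_mat d d"
    by (rule mderiv_carrier[OF F])
  fix a b assume "a < d" "b < d"
  then have "((\<lambda>s. F s $$ (a, b)) has_field_derivative D $$ (a, b)) (at 0)"
    using F by (simp add: mderiv_def)
  moreover have "\<forall>\<^sub>F s in nhds 0. G s $$ (a, b) = F s $$ (a, b)"
    using ev by eventually_elim simp
  ultimately show "((\<lambda>s. G s $$ (a, b)) has_field_derivative D $$ (a, b)) (at 0)"
    by (rule DERIV_eventually_eq)
qed

lemma mderiv_mult:
  assumes F: "mderiv d F D" and G: "mderiv d G E"
  shows "mderiv d (\<lambda>s. F s * G s) (D * G 0 + F 0 * E)"
  unfolding mderiv_def
proof (intro conjI allI impI)
  note c = mderiv_carrier[OF F] mderiv_carrier[OF G] mderiv_at[OF F] mderiv_at[OF G]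
  have evF: "\<forall>\<^sub>F s in nhds 0. F s \<in> carrier_mat d d" and evG: "\<forall>\<^sub>F s in nhds 0. G s \<in> carrier_mat d d"
    using F G by (simp_all add: mderiv_def)
  then have ev: "\<forall>\<^sub>F s in nhds 0. F s \<in> carrier_mat d d \<and> G s \<in> carrier_mat d d"
    by (rule eventually_conj)
  then show "\<forall>\<^sub>F s in nhds 0. F s * G s \<in> carrier_mat d d"
    by eventually_elim auto
  show "D * G 0 + F 0 * E \<in> carrier_mat d d"
    using c by auto
  fix a b assume ab: "a < d" "b < d"
  have "((\<lambda>s. \<Sum>k<d. F s $$ (a, k) * G s $$ (k, b)) has_field_derivative
      (\<Sum>k<d. D $$ (a, k) * G 0 $$ (k, b) + E $$ (k, b) * F 0 $$ (a, k))) (at 0)"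
    using F G ab unfolding mderiv_def by (intro DERIV_sum DERIV_mult) auto
  also have "(\<Sum>k<d. D $$ (a, k) * G 0 $$ (k, b) + E $$ (k, b) * F 0 $$ (a, k)) = (D * G 0 + F 0 * E) $$ (a, b)"
    using c ab by (simp add: index_mult_sum[of _ d d _ d] sum.distrib mult.commute del: index_mult_mat(1))
  finally have *: "((\<lambda>s. \<Sum>k<d. F s $$ (a, k) * G s $$ (k, b)) has_field_derivative
      (D * G 0 + F 0 * E) $$ (a, b)) (at 0)" .
  have "\<forall>\<^sub>F s in nhds 0. (F s * G s) $$ (a, b) = (\<Sum>k<d. F s $$ (a, k) * G s $$ (k, b))"
    using ev by eventually_elim (rule index_mult_sum, use ab in auto)
  with * show "((\<lambda>s. (F s * G s) $$ (a, b)) has_field_derivative (D * G 0 + F 0 * E) $$ (a, b)) (at 0)"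
    by (rule DERIV_eventually_eq)
qed

lemma mderiv_const: "A \<in> carrier_mat d d \<Longrightarrow> mderiv d (\<lambda>s. A) (0\<^sub>m d d)"
  by (simp add: mderiv_def)

lemma mderiv_mult_left:
  "A \<in> carrier_mat d d \<Longrightarrow> mderiv d F D \<Longrightarrow> mderiv d (\<lambda>s. A * F s) (A * D)"
  using mderiv_mult[OF mderiv_const, of A d F D] mderiv_carrier[of d F D] mderiv_at[of d F D] by simp

lemma mderiv_mult_right:
  "A \<in> carrier_mat d d \<Longrightarrow> mderiv d F D \<Longrightarrow> mderiv d (\<lambda>s. F s * A) (D * A)"
  using mderiv_mult[OF _ mderiv_const, of d F D A] mderiv_carrier[of d F D] mderiv_at[of d F D] by simp

lemma mderiv_tr:
  assumes F: "mderiv d F D"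
  shows "((\<lambda>s. tr (F s)) has_field_derivative tr D) (at 0)"
proof -
  have "((\<lambda>s. \<Sum>a<d. F s $$ (a, a)) has_field_derivative (\<Sum>a<d. D $$ (a, a))) (at 0)"
    using F unfolding mderiv_def by (intro DERIV_sum) auto
  then have *: "((\<lambda>s. \<Sum>a<d. F s $$ (a, a)) has_field_derivative tr D) (at 0)"
    using mderiv_carrier[OF F] by (simp add: tr_def)
  have "\<forall>\<^sub>F s in nhds 0. F s \<in> carrier_mat d d"
    using F by (simp add: mderiv_def)
  then have "\<forall>\<^sub>F s in nhds 0. tr (F s) = (\<Sum>a<d. F s $$ (a, a))"
    by eventually_elim (auto simp: tr_def)
  with * show ?thesis
    by (rule DERIV_eventually_eq)
qed

definition line :: "nat \<Rightarrow> complex mat \<Rightarrow> complex \<Rightarrow> complex mat" where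
  "line n X s = mat n n (\<lambda>(i, j). (if i = j then 1 else 0) + s * X $$ (i, j))"

lemma line_carrier [simp]: "line n X s \<in> carrier_mat n n"
  by (simp add: line_def)

lemma line_0 [simp]: "line n X 0 = 1\<^sub>m n"
  by (rule eq_matI) (auto simp: line_def)

lemma line_index: "i < n \<Longrightarrow> j < n \<Longrightarrow> line n X s $$ (i, j) = (if i = j then 1 else 0) + s * X $$ (i, j)"
  by (simp add: line_def)

text \<open>Differentials at the identity are linear in the direction \<open>X\<close>. They are recorded by their
  coefficients, so that linearity does not have to be carried along as a separate statement.\<close>

definition linear_form :: "nat \<Rightarrow> (nat \<Rightarrow> nat \<Rightarrow> complex) \<Rightarrow> complex mat \<Rightarrow> complex" where
  "linear_form n c X = (\<Sum>i<n. \<Sum>j<n. c i j * X $$ (i, j))"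

lemma linear_form_add: "linear_form n c X + linear_form n c' X = linear_form n (\<lambda>i j. c i j + c' i j) X"
  by (simp add: linear_form_def sum.distrib algebra_simps)

lemma linear_form_scale: "a * linear_form n c X = linear_form n (\<lambda>i j. a * c i j) X"
  by (simp add: linear_form_def sum_distrib_left algebra_simps)

lemma linear_form_sum: "finite A \<Longrightarrow> (\<Sum>a\<in>A. linear_form n (c a) X) = linear_form n (\<lambda>i j. \<Sum>a\<in>A. c a i j) X"
  by (induction A rule: finite_induct) (auto simp: linear_form_add, simp add: linear_form_def)

lemma linear_form_entry:
  assumes "i < n" "j < n"
  shows "X $$ (i, j) = linear_form n (\<lambda>a b. if a = i \<and> b = j then 1 else 0) X"
proof -
  have "linear_form n (\<lambda>a b. if a = i \<and> b = j then 1 else 0) X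
      = (\<Sum>a<n. if a = i then \<Sum>b<n. if b = j then X $$ (i, j) else 0 else 0)"
    unfolding linear_form_def
  proof (rule sum.cong[OF refl])
    fix a
    show "(\<Sum>b<n. (if a = i \<and> b = j then 1 else 0) * X $$ (a, b))
      = (if a = i then \<Sum>b<n. if b = j then X $$ (i, j) else 0 else 0)"
    proof (cases "a = i")
      case True
      show ?thesis
        unfolding True simp_thms if_True by (rule sum.cong) auto
    qed simp
  qed
  also have "\<dots> = X $$ (i, j)"
    using assms by simp
  finally show ?thesis ..
qed

lemma det_line_deriv:
  "\<exists>c. \<forall>X. ((\<lambda>s. det (line n X s)) has_field_derivative linear_form n c X) (at 0)"
proof -
  let ?S = "{p. p permutes {0..<n}}"
  let ?c = "\<lambda>p i a b. of_int (sign p) * (\<Prod>j\<in>{0..<n} - {i}. if j = p j then 1 else 0) * (if a = i \<and> b = p i then 1 else 0 :: complex)"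
  have "((\<lambda>s. det (line n X s)) has_field_derivative
      linear_form n (\<lambda>a b. \<Sum>p\<in>?S. \<Sum>i\<in>{0..<n}. ?c p i a b) X) (at 0)" for X
  proof -
    have "((\<lambda>s. \<Sum>p\<in>?S. of_int (sign p) * (\<Prod>i\<in>{0..<n}. (if i = p i then 1 else 0) + s * X $$ (i, p i)))
      has_field_derivative
       (\<Sum>p\<in>?S. of_int (sign p) * (\<Sum>i\<in>{0..<n}. X $$ (i, p i) * (\<Prod>j\<in>{0..<n} - {i}. (if j = p j then 1 else 0) + 0 * X $$ (j, p j))))) (at 0)"
      by (intro DERIV_sum DERIV_cmult has_field_derivative_prod) (auto intro!: derivative_eq_intros)
    also have "(\<Sum>p\<in>?S. of_int (sign p) * (\<Sum>i\<in>{0..<n}. X $$ (i, p i) * (\<Prod>j\<in>{0..<n} - {i}. (if j = p j then 1 else 0) + 0 * X $$ (j, p j))))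
      = (\<Sum>p\<in>?S. \<Sum>i\<in>{0..<n}. linear_form n (?c p i) X)"
    proof (intro sum.cong refl)
      fix p assume "p \<in> ?S"
      then have p: "p i < n" if "i < n" for i
        using permutes_in_image[of p "{0..<n}" i] that by simp
      have "linear_form n (?c p i) X = of_int (sign p) * (\<Prod>j\<in>{0..<n} - {i}. if j = p j then 1 else 0) * X $$ (i, p i)"
        if "i < n" for i
        by (subst linear_form_entry[OF that p[OF that]]) (simp add: linear_form_scale)
      then show "of_int (sign p) * (\<Sum>i\<in>{0..<n}. X $$ (i, p i) * (\<Prod>j\<in>{0..<n} - {i}. (if j = p j then 1 else 0) + 0 * X $$ (j, p j)))
        = (\<Sum>i\<in>{0..<n}. linear_form n (?c p i) X)"
        by (simp add: sum_distrib_left mult_ac)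
    qed
    also have "\<dots> = linear_form n (\<lambda>a b. \<Sum>p\<in>?S. \<Sum>i\<in>{0..<n}. ?c p i a b) X"
      by (simp add: linear_form_sum finite_permutations)
    also have "(\<lambda>s. \<Sum>p\<in>?S. of_int (sign p) * (\<Prod>i\<in>{0..<n}. (if i = p i then 1 else 0) + s * X $$ (i, p i)))
       = (\<lambda>s. det (line n X s))"
    proof
      fix s
      show "(\<Sum>p\<in>?S. of_int (sign p) * (\<Prod>i\<in>{0..<n}. (if i = p i then 1 else 0) + s * X $$ (i, p i))) = det (line n X s)"
        unfolding det_def'[OF line_carrier]
      proof (intro sum.cong refl arg_cong2[where f = "(*)"] prod.cong)
        fix p i assume "p \<in> ?S" "i \<in> {0..<n}"
        then have "p i < n"
          using permutes_in_image[of p "{0..<n}" i] by simp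
        then show "(if i = p i then 1 else 0) + s * X $$ (i, p i) = line n X s $$ (i, p i)"
          using \<open>i \<in> {0..<n}\<close> by (simp add: line_index)
      qed
    qed
    finally show ?thesis .
  qed
  then show ?thesis by blast
qed

lemma regular_fun_deriv:
  assumes "f \<in> regular_funs n"
  shows "\<exists>c. \<forall>X. ((\<lambda>s. f (line n X s)) has_field_derivative linear_form n c X) (at 0)"
  using assms
proof induction
  case (const c)
  show ?case
    by (rule exI[of _ "\<lambda>i j. 0"]) (simp add: linear_form_def)
next
  case (entry i j)
  show ?case
    by (rule exI[of _ "\<lambda>a b. if a = i \<and> b = j then 1 else 0"])
       (auto simp: linear_form_entry[OF entry, symmetric] line_index[OF entry] intro!: derivative_eq_intros)
next
  case inverse_det
  obtain c where c: "\<And>X. ((\<lambda>s. det (line n X s)) has_field_derivative linear_form n c X) (at 0)"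
    using det_line_deriv by blast
  have "((\<lambda>s. inverse (det (line n X s))) has_field_derivative - linear_form n c X) (at 0)" for X
    using DERIV_inverse'[OF c[of X]] by simp
  then have "\<forall>X. ((\<lambda>s. inverse (det (line n X s))) has_field_derivative - 1 * linear_form n c X) (at 0)"
    by simp
  then show ?case
    by (intro exI[of _ "\<lambda>i j. - 1 * c i j"]) (simp only: linear_form_scale simp_thms)
next
  case (add f h)
  then obtain c c' where "\<And>X. ((\<lambda>s. f (line n X s)) has_field_derivative linear_form n c X) (at 0)"
    "\<And>X. ((\<lambda>s. h (line n X s)) has_field_derivative linear_form n c' X) (at 0)"
    by blast
  then show ?case
    by (intro exI[of _ "\<lambda>i j. c i j + c' i j"]) (auto simp: linear_form_add[symmetric] intro: DERIV_add)
next
  case (mult f h)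
  then obtain c c' where "\<And>X. ((\<lambda>s. f (line n X s)) has_field_derivative linear_form n c X) (at 0)"
    "\<And>X. ((\<lambda>s. h (line n X s)) has_field_derivative linear_form n c' X) (at 0)"
    by blast
  from DERIV_mult[OF this] have "((\<lambda>s. f (line n X s) * h (line n X s)) has_field_derivative
      h (1\<^sub>m n) * linear_form n c X + f (1\<^sub>m n) * linear_form n c' X) (at 0)" for X
    by (simp add: mult.commute)
  then show ?case
    by (intro exI[of _ "\<lambda>i j. h (1\<^sub>m n) * c i j + f (1\<^sub>m n) * c' i j"])
       (simp only: linear_form_add[symmetric] linear_form_scale[symmetric] simp_thms)
qed

lemma eventually_line_GL: "\<forall>\<^sub>F s in nhds 0. line n X s \<in> carrier (GL n)"
proof -
  obtain c where "((\<lambda>s. det (line n X s)) has_field_derivative linear_form n c X) (at 0)"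
    using det_line_deriv by blast
  then have "isCont (\<lambda>s. det (line n X s)) 0"
    by (rule DERIV_isCont)
  then have "\<forall>\<^sub>F s in at 0. det (line n X s) \<noteq> 0"
    unfolding isCont_def by (rule tendsto_imp_eventually_ne) simp
  then have "\<forall>\<^sub>F s in nhds 0. det (line n X s) \<noteq> 0"
    unfolding eventually_at_filter
  proof (rule eventually_mono)
    fix s assume "s \<noteq> 0 \<longrightarrow> s \<in> UNIV \<longrightarrow> det (line n X s) \<noteq> 0"
    then show "det (line n X s) \<noteq> 0"
      by (cases "s = 0") auto
  qed
  then show ?thesis
    by (simp add: in_GL_iff)
qed

section \<open>The Lie algebra action and the Casimir operator\<close>

definition unit_mat :: "nat \<Rightarrow> nat \<Rightarrow> nat \<Rightarrow> complex mat" where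
  "unit_mat n i j = mat n n (\<lambda>(a, b). if a = i \<and> b = j then 1 else 0)"

lemma unit_mat_carrier [simp]: "unit_mat n i j \<in> carrier_mat n n"
  by (simp add: unit_mat_def)

lemma unit_mat_dim [simp]: "dim_row (unit_mat n i j) = n" "dim_col (unit_mat n i j) = n"
  by (simp_all add: unit_mat_def)

lemma linear_form_delta:
  assumes "i < n" "j < n"
  shows "linear_form n c (unit_mat n i j) = c i j"
proof -
  have "linear_form n c (unit_mat n i j) = (\<Sum>a<n. if a = i then \<Sum>b<n. if b = j then c i j else 0 else 0)"
    unfolding linear_form_def
  proof (rule sum.cong[OF refl])
    fix a assume "a \<in> {..<n}"
    then have "(\<Sum>b<n. c a b * unit_mat n i j $$ (a, b)) = (\<Sum>b<n. if a = i then if b = j then c i j else 0 else 0)"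
      by (intro sum.cong) (auto simp: unit_mat_def)
    then show "(\<Sum>b<n. c a b * unit_mat n i j $$ (a, b)) = (if a = i then \<Sum>b<n. if b = j then c i j else 0 else 0)"
      by simp
  qed
  then show ?thesis
    using assms by simp
qed

locale algebraic_GL_rep =
  fixes n :: nat and V :: "complex mat rep"
  assumes alg: "algebraic_rep n V"
begin

abbreviation d where "d \<equiv> rep.degree V"

abbreviation P where "P \<equiv> action V"

lemma P_carrier: "g \<in> carrier (GL n) \<Longrightarrow> P g \<in> carrier_mat d d"
  using alg by (auto simp: algebraic_rep_def hom_def in_GL_iff)

lemma P_GL: "g \<in> carrier (GL n) \<Longrightarrow> P g \<in> carrier (GL d)"
  using alg by (auto simp: algebraic_rep_def hom_def)

lemma P_mult: "g \<in> carrier (GL n) \<Longrightarrow> h \<in> carrier (GL n) \<Longrightarrow> P (g * h) = P g * P h"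
  using alg unfolding algebraic_rep_def hom_def
  by (auto simp: GL_def units_of_mult ring_mat_def)

lemma P_one: "P (1\<^sub>m n) = 1\<^sub>m d"
proof -
  have g: "P (1\<^sub>m n) \<in> carrier (GL d)"
    by (rule P_GL[OF one_in_GL])
  then obtain h where h: "h \<in> carrier (GL d)" "h * P (1\<^sub>m n) = 1\<^sub>m d"
    by (rule GL_inverse)
  have c: "P (1\<^sub>m n) \<in> carrier_mat d d" "h \<in> carrier_mat d d"
    using g h by (simp_all add: in_GL_iff)
  have "P (1\<^sub>m n) * P (1\<^sub>m n) = P (1\<^sub>m n)"
    using P_mult[OF one_in_GL one_in_GL] by simp
  then have "h * (P (1\<^sub>m n) * P (1\<^sub>m n)) = h * P (1\<^sub>m n)"
    by simp
  then have "(h * P (1\<^sub>m n)) * P (1\<^sub>m n) = 1\<^sub>m d"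
    using assoc_mult_mat[OF c(2) c(1) c(1)] h by simp
  then show ?thesis
    using h c by simp
qed

lemma P_inverse: "g \<in> carrier (GL n) \<Longrightarrow> h \<in> carrier (GL n) \<Longrightarrow> g * h = 1\<^sub>m n \<Longrightarrow> P g * P h = 1\<^sub>m d"
  using P_mult P_one by metis

lemma matrix_coefficient:
  "a < d \<Longrightarrow> b < d \<Longrightarrow> \<exists>f\<in>regular_funs n. \<forall>g\<in>carrier (GL n). P g $$ (a, b) = f g"
  using alg by (simp add: algebraic_rep_def)

lemma ex_lie_coeff:
  assumes "a < d" "b < d"
  shows "\<exists>c. \<forall>X. ((\<lambda>s. P (line n X s) $$ (a, b)) has_field_derivative linear_form n c X) (at 0)"
proof -
  obtain f where f: "f \<in> regular_funs n" "\<And>g. g \<in> carrier (GL n) \<Longrightarrow> P g $$ (a, b) = f g"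
    using matrix_coefficient[OF assms] by blast
  obtain c where c: "\<And>X. ((\<lambda>s. f (line n X s)) has_field_derivative linear_form n c X) (at 0)"
    using regular_fun_deriv[OF f(1)] by blast
  have "\<forall>\<^sub>F s in nhds 0. P (line n X s) $$ (a, b) = f (line n X s)" for X
    using eventually_line_GL[of n X] by eventually_elim (rule f(2))
  then have "((\<lambda>s. P (line n X s) $$ (a, b)) has_field_derivative linear_form n c X) (at 0)" for X
    by (rule DERIV_eventually_eq[OF c])
  then show ?thesis by blast
qed

definition lie_coeff :: "nat \<Rightarrow> nat \<Rightarrow> nat \<Rightarrow> nat \<Rightarrow> complex" where
  "lie_coeff a b = (SOME c. \<forall>X. ((\<lambda>s. P (line n X s) $$ (a, b)) has_field_derivative linear_form n c X) (at 0))"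

definition dP :: "complex mat \<Rightarrow> complex mat" where
  "dP X = mat d d (\<lambda>(a, b). linear_form n (lie_coeff a b) X)"

definition E :: "nat \<Rightarrow> nat \<Rightarrow> complex mat" where
  "E i j = dP (unit_mat n i j)"

lemma dP_carrier [simp]: "dP X \<in> carrier_mat d d"
  by (simp add: dP_def)

lemma E_carrier [simp]: "E i j \<in> carrier_mat d d"
  by (simp add: E_def)

lemma E_dim [simp]: "dim_row (E i j) = d" "dim_col (E i j) = d"
  by (simp_all add: E_def dP_def)

lemma mderiv_P: "mderiv d (\<lambda>s. P (line n X s)) (dP X)"
  unfolding mderiv_def
proof (intro conjI allI impI)
  show "\<forall>\<^sub>F s in nhds 0. P (line n X s) \<in> carrier_mat d d"
    using eventually_line_GL[of n X] by eventually_elim (rule P_carrier)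
  show "dP X \<in> carrier_mat d d" by simp
  fix a b assume ab: "a < d" "b < d"
  have "((\<lambda>s. P (line n X s) $$ (a, b)) has_field_derivative linear_form n (lie_coeff a b) X) (at 0)"
    using someI_ex[OF ex_lie_coeff[OF ab]] unfolding lie_coeff_def by blast
  then show "((\<lambda>s. P (line n X s) $$ (a, b)) has_field_derivative dP X $$ (a, b)) (at 0)"
    using ab by (simp add: dP_def)
qed

lemma E_entry: "a < d \<Longrightarrow> b < d \<Longrightarrow> i < n \<Longrightarrow> j < n \<Longrightarrow> E i j $$ (a, b) = lie_coeff a b i j"
  by (simp add: E_def dP_def linear_form_delta)

lemma dP_entry:
  "a < d \<Longrightarrow> b < d \<Longrightarrow> dP X $$ (a, b) = (\<Sum>i<n. \<Sum>j<n. E i j $$ (a, b) * X $$ (i, j))"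
  by (simp add: E_entry) (simp add: dP_def linear_form_def)

lemma dP_smult: "X \<in> carrier_mat n n \<Longrightarrow> dP (c \<cdot>\<^sub>m X) = c \<cdot>\<^sub>m dP X"
  by (rule eq_matI) (auto simp: dP_def linear_form_def sum_distrib_left mult_ac intro!: sum.cong)

lemma line_conj:
  assumes X: "X \<in> carrier_mat n n" and g: "g \<in> carrier_mat n n" and h: "h \<in> carrier_mat n n"
    and gh: "g * h = 1\<^sub>m n"
  shows "g * line n X s * h = line n (g * X * h) s"
proof -
  have l: "line n Y s = 1\<^sub>m n + s \<cdot>\<^sub>m Y" if "Y \<in> carrier_mat n n" for Y
    using that by (intro eq_matI) (auto simp: line_def)
  have "g * (1\<^sub>m n + s \<cdot>\<^sub>m X) * h = g * 1\<^sub>m n * h + g * (s \<cdot>\<^sub>m X) * h"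
    unfolding mult_add_distrib_mat[OF g one_carrier_mat smult_carrier_mat[OF X]]
    by (rule add_mult_distrib_mat[of _ n n]) (use X g h in auto)
  also have "\<dots> = 1\<^sub>m n + s \<cdot>\<^sub>m (g * X * h)"
    using X g h gh by (simp add: mult_smult_distrib[of _ n n] mult_smult_assoc_mat[of _ n n])
  finally show ?thesis
    using X g h by (simp add: l)
qed

text \<open>Conjugation maps the line \<open>1 + sX\<close> to the line \<open>1 + s g X g\<^sup>-\<^sup>1\<close>; the claim compares derivatives.\<close>

lemma Ad:
  assumes g: "g \<in> carrier (GL n)" and h: "h \<in> carrier (GL n)" and gh: "g * h = 1\<^sub>m n"
    and X: "X \<in> carrier_mat n n"
  shows "P g * dP X * P h = dP (g * X * h)"
proof -
  have gc: "g \<in> carrier_mat n n" and hc: "h \<in> carrier_mat n n"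
    using g h by (simp_all add: in_GL_iff)
  have "mderiv d (\<lambda>s. P g * P (line n X s) * P h) (P g * dP X * P h)"
    by (intro mderiv_mult_left mderiv_mult_right mderiv_P P_carrier g h)
  moreover have "\<forall>\<^sub>F s in nhds 0. P g * P (line n X s) * P h = P (line n (g * X * h) s)"
    using eventually_line_GL[of n X]
  proof eventually_elim
    case (elim s)
    then have "P g * P (line n X s) * P h = P (g * line n X s * h)"
      by (simp add: P_mult g h mult_in_GL)
    then show ?case
      by (simp add: line_conj[OF X gc hc gh])
  qed
  ultimately have "mderiv d (\<lambda>s. P (line n (g * X * h) s)) (P g * dP X * P h)"
    by (rule mderiv_cong[rotated])
  then show ?thesis
    using mderiv_P mderiv_unique by blast
qed

definition T :: "(nat \<Rightarrow> complex) \<Rightarrow> complex mat" where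
  "T t = mat_diag n t"

lemma T_GL: "t \<in> torus n \<Longrightarrow> T t \<in> carrier (GL n)"
proof -
  assume t: "t \<in> torus n"
  have "det (T t) = (\<Prod>i\<leftarrow>diag_mat (T t). i)"
    using det_upper_triangular[of "T t" n] by (simp add: T_def mat_diag_def upper_triangular_def)
  also have "\<dots> = (\<Prod>i = 0..<n. t i)"
    using prod_list_diag_prod[of "T t"] by (simp add: T_def mat_diag_def)
  finally show ?thesis
    using t by (auto simp: in_GL_iff T_def torus_def)
qed

lemma T_mult: "T t * T u = T (\<lambda>i. t i * u i)"
  by (simp add: T_def)

lemma T_inverse: "t \<in> torus n \<Longrightarrow> T t * T (\<lambda>i. inverse (t i)) = 1\<^sub>m n"
proof -
  assume "t \<in> torus n"
  then have "T t * T (\<lambda>i. inverse (t i)) = mat_diag n (\<lambda>i. 1)"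
    unfolding T_mult unfolding T_def mat_diag_def by (intro eq_matI) (auto simp: torus_def)
  then show ?thesis by simp
qed

lemma P_T_E:
  assumes t: "t \<in> torus n" and ij: "i < n" "j < n"
  shows "P (T t) * E i j = (t i / t j) \<cdot>\<^sub>m (E i j * P (T t))"
proof -
  let ?u = "\<lambda>i. inverse (t i)"
  have u: "?u \<in> torus n"
    using t by (simp add: torus_def)
  have tu: "T t * T ?u = 1\<^sub>m n"
    by (rule T_inverse[OF t])
  have ut: "T ?u * T t = 1\<^sub>m n"
    using T_inverse[OF u] by simp
  have "T t * unit_mat n i j * T ?u = (t i / t j) \<cdot>\<^sub>m unit_mat n i j"
    unfolding T_def using t
    by (subst mat_diag_mult_left[of _ n n], simp, subst mat_diag_mult_right[of _ n n], simp)
       (intro eq_matI, auto simp: unit_mat_def torus_def divide_inverse)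
  then have "P (T t) * E i j * P (T ?u) = (t i / t j) \<cdot>\<^sub>m E i j"
    using Ad[OF T_GL[OF t] T_GL[OF u] tu unit_mat_carrier, of i j] dP_smult[OF unit_mat_carrier]
    by (simp add: E_def)
  then have "P (T t) * E i j * P (T ?u) * P (T t) = (t i / t j) \<cdot>\<^sub>m E i j * P (T t)"
    by simp
  moreover have "P (T t) * E i j * P (T ?u) * P (T t) = P (T t) * E i j"
    using P_inverse[OF T_GL[OF u] T_GL[OF t] ut]
      assoc_mult_mat[OF mult_carrier_mat[OF P_carrier[OF T_GL[OF t]] E_carrier] P_carrier[OF T_GL[OF u]]
        P_carrier[OF T_GL[OF t]]] right_mult_one_mat[OF mult_carrier_mat[OF P_carrier[OF T_GL[OF t]] E_carrier]]
    by simp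
  ultimately show ?thesis
    using P_carrier[OF T_GL[OF t]] by (simp add: mult_smult_assoc_mat[of _ d d])
qed

lemma unit_mat_mult:
  assumes "j < n"
  shows "unit_mat n i j * unit_mat n k l = (if j = k then unit_mat n i l else 0\<^sub>m n n)"
proof (rule eq_matI)
  fix a b assume "a < dim_row (if j = k then unit_mat n i l else 0\<^sub>m n n)"
    "b < dim_col (if j = k then unit_mat n i l else 0\<^sub>m n n)"
  then have ab: "a < n" "b < n"
    by (simp_all add: unit_mat_def split: if_splits)
  have "(unit_mat n i j * unit_mat n k l) $$ (a, b)
      = (\<Sum>c<n. unit_mat n i j $$ (a, c) * unit_mat n k l $$ (c, b))"
    by (rule index_mult_sum[OF unit_mat_carrier unit_mat_carrier ab])
  also have "\<dots> = (\<Sum>c<n. if c = j then (if a = i \<and> j = k \<and> b = l then 1 else 0) else 0)"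
    using ab by (intro sum.cong) (auto simp: unit_mat_def)
  also have "\<dots> = (if j = k then unit_mat n i l else 0\<^sub>m n n) $$ (a, b)"
    using assms ab by (auto simp: unit_mat_def)
  finally show "(unit_mat n i j * unit_mat n k l) $$ (a, b) = (if j = k then unit_mat n i l else 0\<^sub>m n n) $$ (a, b)" .
qed (auto simp: unit_mat_def)

lemma line_eq: "X \<in> carrier_mat n n \<Longrightarrow> line n X s = 1\<^sub>m n + s \<cdot>\<^sub>m X"
  by (intro eq_matI) (auto simp: line_def)

lemma line_mult_left:
  assumes X: "X \<in> carrier_mat n n" and Y: "Y \<in> carrier_mat n n"
  shows "line n X s * Y = Y + s \<cdot>\<^sub>m (X * Y)"
  unfolding line_eq[OF X] add_mult_distrib_mat[OF one_carrier_mat smult_carrier_mat[OF X] Y]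
  using X Y by (simp add: mult_smult_assoc_mat[OF X Y])

lemma line_mult_right:
  assumes X: "X \<in> carrier_mat n n" and Y: "Y \<in> carrier_mat n n"
  shows "Y * line n X s = Y + s \<cdot>\<^sub>m (Y * X)"
  unfolding line_eq[OF X] mult_add_distrib_mat[OF Y one_carrier_mat smult_carrier_mat[OF X]]
  using X Y by (simp add: mult_smult_distrib[OF Y X])

lemma dP_add:
  assumes "X \<in> carrier_mat n n" "Y \<in> carrier_mat n n"
  shows "dP (X + Y) = dP X + dP Y"
proof -
  have "linear_form n c (X + Y) = linear_form n c X + linear_form n c Y" for c
  proof -
    have "linear_form n c (X + Y) = (\<Sum>i<n. \<Sum>j<n. c i j * X $$ (i, j) + c i j * Y $$ (i, j))"
      unfolding linear_form_def by (intro sum.cong refl) (use assms in \<open>simp add: distrib_left\<close>)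
    then show ?thesis
      by (simp only: sum.distrib linear_form_def)
  qed
  then show ?thesis
    by (intro eq_matI) (auto simp: dP_def)
qed

lemma dP_uminus: "X \<in> carrier_mat n n \<Longrightarrow> dP (- X) = - dP X"
proof -
  assume X: "X \<in> carrier_mat n n"
  have "- X = (- 1) \<cdot>\<^sub>m X" "- dP X = (- 1) \<cdot>\<^sub>m dP X"
    by (intro eq_matI; simp)+
  with dP_smult[OF X] show ?thesis
    by simp
qed

lemma line_unit_inverse:
  assumes ij: "i < n" "j < n" "i \<noteq> j"
  shows "line n (unit_mat n i j) s * line n (- unit_mat n i j) s = 1\<^sub>m n"
proof -
  have "unit_mat n i j * - unit_mat n i j = 0\<^sub>m n n"
    using unit_mat_mult[of j i i j] ij by (auto intro!: eq_matI)
  moreover have "line n (- unit_mat n i j) s = 1\<^sub>m n + s \<cdot>\<^sub>m - unit_mat n i j"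
    by (rule line_eq) simp
  ultimately show ?thesis
    unfolding line_mult_left[OF unit_mat_carrier line_carrier]
    by (subst line_mult_right) (auto intro!: eq_matI simp: unit_mat_def line_def)
qed

lemma line_unit_GL:
  assumes ij: "i < n" "j < n" "i \<noteq> j"
  shows "line n (unit_mat n i j) s \<in> carrier (GL n)" "line n (- unit_mat n i j) s \<in> carrier (GL n)"
proof -
  have "det (line n (unit_mat n i j) s) * det (line n (- unit_mat n i j) s) = 1"
    using det_mult[OF line_carrier line_carrier, of n "unit_mat n i j" s "- unit_mat n i j" s]
    by (simp add: line_unit_inverse[OF ij])
  then show "line n (unit_mat n i j) s \<in> carrier (GL n)" "line n (- unit_mat n i j) s \<in> carrier (GL n)"
    by (auto simp: in_GL_iff)
qed

text \<open>The commutator relation comes from conjugating \<open>e\<^sub>j\<^sub>i\<close> by \<open>1 + s e\<^sub>i\<^sub>j\<close>, which gives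
  \<open>e\<^sub>j\<^sub>i + s (e\<^sub>i\<^sub>i - e\<^sub>j\<^sub>j) - s\<^sup>2 e\<^sub>i\<^sub>j\<close>, and comparing the derivatives at 0.\<close>

lemma bracket:
  assumes ij: "i < n" "j < n" "i \<noteq> j"
  shows "E i j * E j i = E j i * E i j + (E i i - E j j)"
proof -
  let ?e = "unit_mat n i j" and ?f = "unit_mat n j i"
  let ?ei = "unit_mat n i i" and ?ej = "unit_mat n j j"
  note c = unit_mat_carrier[of n i j] unit_mat_carrier[of n j i] unit_mat_carrier[of n i i] unit_mat_carrier[of n j j]
  have ne: "- ?e \<in> carrier_mat n n"
    by simp
  have conj: "line n ?e s * ?f * line n (- ?e) s = (?f + s \<cdot>\<^sub>m ?ei) + s \<cdot>\<^sub>m (- (?ej + s \<cdot>\<^sub>m ?e))" for s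
  proof -
    let ?A = "?f + s \<cdot>\<^sub>m ?ei"
    have A: "?A \<in> carrier_mat n n"
      by simp
    have "line n ?e s * ?f = ?A"
      using unit_mat_mult[of j i j i] ij by (simp add: line_mult_left)
    moreover have "?A * line n (- ?e) s = ?A + s \<cdot>\<^sub>m (?A * - ?e)"
      by (rule line_mult_right[OF ne A])
    moreover have "?A * ?e = ?ej + s \<cdot>\<^sub>m ?e"
      unfolding add_mult_distrib_mat[OF c(2) smult_carrier_mat[OF c(3)] c(1)]
      using ij unit_mat_mult[of i j i j] unit_mat_mult[of i i i j] mult_smult_assoc_mat[OF c(3) c(1)] by simp
    ultimately show ?thesis
      using A by simp
  qed
  have m1: "mderiv d (\<lambda>s. P (line n ?e s) * dP ?f * P (line n (- ?e) s))
      (dP ?e * dP ?f * P (line n (- ?e) 0) + P (line n ?e 0) * dP ?f * dP (- ?e))"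
    by (intro mderiv_mult mderiv_mult_right mderiv_P dP_carrier)
  have eq: "dP ?e * dP ?f * P (line n (- ?e) 0) + P (line n ?e 0) * dP ?f * dP (- ?e)
      = E i j * E j i - E j i * E i j"
    unfolding line_0 P_one dP_uminus[OF c(1)] E_def[symmetric]
      right_mult_one_mat[OF mult_carrier_mat[OF E_carrier E_carrier]] left_mult_one_mat[OF E_carrier]
    by (rule eq_matI) auto
  have m2: "mderiv d (\<lambda>s. P (line n ?e s) * dP ?f * P (line n (- ?e) s)) (E i i - E j j)"
  proof (rule mderiv_cong)
    show "\<forall>\<^sub>F s in nhds 0. (E j i + s \<cdot>\<^sub>m E i i) + s \<cdot>\<^sub>m (- (E j j + s \<cdot>\<^sub>m E i j))
       = P (line n ?e s) * dP ?f * P (line n (- ?e) s)"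
    proof (rule always_eventually, rule allI)
      fix s
      have "P (line n ?e s) * dP ?f * P (line n (- ?e) s)
        = dP ((?f + s \<cdot>\<^sub>m ?ei) + s \<cdot>\<^sub>m (- (?ej + s \<cdot>\<^sub>m ?e)))"
        unfolding Ad[OF line_unit_GL[OF ij] line_unit_inverse[OF ij] c(2)] conj ..
      also have "\<dots> = (E j i + s \<cdot>\<^sub>m E i i) + s \<cdot>\<^sub>m (- (E j j + s \<cdot>\<^sub>m E i j))"
        by (simp add: dP_add dP_smult dP_uminus E_def)
      finally show "(E j i + s \<cdot>\<^sub>m E i i) + s \<cdot>\<^sub>m (- (E j j + s \<cdot>\<^sub>m E i j))
        = P (line n ?e s) * dP ?f * P (line n (- ?e) s)" ..
    qed
    have "((\<lambda>s. x + s * y + s * (- z - s * w)) has_field_derivative y - z) (at 0)" for x y z w :: complex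
      by (auto intro!: derivative_eq_intros)
    then show "mderiv d (\<lambda>s. (E j i + s \<cdot>\<^sub>m E i i) + s \<cdot>\<^sub>m (- (E j j + s \<cdot>\<^sub>m E i j))) (E i i - E j j)"
      unfolding mderiv_def by auto
  qed
  have e: "E i j * E j i - E j i * E i j = E i i - E j j"
    by (rule mderiv_unique[OF m1[unfolded eq] m2])
  have "A = B + (A - B)" if "A \<in> carrier_mat d d" "B \<in> carrier_mat d d" for A B :: "complex mat"
    using that by (intro eq_matI) auto
  from this[OF mult_carrier_mat[OF E_carrier E_carrier] mult_carrier_mat[OF E_carrier E_carrier]]
  have "E i j * E j i = E j i * E i j + (E i j * E j i - E j i * E i j)" .
  then show ?thesis
    unfolding e .
qed

text \<open>The Casimir operator of the trace form: \<open>e\<^sub>i\<^sub>j\<close> and \<open>e\<^sub>j\<^sub>i\<close> are dual bases.\<close>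

definition Casimir :: "complex mat" where
  "Casimir = mat d d (\<lambda>(a, b). \<Sum>i<n. \<Sum>j<n. (E i j * E j i) $$ (a, b))"

lemma Casimir_carrier [simp]: "Casimir \<in> carrier_mat d d"
  by (simp add: Casimir_def)

lemma mult_Casimir_entry:
  assumes A: "A \<in> carrier_mat d d" and ab: "a < d" "b < d"
  shows "(A * Casimir) $$ (a, b) = (\<Sum>i<n. \<Sum>j<n. (A * (E i j * E j i)) $$ (a, b))"
proof -
  have "(A * Casimir) $$ (a, b) = (\<Sum>c<d. A $$ (a, c) * (\<Sum>i<n. \<Sum>j<n. (E i j * E j i) $$ (c, b)))"
    unfolding index_mult_sum[OF A Casimir_carrier ab] using ab by (intro sum.cong refl) (simp add: Casimir_def)
  also have "\<dots> = (\<Sum>i<n. \<Sum>j<n. \<Sum>c<d. A $$ (a, c) * (E i j * E j i) $$ (c, b))"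
    unfolding sum_distrib_left by (rule trans[OF sum.swap]) (intro sum.cong refl sum.swap)
  also have "\<dots> = (\<Sum>i<n. \<Sum>j<n. (A * (E i j * E j i)) $$ (a, b))"
    using index_mult_sum[OF A mult_carrier_mat[OF E_carrier E_carrier] ab] by simp
  finally show ?thesis .
qed

lemma tr_mult_Casimir:
  assumes A: "A \<in> carrier_mat d d"
  shows "tr (A * Casimir) = (\<Sum>i<n. \<Sum>j<n. tr (A * (E i j * E j i)))"
proof -
  have "tr (A * Casimir) = (\<Sum>a<d. \<Sum>i<n. \<Sum>j<n. (A * (E i j * E j i)) $$ (a, a))"
    unfolding tr_def using A by (auto simp del: index_mult_mat(1) simp: mult_Casimir_entry intro!: sum.cong)
  also have "\<dots> = (\<Sum>i<n. \<Sum>j<n. \<Sum>a<d. (A * (E i j * E j i)) $$ (a, a))"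
    by (rule trans[OF sum.swap]) (intro sum.cong refl sum.swap)
  also have "\<dots> = (\<Sum>i<n. \<Sum>j<n. tr (A * (E i j * E j i)))"
    unfolding tr_def using A by simp
  finally show ?thesis .
qed

end

text \<open>Conjugation preserves the trace form and thus maps dual bases to dual bases. In coordinates,
  the double sum is the trace of a product in which \<open>h\<^sup>T g\<^sup>T = 1\<close> cancels twice.\<close>

lemma sum_conj_dual_bases:
  fixes g h U W :: "complex mat"
  assumes g: "g \<in> carrier_mat n n" and h: "h \<in> carrier_mat n n" and hg: "g * h = 1\<^sub>m n"
    and U: "U \<in> carrier_mat n n" and W: "W \<in> carrier_mat n n"
  shows "(\<Sum>i<n. \<Sum>j<n. (\<Sum>a<n. \<Sum>b<n. U $$ (a, b) * (g $$ (a, i) * h $$ (j, b))) *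
      (\<Sum>a<n. \<Sum>b<n. W $$ (a, b) * (g $$ (a, j) * h $$ (i, b))))
    = (\<Sum>i<n. \<Sum>j<n. U $$ (i, j) * W $$ (j, i))"
proof -
  let ?g = "transpose_mat g" and ?h = "transpose_mat h"
  have gh: "?h * ?g = 1\<^sub>m n"
    using transpose_mult[OF g h] hg by simp
  have c: "?g \<in> carrier_mat n n" "?h \<in> carrier_mat n n"
    using g h by auto
  have entry: "(\<Sum>a<n. \<Sum>b<n. X $$ (a, b) * (g $$ (a, i) * h $$ (j, b))) = (?g * (X * ?h)) $$ (i, j)"
    if X: "X \<in> carrier_mat n n" and ij: "i < n" "j < n" for X i j
  proof -
    have "(?g * (X * ?h)) $$ (i, j) = (\<Sum>a<n. ?g $$ (i, a) * (\<Sum>b<n. X $$ (a, b) * ?h $$ (b, j)))"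
      using index_mult_sum[OF c(1) mult_carrier_mat[OF X c(2)] ij] index_mult_sum[OF X c(2) _ ij(2)] by simp
    also have "\<dots> = (\<Sum>a<n. \<Sum>b<n. X $$ (a, b) * (g $$ (a, i) * h $$ (j, b)))"
      unfolding sum_distrib_left using g h ij by (intro sum.cong refl) (simp add: mult_ac)
    finally show ?thesis ..
  qed
  have tr2: "(\<Sum>i<n. \<Sum>j<n. A $$ (i, j) * B $$ (j, i)) = tr (A * B)"
    if "A \<in> carrier_mat n n" "B \<in> carrier_mat n n" for A B :: "complex mat"
    unfolding tr_def using that index_mult_sum[OF that] by (auto intro!: sum.cong simp del: index_mult_mat(1))
  have "(\<Sum>i<n. \<Sum>j<n. (\<Sum>a<n. \<Sum>b<n. U $$ (a, b) * (g $$ (a, i) * h $$ (j, b))) *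
      (\<Sum>a<n. \<Sum>b<n. W $$ (a, b) * (g $$ (a, j) * h $$ (i, b))))
    = (\<Sum>i<n. \<Sum>j<n. (?g * (U * ?h)) $$ (i, j) * (?g * (W * ?h)) $$ (j, i))"
    by (intro sum.cong refl arg_cong2[where f = "(*)"] entry U W) auto
  also have "\<dots> = tr ((?g * (U * ?h)) * (?g * (W * ?h)))"
    by (rule tr2) (use c U W in auto)
  also have "(?g * (U * ?h)) * (?g * (W * ?h)) = ?g * (U * ((?h * ?g) * (W * ?h)))"
    using c U W by (simp add: assoc_mult_mat[of _ n n _ n _ n])
  also have "\<dots> = ?g * (U * W * ?h)"
    using c U W left_mult_one_mat[OF mult_carrier_mat[OF W c(2)]] by (simp add: gh assoc_mult_mat[of _ n n _ n _ n])
  also have "tr \<dots> = tr (U * W * ?h * ?g)"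
    by (rule tr_comm) (use c U W in auto)
  also have "U * W * ?h * ?g = U * W * (?h * ?g)"
    using c U W by (intro assoc_mult_mat) auto
  also have "tr \<dots> = (\<Sum>i<n. \<Sum>j<n. U $$ (i, j) * W $$ (j, i))"
    using U W tr2[OF U W] by (simp add: gh)
  finally show ?thesis .
qed

context algebraic_GL_rep
begin

lemma Casimir_conj:
  assumes g: "g \<in> carrier (GL n)" and h: "h \<in> carrier (GL n)" and gh: "g * h = 1\<^sub>m n" and hg: "h * g = 1\<^sub>m n"
  shows "P g * Casimir * P h = Casimir"
proof (rule eq_matI)
  have gc: "g \<in> carrier_mat n n" and hc: "h \<in> carrier_mat n n"
    using g h by (simp_all add: in_GL_iff)
  note c = P_carrier[OF g] P_carrier[OF h]
  show "dim_row (P g * Casimir * P h) = dim_row Casimir" "dim_col (P g * Casimir * P h) = dim_col Casimir"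
    using c by (auto simp: Casimir_def)
  fix a b assume "a < dim_row Casimir" "b < dim_col Casimir"
  then have ab: "a < d" "b < d"
    by (simp_all add: Casimir_def)
  have conj: "P g * (E i j * E j i) * P h = dP (g * unit_mat n i j * h) * dP (g * unit_mat n j i * h)" for i j
  proof -
    let ?A = "E i j" and ?B = "E j i"
    have as: "X * Y * Z = X * (Y * Z)"
      if "X \<in> carrier_mat d d" "Y \<in> carrier_mat d d" "Z \<in> carrier_mat d d" for X Y Z :: "complex mat"
      using that by (rule assoc_mult_mat)
    have mc: "X * Y \<in> carrier_mat d d"
      if "X \<in> carrier_mat d d" "Y \<in> carrier_mat d d" for X Y :: "complex mat"
      using that by (rule mult_carrier_mat)
    have "P g * (?A * ?B) * P h = P g * (?A * (1\<^sub>m d * (?B * P h)))"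
      using c by (simp add: as mc left_mult_one_mat[of _ d d])
    also have "1\<^sub>m d = P h * P g"
      using P_inverse[OF h g hg] by simp
    also have "P g * (?A * (P h * P g * (?B * P h))) = (P g * ?A * P h) * (P g * ?B * P h)"
      using c by (simp add: as mc)
    finally show ?thesis
      unfolding E_def Ad[OF g h gh unit_mat_carrier] .
  qed
  have ge: "(g * unit_mat n i j * h) $$ (p, q) = g $$ (p, i) * h $$ (j, q)"
    if "i < n" "j < n" "p < n" "q < n" for i j p q
  proof -
    have "(g * unit_mat n i j) $$ (p, r) = (if r = j then g $$ (p, i) else 0)" if "r < n" for r
    proof -
      have "(g * unit_mat n i j) $$ (p, r) = (\<Sum>k<n. if k = i then (if r = j then g $$ (p, i) else 0) else 0)"
        unfolding index_mult_sum[OF gc unit_mat_carrier \<open>p < n\<close> that] using that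
        by (intro sum.cong refl) (auto simp: unit_mat_def)
      then show ?thesis
        using \<open>i < n\<close> by simp
    qed
    then have "(g * unit_mat n i j * h) $$ (p, q) = (\<Sum>r<n. if r = j then g $$ (p, i) * h $$ (j, q) else 0)"
      unfolding index_mult_sum[OF mult_carrier_mat[OF gc unit_mat_carrier] hc \<open>p < n\<close> \<open>q < n\<close>]
      by (intro sum.cong refl) auto
    then show ?thesis
      using \<open>j < n\<close> by simp
  qed
  have "(P g * Casimir * P h) $$ (a, b) = (\<Sum>c<d. \<Sum>i<n. \<Sum>j<n. (P g * (E i j * E j i)) $$ (a, c) * P h $$ (c, b))"
    unfolding index_mult_sum[OF mult_carrier_mat[OF c(1) Casimir_carrier] c(2) ab]
    by (intro sum.cong refl) (simp only: lessThan_iff mult_Casimir_entry[OF c(1) ab(1)] sum_distrib_right)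
  also have "\<dots> = (\<Sum>i<n. \<Sum>j<n. \<Sum>c<d. (P g * (E i j * E j i)) $$ (a, c) * P h $$ (c, b))"
    by (rule trans[OF sum.swap]) (intro sum.cong refl sum.swap)
  also have "\<dots> = (\<Sum>i<n. \<Sum>j<n. (P g * (E i j * E j i) * P h) $$ (a, b))"
    unfolding index_mult_sum[OF mult_carrier_mat[OF c(1) mult_carrier_mat[OF E_carrier E_carrier]] c(2) ab] ..
  also have "\<dots> = (\<Sum>i<n. \<Sum>j<n. \<Sum>c<d. dP (g * unit_mat n i j * h) $$ (a, c) * dP (g * unit_mat n j i * h) $$ (c, b))"
    unfolding conj index_mult_sum[OF dP_carrier dP_carrier ab] ..
  also have "\<dots> = (\<Sum>c<d. \<Sum>i<n. \<Sum>j<n. dP (g * unit_mat n i j * h) $$ (a, c) * dP (g * unit_mat n j i * h) $$ (c, b))"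
    by (rule sym, rule trans[OF sum.swap]) (intro sum.cong refl sum.swap)
  also have "\<dots> = (\<Sum>c<d. \<Sum>i<n. \<Sum>j<n. E i j $$ (a, c) * E j i $$ (c, b))"
  proof (rule sum.cong[OF refl])
    fix c assume "c \<in> {..<d}"
    then have c: "c < d" by simp
    let ?U = "mat n n (\<lambda>(i, j). E i j $$ (a, c))" and ?W = "mat n n (\<lambda>(i, j). E i j $$ (c, b))"
    have "(\<Sum>i<n. \<Sum>j<n. dP (g * unit_mat n i j * h) $$ (a, c) * dP (g * unit_mat n j i * h) $$ (c, b))
      = (\<Sum>i<n. \<Sum>j<n. (\<Sum>p<n. \<Sum>q<n. ?U $$ (p, q) * (g $$ (p, i) * h $$ (j, q))) *
          (\<Sum>p<n. \<Sum>q<n. ?W $$ (p, q) * (g $$ (p, j) * h $$ (i, q))))"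
      unfolding dP_entry[OF ab(1) c] dP_entry[OF c ab(2)]
      by (intro sum.cong refl arg_cong2[where f = "(*)"]) (simp_all add: ge)
    also have "\<dots> = (\<Sum>i<n. \<Sum>j<n. ?U $$ (i, j) * ?W $$ (j, i))"
      by (rule sum_conj_dual_bases[OF gc hc gh]) auto
    also have "\<dots> = (\<Sum>i<n. \<Sum>j<n. E i j $$ (a, c) * E j i $$ (c, b))"
      by (intro sum.cong refl) simp
    finally show "(\<Sum>i<n. \<Sum>j<n. dP (g * unit_mat n i j * h) $$ (a, c) * dP (g * unit_mat n j i * h) $$ (c, b))
      = (\<Sum>i<n. \<Sum>j<n. E i j $$ (a, c) * E j i $$ (c, b))" .
  qed
  also have "\<dots> = (\<Sum>i<n. \<Sum>j<n. \<Sum>c<d. E i j $$ (a, c) * E j i $$ (c, b))"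
    by (rule trans[OF sum.swap]) (intro sum.cong refl sum.swap)
  also have "\<dots> = Casimir $$ (a, b)"
    unfolding index_mult_sum[OF E_carrier E_carrier ab, symmetric] using ab by (simp add: Casimir_def)
  finally show "(P g * Casimir * P h) $$ (a, b) = Casimir $$ (a, b)" .
qed

lemma Casimir_commute:
  assumes g: "g \<in> carrier (GL n)"
  shows "P g * Casimir = Casimir * P g"
proof -
  obtain h where h: "h \<in> carrier (GL n)" "g * h = 1\<^sub>m n" "h * g = 1\<^sub>m n"
    using GL_inverse[OF g] .
  note c = P_carrier[OF g] P_carrier[OF h(1)]
  have "P g * Casimir * P h * P g = P g * Casimir * (P h * P g)"
    by (rule assoc_mult_mat[OF mult_carrier_mat[OF c(1) Casimir_carrier] c(2) c(1)])
  also have "\<dots> = P g * Casimir"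
    using P_inverse[OF h(1) g h(3)] right_mult_one_mat[OF mult_carrier_mat[OF c(1) Casimir_carrier]] by simp
  finally show ?thesis
    using Casimir_conj[OF g h] by simp
qed

end

section \<open>Schur's lemma and the value of the Casimir operator\<close>

context algebraic_GL_rep
begin

lemma irreducible_imp_full:
  assumes irr: "irreducible_rep n V" and W: "W \<subseteq> carrier_vec d"
    and zero: "0\<^sub>v d \<in> W"
    and add: "\<And>v w. v \<in> W \<Longrightarrow> w \<in> W \<Longrightarrow> v + w \<in> W"
    and smult: "\<And>c v. v \<in> W \<Longrightarrow> c \<cdot>\<^sub>v v \<in> W"
    and inv: "\<And>g w. g \<in> carrier (GL n) \<Longrightarrow> w \<in> W \<Longrightarrow> P g *\<^sub>v w \<in> W"
    and v: "v \<in> W" "v \<noteq> 0\<^sub>v d"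
  shows "W = carrier_vec d"
proof -
  have "VectorSpace.subspace class_ring W (module_vec TYPE(complex) d)"
    unfolding subspace_def submodule_def
    using vec_vs[of d, where 'a = complex] vec_module[of d, where 'a = complex] W zero add smult by (simp add: module_vec_simps class_ring_simps)
  then have "W = {0\<^sub>v d} \<or> W = carrier_vec d"
    using irr inv unfolding irreducible_rep_def by blast
  then show ?thesis
    using v by auto
qed

text \<open>An eigenspace of an operator that commutes with the group is an invariant subspace.\<close>

lemma Schur:
  assumes irr: "irreducible_rep n V" and A: "A \<in> carrier_mat d d"
    and comm: "\<And>g. g \<in> carrier (GL n) \<Longrightarrow> P g * A = A * P g"
    and v: "v \<in> carrier_vec d" "v \<noteq> 0\<^sub>v d" "A *\<^sub>v v = c \<cdot>\<^sub>v v"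
  shows "A = c \<cdot>\<^sub>m 1\<^sub>m d"
proof -
  define W where "W = {w \<in> carrier_vec d. A *\<^sub>v w = c \<cdot>\<^sub>v w}"
  have "W = carrier_vec d"
  proof (rule irreducible_imp_full[OF irr])
    show "W \<subseteq> carrier_vec d" by (auto simp: W_def)
    show "0\<^sub>v d \<in> W" using A by (auto simp: W_def intro!: eq_vecI)
    show "x + y \<in> W" if "x \<in> W" "y \<in> W" for x y
      using that A by (simp add: W_def mult_add_distrib_mat_vec[of _ d d] smult_add_distrib_vec[of _ d])
    show "a \<cdot>\<^sub>v x \<in> W" if "x \<in> W" for a x
      using that A by (simp add: W_def mult_mat_vec[of _ d d] smult_smult_assoc mult.commute)
    show "P g *\<^sub>v w \<in> W" if g: "g \<in> carrier (GL n)" and w: "w \<in> W" for g w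
    proof -
      note c = P_carrier[OF g]
      have wc: "w \<in> carrier_vec d" and we: "A *\<^sub>v w = c \<cdot>\<^sub>v w"
        using w by (auto simp: W_def)
      have "A *\<^sub>v (P g *\<^sub>v w) = (A * P g) *\<^sub>v w"
        using assoc_mult_mat_vec[OF A c wc] by simp
      also have "\<dots> = P g *\<^sub>v (A *\<^sub>v w)"
        unfolding comm[OF g, symmetric] using assoc_mult_mat_vec[OF c A wc] by simp
      also have "\<dots> = c \<cdot>\<^sub>v (P g *\<^sub>v w)"
        unfolding we using mult_mat_vec[OF c wc] by simp
      finally show ?thesis
        using c wc by (auto simp: W_def)
    qed
    show "v \<in> W" using v by (simp add: W_def)
  qed (rule v(2))
  then have "unit_vec d j \<in> W" for j
    by simp
  then have e: "A *\<^sub>v unit_vec d j = c \<cdot>\<^sub>v unit_vec d j" for j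
    unfolding W_def by blast
  show ?thesis
  proof (rule eq_matI)
    fix i j assume "i < dim_row (c \<cdot>\<^sub>m 1\<^sub>m d)" "j < dim_col (c \<cdot>\<^sub>m 1\<^sub>m d)"
    then have ij: "i < d" "j < d" by auto
    have "(A *\<^sub>v unit_vec d j) $ i = A $$ (i, j)"
      using A ij by simp
    then show "A $$ (i, j) = (c \<cdot>\<^sub>m 1\<^sub>m d) $$ (i, j)"
      unfolding e using ij by auto
  qed (use A in auto)
qed

end

locale highest_weight_GL_rep = algebraic_GL_rep +
  fixes lam :: "int list" and v :: "complex vec"
  assumes irr: "irreducible_rep n V"
    and len: "length lam = n"
    and v_carrier: "v \<in> carrier_vec d" and v_nonzero: "v \<noteq> 0\<^sub>v d"
    and v_weight: "\<And>b. b \<in> carrier (GL n) \<Longrightarrow> upper_triangular b \<Longrightarrow>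
      P b *\<^sub>v v = (\<Prod>i<n. (b $$ (i, i)) powi (lam ! i)) \<cdot>\<^sub>v v"
begin

definition wt :: "nat \<Rightarrow> int" where
  "wt i = (if i < n then lam ! i else 0)"

text \<open>If \<open>v\<close> is an eigenvector along a curve, it is an eigenvector of the derivative.\<close>

lemma mderiv_vec:
  assumes F: "mderiv d F D" and ev: "\<forall>\<^sub>F s in nhds 0. F s *\<^sub>v v = f s \<cdot>\<^sub>v v"
    and f: "(f has_field_derivative f') (at 0)"
  shows "D *\<^sub>v v = f' \<cdot>\<^sub>v v"
proof (rule eq_vecI)
  note D = mderiv_carrier[OF F]
  show "dim_vec (D *\<^sub>v v) = dim_vec (f' \<cdot>\<^sub>v v)"
    using D v_carrier by auto
  fix a assume "a < dim_vec (f' \<cdot>\<^sub>v v)"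
  then have a: "a < d" using v_carrier by auto
  have e: "(A *\<^sub>v v) $ a = (\<Sum>b<d. A $$ (a, b) * v $ b)" if "A \<in> carrier_mat d d" for A
    using that a v_carrier by (auto simp: scalar_prod_def atLeast0LessThan intro!: sum.cong)
  have "((\<lambda>s. \<Sum>b<d. F s $$ (a, b) * v $ b) has_field_derivative (\<Sum>b<d. D $$ (a, b) * v $ b)) (at 0)"
    using F a unfolding mderiv_def by (intro DERIV_sum DERIV_cmult_right) auto
  moreover have "((\<lambda>s. f s * v $ a) has_field_derivative f' * v $ a) (at 0)"
    using f by (rule DERIV_cmult_right)
  then have "((\<lambda>s. \<Sum>b<d. F s $$ (a, b) * v $ b) has_field_derivative f' * v $ a) (at 0)"
  proof (rule DERIV_eventually_eq)
    have "\<forall>\<^sub>F s in nhds 0. F s \<in> carrier_mat d d"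
      using F by (simp add: mderiv_def)
    with ev show "\<forall>\<^sub>F s in nhds 0. (\<Sum>b<d. F s $$ (a, b) * v $ b) = f s * v $ a"
    proof eventually_elim
      case (elim s)
      then have "(F s *\<^sub>v v) $ a = f s * v $ a"
        using a v_carrier by simp
      then show ?case
        using e[OF elim(2)] by simp
    qed
  qed
  ultimately have "(\<Sum>b<d. D $$ (a, b) * v $ b) = f' * v $ a"
    by (rule DERIV_unique)
  then show "(D *\<^sub>v v) $ a = (f' \<cdot>\<^sub>v v) $ a"
    using e[OF D] a v_carrier by simp
qed

lemma E_upper_v:
  assumes "i < j" "j < n"
  shows "E i j *\<^sub>v v = 0\<^sub>v d"
proof -
  have "E i j *\<^sub>v v = 0 \<cdot>\<^sub>v v"
    unfolding E_def
  proof (rule mderiv_vec[OF mderiv_P])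
    show "\<forall>\<^sub>F s in nhds 0. P (line n (unit_mat n i j) s) *\<^sub>v v = 1 \<cdot>\<^sub>v v"
      using eventually_line_GL[of n "unit_mat n i j"]
    proof eventually_elim
      case (elim s)
      have "upper_triangular (line n (unit_mat n i j) s)"
        using assms by (auto simp: upper_triangular_def line_def unit_mat_def)
      moreover have "(\<Prod>k<n. (line n (unit_mat n i j) s $$ (k, k)) powi (lam ! k)) = 1"
        using assms by (intro prod.neutral) (auto simp: line_def unit_mat_def)
      ultimately show ?case
        using v_weight[OF elim] by simp
    qed
  qed simp
  then show ?thesis
    using v_carrier by (auto intro!: eq_vecI)
qed

lemma E_diag_v:
  assumes "i < n"
  shows "E i i *\<^sub>v v = of_int (wt i) \<cdot>\<^sub>v v"
  unfolding E_def
proof (rule mderiv_vec[OF mderiv_P])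
  show "\<forall>\<^sub>F s in nhds 0. P (line n (unit_mat n i i) s) *\<^sub>v v = ((1 + s) powi wt i) \<cdot>\<^sub>v v"
    using eventually_line_GL[of n "unit_mat n i i"]
  proof eventually_elim
    case (elim s)
    have "upper_triangular (line n (unit_mat n i i) s)"
      by (auto simp: upper_triangular_def line_def unit_mat_def)
    moreover have "(\<Prod>k<n. (line n (unit_mat n i i) s $$ (k, k)) powi (lam ! k))
       = (\<Prod>k<n. if k = i then (1 + s) powi wt i else 1)"
      using assms by (intro prod.cong) (auto simp: line_def unit_mat_def wt_def)
    ultimately show ?case
      using v_weight[OF elim] assms by simp
  qed
  show "((\<lambda>s. (1 + s) powi wt i) has_field_derivative of_int (wt i)) (at 0)"
    by (auto intro!: derivative_eq_intros)
qed

definition casimir_value :: complex where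
  "casimir_value = (\<Sum>i<n. \<Sum>j<n. if i = j then of_int (wt i) ^ 2 else if i < j then of_int (wt i) - of_int (wt j) else 0)"

text \<open>For \<open>i \<noteq> j\<close>, one of \<open>E i j\<close>, \<open>E j i\<close> raises the weight and kills the highest weight vector. If it
  is not the one applied first, the commutator brings it there.\<close>

lemma EE_v:
  assumes "i < n" "j < n"
  shows "(E i j * E j i) *\<^sub>v v
    = (if i = j then of_int (wt i) ^ 2 else if i < j then of_int (wt i) - of_int (wt j) else 0) \<cdot>\<^sub>v v"
proof -
  have dv: "dim_vec v = d"
    using v_carrier by auto
  have as: "(E i j * E j i) *\<^sub>v v = E i j *\<^sub>v (E j i *\<^sub>v v)" for i j
    by (rule assoc_mult_mat_vec[OF E_carrier E_carrier v_carrier])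
  have z: "E i j *\<^sub>v 0\<^sub>v d = 0\<^sub>v d" for i j
    by (rule eq_vecI) auto
  consider "i = j" | "j < i" | "i < j" by linarith
  then show ?thesis
  proof cases
    case 1
    then show ?thesis
      using E_diag_v[OF assms(1)] mult_mat_vec[OF E_carrier v_carrier]
      by (simp add: as smult_smult_assoc power2_eq_square)
  next
    case 2
    then show ?thesis
      using E_upper_v[OF 2 assms(1)] dv by (auto simp: as z intro!: eq_vecI)
  next
    case 3
    have "(E i j * E j i) *\<^sub>v v = (E j i * E i j) *\<^sub>v v + (E i i - E j j) *\<^sub>v v"
      unfolding bracket[OF assms less_imp_neq[OF 3]]
      by (rule add_mult_distrib_mat_vec[OF _ _ v_carrier]) (auto intro: mult_carrier_mat)
    also have "(E j i * E i j) *\<^sub>v v = 0\<^sub>v d"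
      using E_upper_v[OF 3 assms(2)] by (simp only: as z)
    also have "(E i i - E j j) *\<^sub>v v = E i i *\<^sub>v v - E j j *\<^sub>v v"
      by (rule minus_mult_distrib_mat_vec[OF _ _ v_carrier]) auto
    also have "\<dots> = (of_int (wt i) - of_int (wt j)) \<cdot>\<^sub>v v"
      unfolding E_diag_v[OF assms(1)] E_diag_v[OF assms(2)] by (rule eq_vecI) (auto simp: algebra_simps)
    finally show ?thesis
      using 3 dv by (auto intro!: eq_vecI)
  qed
qed

lemma Casimir_v: "Casimir *\<^sub>v v = casimir_value \<cdot>\<^sub>v v"
proof (rule eq_vecI)
  have dv: "dim_vec v = d"
    using v_carrier by auto
  show "dim_vec (Casimir *\<^sub>v v) = dim_vec (casimir_value \<cdot>\<^sub>v v)"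
    using dv by (simp add: Casimir_def)
  fix a assume "a < dim_vec (casimir_value \<cdot>\<^sub>v v)"
  then have a: "a < d" using dv by auto
  have e: "(A *\<^sub>v v) $ a = (\<Sum>b<d. A $$ (a, b) * v $ b)" if "A \<in> carrier_mat d d" for A
    using that a v_carrier by (auto simp: scalar_prod_def atLeast0LessThan intro!: sum.cong)
  have "(Casimir *\<^sub>v v) $ a = (\<Sum>b<d. \<Sum>i<n. \<Sum>j<n. (E i j * E j i) $$ (a, b) * v $ b)"
    unfolding e[OF Casimir_carrier] using a
    by (intro sum.cong refl) (simp add: Casimir_def sum_distrib_right del: index_mult_mat(1))
  also have "\<dots> = (\<Sum>i<n. \<Sum>j<n. \<Sum>b<d. (E i j * E j i) $$ (a, b) * v $ b)"
    by (rule trans[OF sum.swap]) (intro sum.cong refl sum.swap)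
  also have "\<dots> = (\<Sum>i<n. \<Sum>j<n. ((E i j * E j i) *\<^sub>v v) $ a)"
    unfolding e[OF mult_carrier_mat[OF E_carrier E_carrier]] ..
  also have "\<dots> = (casimir_value \<cdot>\<^sub>v v) $ a"
    using a dv by (simp add: EE_v casimir_value_def sum_distrib_right)
  finally show "(Casimir *\<^sub>v v) $ a = (casimir_value \<cdot>\<^sub>v v) $ a" .
qed

lemma Casimir_scalar: "Casimir = casimir_value \<cdot>\<^sub>m 1\<^sub>m d"
  by (rule Schur[OF irr Casimir_carrier Casimir_commute v_carrier v_nonzero Casimir_v])

end

section \<open>The radial part of the Casimir operator\<close>

lemma sum_off_diagonal:
  fixes H :: "nat \<Rightarrow> nat \<Rightarrow> complex"
  shows "(\<Sum>i<n. \<Sum>j\<in>{..<n} - {i}. H i j) = (\<Sum>(i, j)\<in>pairs n. H i j + H j i)"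
proof -
  have "(\<Sum>i<n. \<Sum>j\<in>{..<n} - {i}. H i j) = (\<Sum>(i, j)\<in>(SIGMA i:{..<n}. {..<n} - {i}). H i j)"
    by (rule sum.Sigma) auto
  also have "(SIGMA i:{..<n}. {..<n} - {i}) = pairs n \<union> prod.swap ` pairs n"
    by (auto simp: pairs_def)
  also have "(\<Sum>(i, j)\<in>pairs n \<union> prod.swap ` pairs n. H i j)
      = (\<Sum>(i, j)\<in>pairs n. H i j) + (\<Sum>(i, j)\<in>prod.swap ` pairs n. H i j)"
    by (rule sum.union_disjoint) (use finite_pairs[of n] in \<open>auto simp: pairs_def\<close>)
  also have "(\<Sum>(i, j)\<in>prod.swap ` pairs n. H i j) = (\<Sum>(i, j)\<in>pairs n. H j i)"
    by (subst sum.reindex) (simp_all add: comp_def case_prod_beta inj_on_def prod_eq_iff)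
  finally show ?thesis
    unfolding split_def sum.distrib .
qed

lemma leval_ldiff_prod:
  assumes t: "t \<in> torus n" and X: "finite X" "\<And>x. x \<in> X \<Longrightarrow> leval n (f x) t \<noteq> 0"
  shows "leval n (ldiff i (\<Prod>x\<in>X. f x)) t
    = leval n (\<Prod>x\<in>X. f x) t * (\<Sum>x\<in>X. leval n (ldiff i (f x)) t / leval n (f x) t)"
  using X
proof (induction X rule: finite_induct)
  case empty
  have "ldiff i 1 = 0"
    by (rule poly_mapping_eqI) (simp add: lookup_one when_def)
  then show ?case by simp
next
  case (insert x X)
  have "leval n (f x) t \<noteq> 0"
    using insert by simp
  moreover have "leval n (ldiff i (\<Prod>x\<in>X. f x)) t
    = leval n (\<Prod>x\<in>X. f x) t * (\<Sum>x\<in>X. leval n (ldiff i (f x)) t / leval n (f x) t)"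
    using insert by simp
  ultimately show ?case
    unfolding prod.insert[OF insert.hyps] sum.insert[OF insert.hyps] ldiff_mult leval_add leval_mult[OF t]
    by (simp add: field_simps)
qed

lemma leval_ldiff_vandermonde:
  assumes t: "t \<in> regular n" and i: "i < n"
  shows "leval n (ldiff i (vandermonde n)) t = leval n (vandermonde n) t * (\<Sum>j\<in>{..<n} - {i}. t i / (t i - t j))"
proof -
  note tt = regular_torus[OF t]
  define F :: "nat \<times> nat \<Rightarrow> laurent"
    where "F x = Poly_Mapping.single (unit_exp (fst x)) 1 - Poly_Mapping.single (unit_exp (snd x)) 1" for x
  have v: "vandermonde n = (\<Prod>x\<in>pairs n. F x)"
    by (simp add: vandermonde_def F_def case_prod_beta)
  have f: "leval n (F x) t = t (fst x) - t (snd x)" if "x \<in> pairs n" for x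
    using that by (auto simp: pairs_def F_def mono_at_unit_exp)
  have ne: "t (fst x) - t (snd x) \<noteq> 0" if "x \<in> pairs n" for x
    using that t by (fastforce simp: pairs_def regular_def inj_on_def)
  let ?H = "\<lambda>a b. if a = i then t a / (t a - t b) else 0"
  have "leval n (ldiff i (F x)) t / leval n (F x) t = ?H (fst x) (snd x) + ?H (snd x) (fst x)"
    if x: "x \<in> pairs n" for x
  proof -
    have "ldiff i (F x) = Poly_Mapping.single (unit_exp (fst x)) (if fst x = i then 1 else 0)
        - Poly_Mapping.single (unit_exp (snd x)) (if snd x = i then 1 else 0)"
    proof (rule poly_mapping_eqI)
      fix \<nu>
      have "unit_exp (fst x) i = (if fst x = i then 1 else 0)" "unit_exp (snd x) i = (if snd x = i then 1 else 0)"
        by (auto simp: unit_exp_def)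
      then show "coef (ldiff i (F x)) \<nu> = coef (Poly_Mapping.single (unit_exp (fst x)) (if fst x = i then 1 else 0)
          - Poly_Mapping.single (unit_exp (snd x)) (if snd x = i then 1 else 0)) \<nu>"
        by (auto simp: F_def lookup_minus lookup_single when_def)
    qed
    then have e: "leval n (ldiff i (F x)) t = (if fst x = i then t (fst x) else 0) - (if snd x = i then t (snd x) else 0)"
      using x by (auto simp: pairs_def mono_at_unit_exp)
    have "t (snd x) / (t (fst x) - t (snd x)) = - (t (snd x) / (t (snd x) - t (fst x)))"
      using ne[OF x] by (simp add: minus_divide_right)
    moreover have "fst x \<noteq> snd x"
      using x by (auto simp: pairs_def)
    ultimately show ?thesis
      unfolding e f[OF x] by auto
  qed
  then have "(\<Sum>x\<in>pairs n. leval n (ldiff i (F x)) t / leval n (F x) t)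
      = (\<Sum>(a, b)\<in>pairs n. ?H a b + ?H b a)"
    by (intro sum.cong refl) (simp add: case_prod_beta)
  also have "\<dots> = (\<Sum>a<n. \<Sum>b\<in>{..<n} - {a}. ?H a b)"
    by (rule sum_off_diagonal[symmetric])
  also have "\<dots> = (\<Sum>a<n. if a = i then \<Sum>b\<in>{..<n} - {i}. t i / (t i - t b) else 0)"
    by (intro sum.cong refl) auto
  also have "\<dots> = (\<Sum>j\<in>{..<n} - {i}. t i / (t i - t j))"
    using i by simp
  finally have "(\<Sum>x\<in>pairs n. leval n (ldiff i (F x)) t / leval n (F x) t) = (\<Sum>j\<in>{..<n} - {i}. t i / (t i - t j))" .
  moreover have "leval n (F x) t \<noteq> 0" if "x \<in> pairs n" for x
    unfolding f[OF that] by (rule ne[OF that])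
  then have "leval n (ldiff i (\<Prod>x\<in>pairs n. F x)) t
    = leval n (\<Prod>x\<in>pairs n. F x) t * (\<Sum>x\<in>pairs n. leval n (ldiff i (F x)) t / leval n (F x) t)"
    by (rule leval_ldiff_prod[OF tt finite_pairs])
  ultimately show ?thesis
    unfolding v by metis
qed

definition lscale :: "complex \<Rightarrow> laurent \<Rightarrow> laurent" where
  "lscale c p = Poly_Mapping.single 0 c * p"

definition laplacian :: "nat \<Rightarrow> laurent \<Rightarrow> laurent" where
  "laplacian n p = (\<Sum>i<n. ldiff i (ldiff i p))"

definition norm_sq :: "nat \<Rightarrow> (nat \<Rightarrow> int) \<Rightarrow> int" where
  "norm_sq n \<nu> = (\<Sum>i<n. \<nu> i * \<nu> i)"

lemma coef_laplacian: "coef (laplacian n p) \<nu> = of_int (norm_sq n \<nu>) * coef p \<nu>"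
  by (simp add: laplacian_def norm_sq_def lookup_sum sum_distrib_right mult.assoc)

lemma coef_lscale: "coef (lscale c p) \<nu> = c * coef p \<nu>"
  unfolding lscale_def mult_map_scale_conv_mult[symmetric] by (simp add: map.rep_eq when_def)

lemma leval_lscale: "leval n (lscale c p) t = c * leval n p t"
  unfolding leval_def sum_distrib_left
proof (rule sum.mono_neutral_cong_left)
  show "supp (lscale c p) \<subseteq> supp p"
    by (auto simp: in_keys_iff coef_lscale)
qed (auto simp: in_keys_iff coef_lscale)

lemma laplacian_vandermonde: "laplacian n (vandermonde n) = lscale (of_int (norm_sq n (rho_exp n))) (vandermonde n)"
proof (rule poly_mapping_eqI)
  fix \<nu>
  show "coef (laplacian n (vandermonde n)) \<nu> = coef (lscale (of_int (norm_sq n (rho_exp n))) (vandermonde n)) \<nu>"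
  proof (cases "\<nu> \<in> supp (vandermonde n)")
    case True
    then obtain \<sigma> where \<sigma>: "\<sigma> permutes {..<n}" "\<nu> = rho_exp n \<circ> \<sigma>"
      unfolding vandermonde_eq_alternant using supp_alternant by blast
    have "norm_sq n \<nu> = norm_sq n (rho_exp n)"
      unfolding norm_sq_def \<sigma>(2) by (subst (2) sum.permute[OF \<sigma>(1)]) (simp add: comp_def)
    then show ?thesis
      by (simp add: coef_laplacian coef_lscale)
  next
    case False
    then show ?thesis
      by (simp add: coef_laplacian coef_lscale in_keys_iff)
  qed
qed

text \<open>The dominance order fixes the sum of the entries, so all monomials have the same total degree.\<close>

lemma sum_ldiff_leading:
  assumes "leading n \<nu> p"
  shows "(\<Sum>i<n. ldiff i p) = lscale (of_int (partial_sum n \<nu>)) p"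
proof (rule poly_mapping_eqI)
  fix \<kappa>
  have "coef (\<Sum>i<n. ldiff i p) \<kappa> = of_int (partial_sum n \<kappa>) * coef p \<kappa>"
    by (simp add: lookup_sum partial_sum_def sum_distrib_right)
  also have "\<dots> = of_int (partial_sum n \<nu>) * coef p \<kappa>"
    using leading_lower[OF assms, of \<kappa>] by (cases "\<kappa> \<in> supp p") (auto simp: lower_def in_keys_iff)
  finally show "coef (\<Sum>i<n. ldiff i p) \<kappa> = coef (lscale (of_int (partial_sum n \<nu>)) p) \<kappa>"
    by (simp add: coef_lscale)
qed

text \<open>Multiplication by the Vandermonde product \<open>A\<close> removes the first order terms of the radial
  equation: the logarithmic derivatives of \<open>A\<close> are the coefficients \<open>\<Sum>\<^sub>j t\<^sub>i / (t\<^sub>i - t\<^sub>j)\<close>, and the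
  identity \<open>t\<^sub>i / (t\<^sub>i - t\<^sub>j) + t\<^sub>j / (t\<^sub>j - t\<^sub>i) = 1\<close> reduces what is left to the total degree.\<close>

lemma laplacian_vandermonde_mult:
  assumes t: "t \<in> regular n" and lead: "leading n \<nu> p"
    and radial: "c * leval n p t = (\<Sum>i<n. leval n (ldiff i (ldiff i p)) t)
      + (\<Sum>i<n. \<Sum>j\<in>{..<n} - {i}. t i / (t i - t j) * (leval n (ldiff i p) t - leval n (ldiff j p) t))"
  shows "leval n (laplacian n (vandermonde n * p)) t
    = (of_int (norm_sq n (rho_exp n)) + c + (of_nat n - 1) * of_int (partial_sum n \<nu>)) * leval n (vandermonde n * p) t"
proof -
  note tt = regular_torus[OF t]
  define A where "A = leval n (vandermonde n) t"
  define q where "q = leval n p t"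
  define D where "D i = leval n (ldiff i p) t" for i
  define D2 where "D2 i = leval n (ldiff i (ldiff i p)) t" for i
  define g where "g i j = t i / (t i - t j)" for i j
  define R :: complex where "R = of_int (norm_sq n (rho_exp n))"
  define \<Lambda> :: complex where "\<Lambda> = of_int (partial_sum n \<nu>)"
  have ne: "t i - t j \<noteq> 0" if "(i, j) \<in> pairs n" for i j
    using that t by (fastforce simp: pairs_def regular_def inj_on_def)
  have rad: "(\<Sum>i<n. D2 i) = c * q - (\<Sum>i<n. \<Sum>j\<in>{..<n} - {i}. g i j * (D i - D j))"
    using radial by (simp add: q_def D2_def D_def g_def)
  have dA: "leval n (ldiff i (vandermonde n)) t = A * (\<Sum>j\<in>{..<n} - {i}. g i j)" if "i < n" for i
    using leval_ldiff_vandermonde[OF t that] by (simp add: A_def g_def)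
  have LA: "(\<Sum>i<n. leval n (ldiff i (ldiff i (vandermonde n))) t) = R * A"
    using arg_cong[OF laplacian_vandermonde, of "\<lambda>p. leval n p t"] by (simp add: laplacian_def leval_lscale A_def R_def del: leval_mult)
  have SD: "(\<Sum>i<n. D i) = \<Lambda> * q"
    using arg_cong[OF sum_ldiff_leading[OF lead], of "\<lambda>p. leval n p t"] by (simp add: leval_lscale D_def \<Lambda>_def q_def del: leval_mult)
  \<comment> \<open>Pairing \<open>(i, j)\<close> with \<open>(j, i)\<close> cancels all denominators.\<close>
  have sym: "(\<Sum>i<n. \<Sum>j\<in>{..<n} - {i}. g i j * (D i + D j)) = (of_nat n - 1) * (\<Lambda> * q)"
  proof -
    have "(\<Sum>i<n. \<Sum>j\<in>{..<n} - {i}. g i j * (D i + D j))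
        = (\<Sum>(i, j)\<in>pairs n. g i j * (D i + D j) + g j i * (D j + D i))"
      by (rule sum_off_diagonal)
    also have "\<dots> = (\<Sum>(i, j)\<in>pairs n. D i + D j)"
    proof (rule sum.cong[OF refl], clarify)
      fix i j assume "(i, j) \<in> pairs n"
      then have "t i - t j \<noteq> 0"
        by (rule ne)
      moreover have "t j / (t j - t i) = - (t j / (t i - t j))"
        using minus_divide_right[of "t j" "t i - t j"] by simp
      ultimately have "g i j + g j i = 1"
        unfolding g_def by (simp add: diff_divide_distrib[symmetric])
      then have "(g i j + g j i) * (D i + D j) = D i + D j"
        by simp
      then show "g i j * (D i + D j) + g j i * (D j + D i) = D i + D j"
        by (simp add: algebra_simps)
    qed
    also have "\<dots> = (\<Sum>i<n. \<Sum>j\<in>{..<n} - {i}. D i)"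
      by (rule sum_off_diagonal[symmetric])
    also have "\<dots> = (\<Sum>i<n. (of_nat n - 1) * D i)"
      by (intro sum.cong refl) (auto simp: of_nat_diff)
    finally show ?thesis
      by (simp add: sum_distrib_left[symmetric] SD)
  qed
  have "leval n (laplacian n (vandermonde n * p)) t
      = (\<Sum>i<n. leval n (ldiff i (ldiff i (vandermonde n))) t * q + 2 * leval n (ldiff i (vandermonde n)) t * D i + A * D2 i)"
    unfolding laplacian_def leval_sum
    unfolding ldiff_mult ldiff_add leval_add leval_mult[OF tt] A_def q_def D_def D2_def
    by (intro sum.cong refl) (simp add: algebra_simps)
  also have "\<dots> = (\<Sum>i<n. leval n (ldiff i (ldiff i (vandermonde n))) t) * q
      + A * (\<Sum>i<n. \<Sum>j\<in>{..<n} - {i}. 2 * g i j * D i) + A * (\<Sum>i<n. D2 i)"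
  proof -
    have "(\<Sum>i<n. 2 * leval n (ldiff i (vandermonde n)) t * D i) = A * (\<Sum>i<n. \<Sum>j\<in>{..<n} - {i}. 2 * g i j * D i)"
      unfolding sum_distrib_left[of A]
      by (intro sum.cong refl) (simp add: dA sum_distrib_left sum_distrib_right mult_ac)
    then show ?thesis
      by (simp only: sum.distrib sum_distrib_left[symmetric] sum_distrib_right[symmetric])
  qed
  also have "\<dots> = R * A * q + A * (c * q
      + ((\<Sum>i<n. \<Sum>j\<in>{..<n} - {i}. 2 * g i j * D i) - (\<Sum>i<n. \<Sum>j\<in>{..<n} - {i}. g i j * (D i - D j))))"
    unfolding rad LA by (simp add: algebra_simps)
  also have "(\<Sum>i<n. \<Sum>j\<in>{..<n} - {i}. 2 * g i j * D i) - (\<Sum>i<n. \<Sum>j\<in>{..<n} - {i}. g i j * (D i - D j))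
      = (\<Sum>i<n. \<Sum>j\<in>{..<n} - {i}. g i j * (D i + D j))"
    unfolding sum_subtractf[symmetric] by (intro sum.cong refl) (simp add: algebra_simps)
  also note sym
  finally show ?thesis
    by (simp add: tt A_def q_def R_def \<Lambda>_def algebra_simps)
qed

text \<open>The three constants of the radial equation add up to \<open>|\<nu> + \<rho>|\<^sup>2\<close>. With the choice
  \<open>\<rho> = (n - 1, \<dots>, 0)\<close>, which has nonzero sum, the total degree of \<open>\<nu>\<close> enters.\<close>

lemma norm_sq_shift:
  fixes \<nu> :: "nat \<Rightarrow> int"
  shows "norm_sq n (rho_exp n)
      + (\<Sum>i<n. \<Sum>j<n. if i = j then \<nu> i ^ 2 else if i < j then \<nu> i - \<nu> j else 0)
      + (int n - 1) * partial_sum n \<nu>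
    = norm_sq n (rho_exp n + \<nu>)"
proof -
  have row: "(\<Sum>j<n. if i = j then \<nu> i ^ 2 else if i < j then \<nu> i - \<nu> j else 0)
      = \<nu> i ^ 2 + (\<Sum>j<n. if i < j then \<nu> i else 0) - (\<Sum>j<n. if i < j then \<nu> j else 0)" if "i < n" for i
  proof -
    have "(\<Sum>j<n. if i = j then \<nu> i ^ 2 else if i < j then \<nu> i - \<nu> j else 0)
      = (\<Sum>j<n. (if j = i then \<nu> i ^ 2 else 0) + (if i < j then \<nu> i else 0) - (if i < j then \<nu> j else 0))"
      by (intro sum.cong refl) auto
    then show ?thesis
      using that by (simp add: sum.distrib sum_subtractf)
  qed
  have up: "(\<Sum>j<n. if i < j then \<nu> i else 0) = (int n - 1 - int i) * \<nu> i" if "i < n" for i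
  proof -
    have "(\<Sum>j<n. if i < j then \<nu> i else 0) = (\<Sum>j\<in>{Suc i..<n}. \<nu> i)"
      by (rule sum.mono_neutral_cong_right) auto
    then show ?thesis
      using that by (simp add: of_nat_diff)
  qed
  have down: "(\<Sum>i<n. \<Sum>j<n. if i < j then \<nu> j else 0) = (\<Sum>j<n. int j * \<nu> j)"
  proof -
    have "(\<Sum>i<n. if i < j then \<nu> j else 0) = int j * \<nu> j" if "j < n" for j
    proof -
      have "(\<Sum>i<n. if i < j then \<nu> j else 0) = (\<Sum>i\<in>{..<j}. \<nu> j)"
        by (rule sum.mono_neutral_cong_right) (use that in auto)
      then show ?thesis by simp
    qed
    then show ?thesis
      by (subst sum.swap) simp
  qed
  have "(\<Sum>i<n. \<Sum>j<n. if i = j then \<nu> i ^ 2 else if i < j then \<nu> i - \<nu> j else 0)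
      = (\<Sum>i<n. \<nu> i ^ 2 + (int n - 1 - int i) * \<nu> i) - (\<Sum>i<n. int i * \<nu> i)"
    unfolding down[symmetric] sum_subtractf[symmetric] by (intro sum.cong refl) (simp add: row up)
  moreover have "norm_sq n (rho_exp n + \<nu>) = (\<Sum>i<n. rho_exp n i * rho_exp n i + \<nu> i ^ 2
      + (int n - 1 - int i) * \<nu> i - int i * \<nu> i + (int n - 1) * \<nu> i)"
    unfolding norm_sq_def
    by (intro sum.cong refl) (simp add: rho_exp_def of_nat_diff power2_eq_square algebra_simps)
  ultimately show ?thesis
    by (simp add: norm_sq_def partial_sum_def sum.distrib sum_subtractf sum_distrib_left)
qed

section \<open>Lower unitriangular matrices and spanning sets\<close>

definition lower_unitriangular :: "nat \<Rightarrow> complex mat \<Rightarrow> bool" where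
  "lower_unitriangular n u \<longleftrightarrow> u \<in> carrier_mat n n \<and> (\<forall>i<n. u $$ (i, i) = 1)
     \<and> (\<forall>i<n. \<forall>j<n. i < j \<longrightarrow> u $$ (i, j) = 0)"

lemma det_lower_unitriangular: "lower_unitriangular n u \<Longrightarrow> det u = 1"
proof -
  assume u: "lower_unitriangular n u"
  then have "det u = prod_list (diag_mat u)"
    by (intro det_lower_triangular[of n]) (auto simp: lower_unitriangular_def)
  also have "\<dots> = 1"
    unfolding prod_list_diag_prod using u by (intro prod.neutral) (auto simp: lower_unitriangular_def)
  finally show ?thesis .
qed

lemma lower_unitriangular_GL: "lower_unitriangular n u \<Longrightarrow> u \<in> carrier (GL n)"
  using det_lower_unitriangular[of n u] by (simp add: in_GL_iff lower_unitriangular_def)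

definition leading_block :: "nat \<Rightarrow> 'a mat \<Rightarrow> 'a mat" where
  "leading_block k A = mat k k (\<lambda>(i, j). A $$ (i, j))"

text \<open>Induction on the size: the factors of the leading block extend uniquely by a last row and a
  last column, because they are invertible.\<close>

lemma LU_decomposition:
  assumes "A \<in> carrier_mat n n" "\<And>k. k \<le> n \<Longrightarrow> det (leading_block k A) \<noteq> (0 :: complex)"
  shows "\<exists>L U. lower_unitriangular n L \<and> U \<in> carrier_mat n n \<and> upper_triangular U \<and> A = L * U"
  using assms
proof (induction n arbitrary: A)
  case 0
  then show ?case
    by (intro exI[of _ A] exI[of _ "1\<^sub>m 0"]) (auto simp: lower_unitriangular_def)
next
  case (Suc n)
  let ?A = "leading_block n A"
  have A: "?A \<in> carrier_mat n n"
    by (simp add: leading_block_def)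
  have "leading_block k ?A = leading_block k A" if "k \<le> n" for k
    using that by (intro eq_matI) (auto simp: leading_block_def)
  then obtain L U where L: "lower_unitriangular n L" and U: "U \<in> carrier_mat n n" "upper_triangular U"
    and LU: "?A = L * U"
    using Suc.IH[OF A] Suc.prems(2) by force
  have Lc: "L \<in> carrier_mat n n"
    using L by (simp add: lower_unitriangular_def)
  have "det U \<noteq> 0"
    using Suc.prems(2)[of n] det_mult[OF Lc U(1)] by (auto simp: LU)
  then obtain Ui where Ui: "Ui \<in> carrier_mat n n" "Ui * U = 1\<^sub>m n"
    using GL_inverse[of U n] U(1) by (metis in_GL_iff)
  obtain Li where Li: "Li \<in> carrier_mat n n" "L * Li = 1\<^sub>m n"
    using GL_inverse[OF lower_unitriangular_GL[OF L]] by (metis in_GL_iff)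
  define b where "b = mat n 1 (\<lambda>(i, j). A $$ (i, n))"
  define c where "c = mat 1 n (\<lambda>(i, j). A $$ (n, j))"
  define y where "y = Li * b"
  define x where "x = c * Ui"
  define e where "e = mat 1 1 (\<lambda>_. A $$ (n, n)) - x * y"
  have bc: "b \<in> carrier_mat n 1" "c \<in> carrier_mat 1 n"
    by (simp_all add: b_def c_def)
  have yx: "y \<in> carrier_mat n 1" "x \<in> carrier_mat 1 n"
    unfolding x_def y_def using mult_carrier_mat[OF Li(1) bc(1)] mult_carrier_mat[OF bc(2) Ui(1)] by simp_all
  have e: "e \<in> carrier_mat 1 1"
    unfolding e_def by (rule minus_carrier_mat[OF mult_carrier_mat[OF yx(2) yx(1)]])
  let ?L = "four_block_mat L (0\<^sub>m n 1) x (1\<^sub>m 1)" and ?U = "four_block_mat U y (0\<^sub>m 1 n) e"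
  have Ly: "L * y = b"
    unfolding y_def using assoc_mult_mat[OF Lc Li(1) bc(1)] Li(2) left_mult_one_mat[OF bc(1)] by simp
  have xU: "x * U = c"
    unfolding x_def using assoc_mult_mat[OF bc(2) Ui(1) U(1)] Ui(2) right_mult_one_mat[OF bc(2)] by simp
  have xye: "x * y + e = mat 1 1 (\<lambda>_. A $$ (n, n))"
  proof -
    have "Z + (mat 1 1 (\<lambda>_. A $$ (n, n)) - Z) = mat 1 1 (\<lambda>_. A $$ (n, n))"
      if "Z \<in> carrier_mat 1 1" for Z
      using that by (intro eq_matI) auto
    then show ?thesis
      unfolding e_def using mult_carrier_mat[OF yx(2) yx(1)] by blast
  qed
  have "?L * ?U = four_block_mat (L * U + 0\<^sub>m n 1 * 0\<^sub>m 1 n) (L * y + 0\<^sub>m n 1 * e)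
      (x * U + 1\<^sub>m 1 * 0\<^sub>m 1 n) (x * y + 1\<^sub>m 1 * e)"
    by (rule mult_four_block_mat[OF Lc _ yx(2) _ U(1) yx(1) _ e]) auto
  also have "\<dots> = four_block_mat ?A b c (mat 1 1 (\<lambda>_. A $$ (n, n)))"
    using A bc e by (simp add: LU[symmetric] Ly xU xye)
  also have "\<dots> = A"
    using Suc.prems(1) by (intro eq_matI) (auto simp: leading_block_def b_def c_def less_Suc_eq)
  finally have "A = ?L * ?U" ..
  moreover have "lower_unitriangular (Suc n) ?L"
    using L Lc yx by (auto simp: lower_unitriangular_def less_Suc_eq)
  moreover have "?U \<in> carrier_mat (Suc n) (Suc n)"
    using U e by auto
  moreover have "upper_triangular ?U"
    using U e by (auto simp: upper_triangular_def less_Suc_eq)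
  ultimately show ?case by blast
qed

text \<open>Along the line from the identity in direction \<open>X\<close> a leading minor is a polynomial in \<open>s\<close> with
  value 1 at \<open>s = 0\<close>, so it has finitely many zeros.\<close>

lemma finite_bad_minors:
  fixes X :: "complex mat"
  assumes "k \<le> n"
  shows "finite {s. det (leading_block k (line n X s)) = 0}"
proof -
  define M where "M = mat k k (\<lambda>(i, j). [:(if i = j then 1 else 0), X $$ (i, j):])"
  have e: "det (leading_block k (line n X s)) = poly (det M) s" for s
  proof -
    have M: "M \<in> carrier_mat k k" and B: "leading_block k (line n X s) \<in> carrier_mat k k"
      by (simp_all add: M_def leading_block_def)
    have entry: "leading_block k (line n X s) $$ (i, j) = poly (M $$ (i, j)) s" if "i < k" "j < k" for i j
      using that assms by (simp add: M_def leading_block_def line_index)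
    show ?thesis
      unfolding det_def'[OF M] det_def'[OF B] poly_sum
    proof (rule sum.cong[OF refl])
      fix p assume "p \<in> {p. p permutes {0..<k}}"
      then have "p i < k" if "i < k" for i
        using permutes_in_image[of p "{0..<k}" i] that by simp
      then have "(\<Prod>i = 0..<k. leading_block k (line n X s) $$ (i, p i)) = (\<Prod>i = 0..<k. poly (M $$ (i, p i)) s)"
        by (intro prod.cong) (auto simp: entry)
      then show "of_int (sign p) * (\<Prod>i = 0..<k. leading_block k (line n X s) $$ (i, p i))
        = poly (of_int (sign p) * (\<Prod>i = 0..<k. M $$ (i, p i))) s"
        by (simp add: poly_prod sign_def)
    qed
  qed
  have "leading_block k (line n X 0) = 1\<^sub>m k"
    using assms by (intro eq_matI) (auto simp: leading_block_def)
  then have "poly (det M) 0 \<noteq> 0"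
    unfolding e[symmetric] by simp
  then have "det M \<noteq> 0"
    by auto
  then show ?thesis
    unfolding e by (rule poly_roots_finite)
qed

lemma isCont_line_entry: "i < n \<Longrightarrow> j < n \<Longrightarrow> isCont (\<lambda>s. line n X s $$ (i, j)) s0"
  by (simp add: line_index)

lemma isCont_det_line: "isCont (\<lambda>s. det (line n X s)) s0"
  unfolding det_def'[OF line_carrier]
proof (intro continuous_sum continuous_mult continuous_const continuous_prod isCont_line_entry)
  fix p i assume p: "p \<in> {p. p permutes {0..<n}}" and i: "i \<in> {0..<n}"
  then show "i < n" "p i < n"
    using permutes_in_image[of p "{0..<n}" i] by auto
qed

lemma regular_fun_continuous:
  assumes "f \<in> regular_funs n" and X: "det (line n X s0) \<noteq> 0"
  shows "isCont (\<lambda>s. f (line n X s)) s0"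
  using assms(1)
proof induction
  case (const c)
  show ?case by simp
next
  case (entry i j)
  then show ?case by (rule isCont_line_entry)
next
  case inverse_det
  show ?case
    by (rule continuous_at_within_inverse[OF isCont_det_line X])
next
  case (add f h)
  show ?case by (rule continuous_add[OF add.IH])
next
  case (mult f h)
  show ?case by (rule continuous_mult[OF mult.IH])
qed

text \<open>If a basis vector is outside the span of \<open>X\<close>, some linear form vanishes on \<open>X\<close> but not on it.\<close>

lemma unit_vec_in_span:
  fixes X :: "complex vec set"
  assumes X: "X \<subseteq> carrier_vec d" and i: "i < d"
    and sep: "\<And>\<phi>. \<phi> \<in> carrier_vec d \<Longrightarrow> (\<And>x. x \<in> X \<Longrightarrow> \<phi> \<bullet> x = 0) \<Longrightarrow> \<phi> $ i = 0"
  obtains Y r where "finite Y" "Y \<subseteq> X" "\<And>a. a < d \<Longrightarrow> (\<Sum>y\<in>Y. r y * y $ a) = (if a = i then 1 else 0)"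
proof -
  let ?s = "\<lambda>(c::complex) (f::nat \<Rightarrow> complex) x. c * f x"
  interpret vs: vector_space_pair ?s "(*) :: complex \<Rightarrow> complex \<Rightarrow> complex"
    by unfold_locales (auto simp: fun_eq_iff algebra_simps)
  let ?h = "\<lambda>x a. if a < d then x $ a else (0 :: complex)"
  let ?e = "\<lambda>j a. if a = j then 1 else (0 :: complex)"
  have "?e i \<in> vs.vs1.span (?h ` X)"
  proof (rule ccontr)
    assume ni: "?e i \<notin> vs.vs1.span (?h ` X)"
    obtain B where B: "B \<subseteq> ?h ` X" "vs.vs1.independent B" "?h ` X \<subseteq> vs.vs1.span B"
      by (rule vs.vs1.maximal_independent_subset)
    have "?e i \<notin> vs.vs1.span B"
      using ni vs.vs1.span_mono[OF B(1)] by blast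
    then have "vs.vs1.independent (insert (?e i) B)"
      using B(2) by (rule vs.vs1.independent_insertI)
    then obtain g where g: "Vector_Spaces.linear ?s (*) g" "\<forall>x\<in>insert (?e i) B. g x = (if x = ?e i then 1 else 0)"
      using vs.linear_independent_extend[where f = "\<lambda>x. if x = ?e i then 1 else 0"] by blast
    interpret g: Vector_Spaces.linear ?s "(*)" g by fact
    have "?e i \<notin> B"
      using \<open>?e i \<notin> vs.vs1.span B\<close> vs.vs1.span_superset by blast
    then have gB: "g b = 0" if "b \<in> B" for b
      using g(2) that by auto
    have gX: "g (?h x) = 0" if "x \<in> X" for x
    proof (rule g.eq_0_on_span)
      show "g b = 0" if "b \<in> B" for b
        by (rule gB[OF that])
      show "?h x \<in> vs.vs1.span B"
        using B(3) \<open>x \<in> X\<close> by blast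
    qed
    define \<phi> where "\<phi> = vec d (\<lambda>j. g (?e j))"
    have "\<phi> \<bullet> x = 0" if x: "x \<in> X" for x
    proof -
      have "?h x = (\<Sum>j<d. ?s (x $ j) (?e j))"
      proof
        fix a
        have "(\<Sum>j<d. x $ j * ?e j a) = (\<Sum>j<d. if j = a then x $ a else 0)"
          by (intro sum.cong) auto
        then show "?h x a = (\<Sum>j<d. ?s (x $ j) (?e j)) a"
          by (simp add: sum_fun_apply)
      qed
      then have "g (?h x) = (\<Sum>j<d. x $ j * g (?e j))"
        by (simp only: g.sum g.scale)
      moreover have "\<phi> \<bullet> x = (\<Sum>j<d. x $ j * g (?e j))"
        using X x by (auto simp: \<phi>_def scalar_prod_def atLeast0LessThan mult.commute intro!: sum.cong)
      ultimately show ?thesis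
        using gX[OF x] by simp
    qed
    then have "\<phi> $ i = 0"
      by (intro sep) (simp_all add: \<phi>_def)
    then show False
      using g(2) i by (simp add: \<phi>_def)
  qed
  then have "\<exists>t r. ?e i = (\<Sum>a\<in>t. ?s (r a) a) \<and> finite t \<and> t \<subseteq> ?h ` X"
    unfolding vs.vs1.span_explicit by (rule CollectD)
  then obtain t r where t: "?e i = (\<Sum>a\<in>t. ?s (r a) a)" "finite t" "t \<subseteq> ?h ` X"
    by (elim exE conjE)
  obtain Y where Y: "Y \<subseteq> X" "t = ?h ` Y" "inj_on ?h Y"
    using t(3) unfolding subset_image_inj by blast
  show thesis
  proof
    show "finite Y"
      by (rule finite_imageD[OF t(2)[unfolded Y(2)] Y(3)])
    show "Y \<subseteq> X" by fact
    fix a assume a: "a < d"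
    have "?e i a = (\<Sum>b\<in>t. r b * b a)"
      using fun_cong[OF t(1), of a] by (simp add: sum_fun_apply)
    also have "\<dots> = (\<Sum>y\<in>Y. r (?h y) * y $ a)"
      unfolding Y(2) using a by (subst sum.reindex[OF Y(3)]) simp
    finally show "(\<Sum>y\<in>Y. r (?h y) * y $ a) = (if a = i then 1 else 0)" ..
  qed
qed

section \<open>The highest term of the character\<close>

text \<open>Constant term \<open>c\<close>, all other exponents strictly below 0 in the dominance order. This is
  \<open>leading n 0\<close> with an arbitrary constant; constants other than 1 are needed for
  closure under sums and products.\<close>

definition near_const :: "nat \<Rightarrow> complex \<Rightarrow> laurent \<Rightarrow> bool" where
  "near_const n c p \<longleftrightarrow> (\<forall>\<kappa>\<in>supp (p - Poly_Mapping.single 0 c). strictly_lower n 0 \<kappa>)"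

lemma near_const_single: "near_const n c (Poly_Mapping.single 0 c)"
  unfolding near_const_def by (simp only: diff_self keys_zero ball_empty)

lemma near_const_coef: "near_const n c p \<Longrightarrow> coef p 0 = c"
proof -
  assume "near_const n c p"
  then have "0 \<notin> supp (p - Poly_Mapping.single 0 c)"
    unfolding near_const_def using strictly_lower_irrefl by blast
  then show ?thesis
    by (simp add: in_keys_iff lookup_minus)
qed

lemma near_const_bounded: "near_const n c p \<Longrightarrow> \<kappa> \<in> supp p \<Longrightarrow> bounded_exp n \<kappa>"
proof -
  assume p: "near_const n c p" and \<kappa>: "\<kappa> \<in> supp p"
  show ?thesis
  proof (cases "\<kappa> = 0")
    case True
    then show ?thesis by (simp add: bounded_exp_def)
  next
    case False
    then have "\<kappa> \<in> supp (p - Poly_Mapping.single 0 c)"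
      using \<kappa> by (simp add: in_keys_iff lookup_minus lookup_single)
    then show ?thesis
      using p unfolding near_const_def strictly_lower_def lower_def by blast
  qed
qed

lemma near_const_add:
  assumes "near_const n c p" "near_const n c' q"
  shows "near_const n (c + c') (p + q)"
  unfolding near_const_def
proof
  let ?p = "p - Poly_Mapping.single 0 c" and ?q = "q - Poly_Mapping.single 0 c'"
  have e: "p + q - Poly_Mapping.single 0 (c + c') = ?p + ?q"
    by (rule poly_mapping_eqI) (simp add: single_add lookup_add lookup_minus)
  fix \<kappa> assume "\<kappa> \<in> supp (p + q - Poly_Mapping.single 0 (c + c'))"
  then have "\<kappa> \<in> supp ?p \<or> \<kappa> \<in> supp ?q"
    unfolding e using keys_add[of ?p ?q] by blast
  then show "strictly_lower n 0 \<kappa>"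
    using assms unfolding near_const_def by blast
qed

lemma near_const_lscale:
  assumes "near_const n c p"
  shows "near_const n (a * c) (lscale a p)"
proof -
  have "supp (lscale a p - Poly_Mapping.single 0 (a * c)) \<subseteq> supp (p - Poly_Mapping.single 0 c)"
    by (auto simp: in_keys_iff lookup_minus coef_lscale lookup_single when_def)
  then show ?thesis
    using assms unfolding near_const_def by blast
qed

lemma near_const_zero: "near_const n 0 0"
  using near_const_single[of n 0] by simp

lemma near_const_sum:
  "finite X \<Longrightarrow> (\<And>x. x \<in> X \<Longrightarrow> near_const n (c x) (p x)) \<Longrightarrow> near_const n (\<Sum>x\<in>X. c x) (\<Sum>x\<in>X. p x)"
proof (induction X rule: finite_induct)
  case empty
  show ?case
    unfolding sum.empty by (rule near_const_zero)
next
  case (insert x X)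
  show ?case
    unfolding sum.insert[OF insert.hyps] by (rule near_const_add) (use insert in auto)
qed

lemma near_const_mult:
  assumes p: "near_const n c p" and q: "near_const n c' q"
  shows "near_const n (c * c') (p * q)"
proof -
  let ?p = "p - Poly_Mapping.single 0 c" and ?q = "q - Poly_Mapping.single 0 c'"
  have e: "p * q - Poly_Mapping.single 0 (c * c') = ?p * ?q + (lscale c ?q + lscale c' ?p)"
    unfolding lscale_def
    by (simp add: left_diff_distrib right_diff_distrib mult_single mult.commute)
  show ?thesis
    unfolding near_const_def e
  proof
    fix \<kappa> assume "\<kappa> \<in> supp (?p * ?q + (lscale c ?q + lscale c' ?p))"
    then consider "\<kappa> \<in> supp (?p * ?q)" | "\<kappa> \<in> supp (lscale c ?q)" | "\<kappa> \<in> supp (lscale c' ?p)"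
      using keys_add[of "?p * ?q" "lscale c ?q + lscale c' ?p"] keys_add[of "lscale c ?q" "lscale c' ?p"]
      by blast
    then show "strictly_lower n 0 \<kappa>"
    proof cases
      case 1
      then obtain a b where "a \<in> supp ?p" "b \<in> supp ?q" and \<kappa>: "\<kappa> = a + b"
        using keys_mult[of ?p ?q] by blast
      then have "strictly_lower n 0 a" "lower n 0 b"
        using p q unfolding near_const_def strictly_lower_def by blast+
      then have "strictly_lower n (0 + 0) (a + b)"
        by (rule strictly_lower_add)
      then show ?thesis
        unfolding \<kappa> by simp
    next
      case 2
      then have "\<kappa> \<in> supp ?q"
        by (simp add: in_keys_iff coef_lscale)
      then show ?thesis
        using q unfolding near_const_def by blast
    next
      case 3
      then have "\<kappa> \<in> supp ?p"
        by (simp add: in_keys_iff coef_lscale)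
      then show ?thesis
        using p unfolding near_const_def by blast
    qed
  qed
qed

definition torus_conj :: "nat \<Rightarrow> (nat \<Rightarrow> complex) \<Rightarrow> complex mat \<Rightarrow> complex mat" where
  "torus_conj n t u = mat n n (\<lambda>(i, j). t i * u $$ (i, j) * inverse (t j))"

lemma torus_conj_lower_unitriangular:
  "t \<in> torus n \<Longrightarrow> lower_unitriangular n u \<Longrightarrow> lower_unitriangular n (torus_conj n t u)"
  by (auto simp: lower_unitriangular_def torus_conj_def torus_def)

text \<open>Conjugation by the torus multiplies the entry \<open>(i, j)\<close> with \<open>i > j\<close> by \<open>t\<^sub>i / t\<^sub>j\<close>, the
  character of a negative root, and the determinant stays 1.\<close>

lemma regular_fun_torus_conj:
  assumes "f \<in> regular_funs n" and u: "lower_unitriangular n u"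
  shows "\<exists>p. near_const n (f (1\<^sub>m n)) p \<and> (\<forall>t\<in>torus n. f (torus_conj n t u) = leval n p t)"
  using assms(1)
proof induction
  case (const c)
  show ?case
    by (intro exI[of _ "Poly_Mapping.single 0 c"] conjI near_const_single) (simp add: mono_at_def)
next
  case (entry i j)
  consider "i = j" | "i < j" | "j < i" by linarith
  then show ?case
  proof cases
    case 1
    have "torus_conj n t u $$ (i, j) = leval n (Poly_Mapping.single 0 1) t" if "t \<in> torus n" for t
      using that entry u 1 by (simp add: torus_conj_def lower_unitriangular_def torus_def)
    then show ?thesis
      using entry 1 near_const_single[of n 1] by (intro exI[of _ "Poly_Mapping.single 0 1"]) simp
  next
    case 2
    have "torus_conj n t u $$ (i, j) = leval n 0 t" for t
      using entry u 2 by (simp add: torus_conj_def lower_unitriangular_def)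
    then show ?thesis
      using entry 2 near_const_zero[of n] by (intro exI[of _ 0]) simp
  next
    case 3
    let ?\<nu> = "unit_exp i + (- unit_exp j)"
    have "partial_sum k (- unit_exp j) = - partial_sum k (unit_exp j)" for k
      by (simp add: partial_sum_def sum_negf)
    then have ps: "partial_sum k ?\<nu> = (if i < k then 1 else 0) - (if j < k then 1 else 0)" for k
      by (simp only: partial_sum_add partial_sum_unit_exp diff_conv_add_uminus)
    have "strictly_lower n 0 ?\<nu>"
      unfolding strictly_lower_def lower_def
    proof (intro conjI allI impI exI)
      show "bounded_exp n ?\<nu>"
        using entry by (auto simp: bounded_exp_def unit_exp_def)
      show "partial_sum k ?\<nu> \<le> partial_sum k 0" for k
        using 3 unfolding ps by (simp add: partial_sum_def)
      show "partial_sum n ?\<nu> = partial_sum n 0"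
        using entry unfolding ps by (simp add: partial_sum_def)
      show "i \<le> n" "partial_sum i ?\<nu> < partial_sum i 0"
        using entry 3 unfolding ps by (simp_all add: partial_sum_def)
    qed
    then have nc: "near_const n 0 (Poly_Mapping.single ?\<nu> (u $$ (i, j)))"
      unfolding near_const_def by simp
    have inv: "mono_at n (- unit_exp j) t = inverse (t j)" if "t \<in> torus n" for t
    proof -
      have "mono_at n (- unit_exp j) t * mono_at n (unit_exp j) t = 1"
        unfolding mono_at_add[OF that, symmetric] by (simp add: mono_at_def)
      moreover have "t j \<noteq> 0"
        using that entry by (simp add: torus_def)
      ultimately show ?thesis
        using entry by (simp add: mono_at_unit_exp field_simps)
    qed
    have "torus_conj n t u $$ (i, j) = leval n (Poly_Mapping.single ?\<nu> (u $$ (i, j))) t" if "t \<in> torus n" for t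
      unfolding leval_single mono_at_add[OF that] inv[OF that] mono_at_unit_exp[OF entry(1)]
      using entry by (simp add: torus_conj_def)
    then show ?thesis
      using entry 3 nc by (intro exI[of _ "Poly_Mapping.single ?\<nu> (u $$ (i, j))"]) simp
  qed
next
  case inverse_det
  have "det (torus_conj n t u) = 1" if "t \<in> torus n" for t
    using det_lower_unitriangular[OF torus_conj_lower_unitriangular[OF that u]] .
  then show ?case
    using near_const_single[of n 1] by (intro exI[of _ "Poly_Mapping.single 0 1"]) simp
next
  case (add f h)
  then obtain p q where p: "near_const n (f (1\<^sub>m n)) p" "\<forall>t\<in>torus n. f (torus_conj n t u) = leval n p t"
    and q: "near_const n (h (1\<^sub>m n)) q" "\<forall>t\<in>torus n. h (torus_conj n t u) = leval n q t"
    by blast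
  then show ?case
    using near_const_add[OF p(1) q(1)] by (intro exI[of _ "p + q"]) simp
next
  case (mult f h)
  then obtain p q where p: "near_const n (f (1\<^sub>m n)) p" "\<forall>t\<in>torus n. f (torus_conj n t u) = leval n p t"
    and q: "near_const n (h (1\<^sub>m n)) q" "\<forall>t\<in>torus n. h (torus_conj n t u) = leval n q t"
    by blast
  then show ?case
    using near_const_mult[OF p(1) q(1)] by (intro exI[of _ "p * q"]) simp
qed

context highest_weight_GL_rep
begin

lemma mult_v_index: "A \<in> carrier_mat d d \<Longrightarrow> w \<in> carrier_vec d \<Longrightarrow> a < d \<Longrightarrow> (A *\<^sub>v w) $ a = (\<Sum>b<d. A $$ (a, b) * w $ b)"
  by (auto simp: scalar_prod_def atLeast0LessThan intro!: sum.cong)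

text \<open>The matrix coefficient \<open>\<phi> (g v)\<close> vanishes on all products \<open>LU\<close>, as \<open>v\<close> is an eigenvector of
  \<open>U\<close>. The line from the identity to \<open>g\<close> consists of such products apart from finitely many
  points, so continuity at \<open>g\<close> gives the claim.\<close>

lemma big_cell_density:
  assumes \<phi>: "\<phi> \<in> carrier_vec d" and kill: "\<And>u. lower_unitriangular n u \<Longrightarrow> \<phi> \<bullet> (P u *\<^sub>v v) = 0"
    and g: "g \<in> carrier (GL n)"
  shows "\<phi> \<bullet> (P g *\<^sub>v v) = 0"
proof -
  have gc: "g \<in> carrier_mat n n" and dg: "det g \<noteq> 0"
    using g by (simp_all add: in_GL_iff)
  define X where "X = g - 1\<^sub>m n"
  have l1: "line n X 1 = g"
    using gc by (intro eq_matI) (auto simp: X_def line_def)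
  have "\<exists>f. \<forall>a<d. \<forall>b<d. f a b \<in> regular_funs n \<and> (\<forall>g\<in>carrier (GL n). P g $$ (a, b) = f a b g)"
    using matrix_coefficient by metis
  then obtain f where f: "\<And>a b. a < d \<Longrightarrow> b < d \<Longrightarrow> f a b \<in> regular_funs n"
    "\<And>a b g. a < d \<Longrightarrow> b < d \<Longrightarrow> g \<in> carrier (GL n) \<Longrightarrow> P g $$ (a, b) = f a b g"
    by metis
  define F where "F s = (\<Sum>a<d. \<phi> $ a * (\<Sum>b<d. f a b (line n X s) * v $ b))" for s
  have F: "\<phi> \<bullet> (P (line n X s) *\<^sub>v v) = F s" if "line n X s \<in> carrier (GL n)" for s
  proof -
    have "\<phi> \<bullet> (P (line n X s) *\<^sub>v v) = (\<Sum>a<d. \<phi> $ a * (P (line n X s) *\<^sub>v v) $ a)"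
      using P_carrier[OF that] by (auto simp: scalar_prod_def atLeast0LessThan)
    also have "\<dots> = F s"
      unfolding F_def by (intro sum.cong refl) (simp add: mult_v_index[OF P_carrier[OF that] v_carrier] f(2) that del: index_mult_mat_vec)
    finally show ?thesis .
  qed
  have "isCont F 1"
    unfolding F_def
    by (intro continuous_sum continuous_mult continuous_const regular_fun_continuous f) (simp_all add: l1 dg)
  then have lim: "(F \<longlongrightarrow> F 1) (at 1)"
    by (simp add: isCont_def)
  \<comment> \<open>Near \<open>s = 1\<close>, apart from \<open>s = 1\<close> itself, all leading minors are nonzero.\<close>
  have "\<forall>\<^sub>F s in at 1. \<forall>k\<in>{..n}. \<forall>c\<in>{s. det (leading_block k (line n X s)) = 0}. s \<noteq> c"
    by (intro eventually_ball_finite ballI finite_bad_minors eventually_neq_at_within) auto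
  then have "\<forall>\<^sub>F s in at 1. F s = 0"
  proof eventually_elim
    case (elim s)
    let ?g = "line n X s"
    have minors: "det (leading_block k ?g) \<noteq> 0" if "k \<le> n" for k
      using elim that by blast
    have "leading_block n ?g = ?g"
      by (intro eq_matI) (auto simp: leading_block_def line_def)
    then have dg: "det ?g \<noteq> 0"
      using minors[of n] by simp
    then have gG: "?g \<in> carrier (GL n)"
      by (simp add: in_GL_iff)
    obtain L U where L: "lower_unitriangular n L" and U: "U \<in> carrier_mat n n" "upper_triangular U" and LU: "?g = L * U"
      using LU_decomposition[OF line_carrier minors] by blast
    have LG: "L \<in> carrier (GL n)"
      by (rule lower_unitriangular_GL[OF L])
    have "det ?g = det L * det U"
      unfolding LU using LG U by (intro det_mult) (auto simp: in_GL_iff)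
    then have UG: "U \<in> carrier (GL n)"
      using U dg by (auto simp: in_GL_iff)
    obtain c where c: "P U *\<^sub>v v = c \<cdot>\<^sub>v v"
      using v_weight[OF UG U(2)] by blast
    have "P ?g *\<^sub>v v = P L *\<^sub>v (P U *\<^sub>v v)"
      unfolding LU P_mult[OF LG UG] by (rule assoc_mult_mat_vec[OF P_carrier[OF LG] P_carrier[OF UG] v_carrier])
    also have "\<dots> = c \<cdot>\<^sub>v (P L *\<^sub>v v)"
      unfolding c by (rule mult_mat_vec[OF P_carrier[OF LG] v_carrier])
    finally have "\<phi> \<bullet> (P ?g *\<^sub>v v) = c * (\<phi> \<bullet> (P L *\<^sub>v v))"
      using \<phi> P_carrier[OF LG] by simp
    then show ?case
      using kill[OF L] F[OF gG] by simp
  qed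
  then have "(F \<longlongrightarrow> 0) (at 1)"
    by (rule tendsto_eventually)
  with lim have "F 1 = 0"
    using tendsto_unique[OF _ lim] by force
  then show ?thesis
    using F[of 1] g by (simp add: l1)
qed

text \<open>The linear forms that vanish on the whole group orbit of \<open>v\<close> form an invariant space, so their
  common kernel is a subrepresentation. It contains \<open>v\<close>, hence it is everything.\<close>

lemma lower_orbit_separates:
  assumes \<phi>: "\<phi> \<in> carrier_vec d" and kill: "\<And>u. lower_unitriangular n u \<Longrightarrow> \<phi> \<bullet> (P u *\<^sub>v v) = 0"
    and i: "i < d"
  shows "\<phi> $ i = 0"
proof -
  define K where "K = {\<psi> \<in> carrier_vec d. \<forall>g\<in>carrier (GL n). \<psi> \<bullet> (P g *\<^sub>v v) = 0}"
  define W where "W = {w \<in> carrier_vec d. \<forall>\<psi>\<in>K. \<psi> \<bullet> w = 0}"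
  have "W = carrier_vec d"
  proof (rule irreducible_imp_full[OF irr])
    show "W \<subseteq> carrier_vec d" unfolding W_def by blast
    show "0\<^sub>v d \<in> W" unfolding W_def K_def by simp
    show "x + y \<in> W" if "x \<in> W" "y \<in> W" for x y
      using that unfolding W_def K_def by (simp add: scalar_prod_add_distrib[of _ d])
    show "c \<cdot>\<^sub>v x \<in> W" if "x \<in> W" for c x
      using that unfolding W_def K_def by (simp add: scalar_prod_smult_distrib[of _ d])
    show "P g *\<^sub>v w \<in> W" if g: "g \<in> carrier (GL n)" and w: "w \<in> W" for g w
    proof -
      note c = P_carrier[OF g]
      have wc: "w \<in> carrier_vec d"
        using w unfolding W_def by blast
      have "\<psi> \<bullet> (P g *\<^sub>v w) = 0" if \<psi>: "\<psi> \<in> K" for \<psi>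
      proof -
        have \<psi>c: "\<psi> \<in> carrier_vec d"
          using \<psi> unfolding K_def by blast
        have t: "(transpose_mat (P g) *\<^sub>v \<psi>) \<bullet> x = \<psi> \<bullet> (P g *\<^sub>v x)" if "x \<in> carrier_vec d" for x
          by (rule transpose_vec_mult_scalar[OF c that \<psi>c])
        have "transpose_mat (P g) *\<^sub>v \<psi> \<in> K"
          unfolding K_def mem_Collect_eq
        proof (intro conjI ballI)
          show "transpose_mat (P g) *\<^sub>v \<psi> \<in> carrier_vec d"
            using c \<psi>c by auto
          fix h assume h: "h \<in> carrier (GL n)"
          have "P (g * h) *\<^sub>v v = P g *\<^sub>v (P h *\<^sub>v v)"
            unfolding P_mult[OF g h] by (rule assoc_mult_mat_vec[OF c P_carrier[OF h] v_carrier])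
          then show "(transpose_mat (P g) *\<^sub>v \<psi>) \<bullet> (P h *\<^sub>v v) = 0"
            using \<psi> mult_in_GL[OF g h] t[OF mult_mat_vec_carrier[OF P_carrier[OF h] v_carrier]]
            unfolding K_def by auto
        qed
        then show ?thesis
          using w t[OF wc] unfolding W_def by auto
      qed
      then show ?thesis
        unfolding W_def using mult_mat_vec_carrier[OF c wc] by blast
    qed
    show "v \<in> W"
      unfolding W_def mem_Collect_eq
    proof (intro conjI ballI v_carrier)
      fix \<psi> assume "\<psi> \<in> K"
      then have "\<psi> \<bullet> (P (1\<^sub>m n) *\<^sub>v v) = 0"
        using one_in_GL unfolding K_def by blast
      then show "\<psi> \<bullet> v = 0"
        using v_carrier by (simp add: P_one)
    qed
  qed (rule v_nonzero)
  then have "unit_vec d i \<in> W"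
    by simp
  moreover have "\<phi> \<in> K"
    unfolding K_def using \<phi> big_cell_density[OF \<phi> kill] by blast
  ultimately have "\<phi> \<bullet> unit_vec d i = 0"
    unfolding W_def by blast
  then show ?thesis
    using \<phi> i by simp
qed

end

lemma upper_triangular_diag: "upper_triangular (mat_diag n t)"
  by (auto simp: upper_triangular_def mat_diag_def)

lemma torus_conj_mult:
  assumes t: "t \<in> torus n" and u: "u \<in> carrier_mat n n"
  shows "mat_diag n t * u = torus_conj n t u * mat_diag n t"
  using t u
  by (subst mat_diag_mult_left[OF u], subst mat_diag_mult_right[of _ n n])
     (auto simp: torus_conj_def torus_def intro!: eq_matI)

lemma laurent_eqI:
  assumes "\<And>t. t \<in> regular n \<Longrightarrow> leval n p t = leval n q t"
    and "\<And>\<nu>. \<nu> \<in> supp p \<Longrightarrow> bounded_exp n \<nu>" "\<And>\<nu>. \<nu> \<in> supp q \<Longrightarrow> bounded_exp n \<nu>"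
  shows "p = q"
proof -
  have "p - q = 0"
  proof (rule laurent_eq_0_if_vanishing)
    show "leval n (p - q) t = 0" if "t \<in> regular n" for t
      using assms(1)[OF that] by simp
    fix \<nu> assume "\<nu> \<in> supp (p - q)"
    then have "\<nu> \<in> supp p \<or> \<nu> \<in> supp q"
      by (auto simp: in_keys_iff lookup_minus)
    then show "bounded_exp n \<nu>"
      using assms(2,3) by blast
  qed
  then show ?thesis
    by simp
qed

lemma leading_single: "bounded_exp n \<nu> \<Longrightarrow> leading n \<nu> (Poly_Mapping.single \<nu> 1)"
  unfolding leading_def by (simp only: diff_self keys_zero ball_empty simp_thms)

lemma leading_0_iff: "leading n 0 p \<longleftrightarrow> near_const n 1 p"
  unfolding leading_def near_const_def by (simp add: bounded_exp_def)

text \<open>Used for \<open>x = l - \<nu>\<close> and \<open>c = l + \<nu>\<close>, where the left side is \<open>|l|\<^sup>2 - |\<nu>|\<^sup>2\<close>.\<close>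

lemma Abel_summation:
  fixes x c :: "nat \<Rightarrow> int"
  shows "(\<Sum>i<Suc m. x i * c i) = partial_sum (Suc m) x * c m + (\<Sum>i<m. partial_sum (Suc i) x * (c i - c (Suc i)))"
proof (induction m)
  case (Suc m)
  have "(\<Sum>i<Suc (Suc m). x i * c i) = (\<Sum>i<Suc m. x i * c i) + x (Suc m) * c (Suc m)"
    by simp
  also have "\<dots> = partial_sum (Suc m) x * c m + x (Suc m) * c (Suc m) + (\<Sum>i<m. partial_sum (Suc i) x * (c i - c (Suc i)))"
    unfolding Suc.IH by simp
  also have "\<dots> = partial_sum (Suc (Suc m)) x * c (Suc m) + (\<Sum>i<Suc m. partial_sum (Suc i) x * (c i - c (Suc i)))"
    by (simp add: partial_sum_def algebra_simps)
  finally show ?case .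
qed (simp add: partial_sum_def)

text \<open>By Abel summation \<open>|l|\<^sup>2 - |\<nu>|\<^sup>2\<close> is a combination of the nonnegative partial sums of \<open>l - \<nu>\<close>
  with the positive coefficients \<open>c\<^sub>i - c\<^sub>i\<^sub>+\<^sub>1\<close> of \<open>c = l + \<nu>\<close>; so all these partial sums vanish.\<close>

lemma eq_if_lower_and_norm_eq:
  assumes low: "lower n l \<nu>" and bl: "bounded_exp n l" and dl: "strictly_decreasing n l" and d\<nu>: "strictly_decreasing n \<nu>"
    and norm: "norm_sq n \<nu> = norm_sq n l"
  shows "\<nu> = l"
proof (cases n)
  case 0
  then show ?thesis
    using low bl by (auto simp: lower_def bounded_exp_def)
next
  case (Suc m)
  define x where "x i = l i - \<nu> i" for i
  define c where "c i = l i + \<nu> i" for i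
  have ps: "partial_sum k x = partial_sum k l - partial_sum k \<nu>" for k
    by (simp add: partial_sum_def x_def sum_subtractf)
  have nonneg: "0 \<le> partial_sum k x" if "k \<le> n" for k
    using low that by (simp add: ps lower_def)
  have total: "partial_sum n x = 0"
    using low by (simp add: ps lower_def)
  have c: "0 < c i - c (Suc i)" if "i < m" for i
  proof -
    have "l (Suc i) < l i" "\<nu> (Suc i) < \<nu> i"
      using that dl d\<nu> Suc by (simp_all add: strictly_decreasing_def)
    then show ?thesis
      by (simp add: c_def)
  qed
  have "(\<Sum>i<n. x i * c i) = norm_sq n l - norm_sq n \<nu>"
    unfolding norm_sq_def sum_subtractf[symmetric] by (intro sum.cong refl) (simp add: x_def c_def algebra_simps)
  then have "(\<Sum>i<m. partial_sum (Suc i) x * (c i - c (Suc i))) = 0"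
    using Abel_summation[of x c m] total norm Suc by simp
  moreover have "0 \<le> partial_sum (Suc i) x * (c i - c (Suc i))" if "i \<in> {..<m}" for i
    using that nonneg[of "Suc i"] c[of i] Suc by simp
  ultimately have "partial_sum (Suc i) x * (c i - c (Suc i)) = 0" if "i < m" for i
    using sum_nonneg_eq_0_iff[of "{..<m}" "\<lambda>i. partial_sum (Suc i) x * (c i - c (Suc i))"] that by auto
  then have z: "partial_sum (Suc i) x = 0" if "i < n" for i
  proof (cases "i = m")
    case False
    then have "i < m"
      using that Suc by simp
    then show ?thesis
      using c[of i] \<open>\<And>i. i < m \<Longrightarrow> partial_sum (Suc i) x * (c i - c (Suc i)) = 0\<close>[of i] by simp
  qed (use total Suc in simp)
  have "x i = 0" if "i < n" for i
  proof (cases i)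
    case 0
    then show ?thesis
      using z[of 0] that by (simp add: partial_sum_def)
  next
    case (Suc j)
    then show ?thesis
      using z[of i] z[of j] that by (simp add: partial_sum_def)
  qed
  then have "\<nu> i = l i" for i
    using low bl by (cases "i < n") (auto simp: x_def lower_def bounded_exp_def)
  then show ?thesis by blast
qed

context highest_weight_GL_rep
begin

lemma bounded_wt: "bounded_exp n wt"
  by (simp add: bounded_exp_def wt_def)

lemma T_v:
  assumes t: "t \<in> torus n"
  shows "P (T t) *\<^sub>v v = mono_at n wt t \<cdot>\<^sub>v v"
proof -
  have "(\<Prod>i<n. (T t $$ (i, i)) powi (lam ! i)) = mono_at n wt t"
    unfolding mono_at_def by (intro prod.cong) (auto simp: T_def mat_diag_def wt_def)
  then show ?thesis
    using v_weight[OF T_GL[OF t]] by (simp add: T_def upper_triangular_diag)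
qed

text \<open>Because \<open>T u v = (T u T\<^sup>-\<^sup>1) T v\<close> and \<open>T v = t\<^sup>\<lambda> v\<close>.\<close>

lemma lower_orbit_coordinate:
  assumes u: "lower_unitriangular n u" and a: "a < d"
  shows "\<exists>q. near_const n (v $ a) q \<and>
    (\<forall>t\<in>torus n. (P (T t) *\<^sub>v (P u *\<^sub>v v)) $ a = mono_at n wt t * leval n q t)"
proof -
  have "\<exists>q. near_const n (1\<^sub>m d $$ (a, b)) q \<and> (\<forall>t\<in>torus n. P (torus_conj n t u) $$ (a, b) = leval n q t)"
    if b: "b < d" for b
  proof -
    obtain f where f: "f \<in> regular_funs n" "\<And>g. g \<in> carrier (GL n) \<Longrightarrow> P g $$ (a, b) = f g"
      using matrix_coefficient[OF a b] by blast
    have "f (1\<^sub>m n) = 1\<^sub>m d $$ (a, b)"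
      using f(2)[OF one_in_GL] by (simp add: P_one)
    then show ?thesis
      using regular_fun_torus_conj[OF f(1) u] f(2) lower_unitriangular_GL[OF torus_conj_lower_unitriangular[OF _ u]]
      by (metis (no_types, lifting))
  qed
  then obtain q where q: "\<And>b. b < d \<Longrightarrow> near_const n (1\<^sub>m d $$ (a, b)) (q b)"
    "\<And>b t. b < d \<Longrightarrow> t \<in> torus n \<Longrightarrow> P (torus_conj n t u) $$ (a, b) = leval n (q b) t"
    by metis
  have uG: "u \<in> carrier (GL n)" and uc: "u \<in> carrier_mat n n"
    using lower_unitriangular_GL[OF u] by (simp_all add: in_GL_iff)
  let ?q = "\<Sum>b<d. lscale (v $ b) (q b)"
  have "near_const n (\<Sum>b<d. v $ b * 1\<^sub>m d $$ (a, b)) ?q"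
    by (intro near_const_sum near_const_lscale q(1)) auto
  moreover have "(\<Sum>b<d. v $ b * 1\<^sub>m d $$ (a, b)) = (\<Sum>b<d. if b = a then v $ a else 0)"
    using a by (intro sum.cong) auto
  ultimately have "near_const n (v $ a) ?q"
    using a by simp
  moreover have "(P (T t) *\<^sub>v (P u *\<^sub>v v)) $ a = mono_at n wt t * leval n ?q t" if t: "t \<in> torus n" for t
  proof -
    let ?u = "torus_conj n t u"
    have u'G: "?u \<in> carrier (GL n)"
      by (rule lower_unitriangular_GL[OF torus_conj_lower_unitriangular[OF t u]])
    note c = P_carrier[OF uG] P_carrier[OF u'G] P_carrier[OF T_GL[OF t]]
    have "P (T t) *\<^sub>v (P u *\<^sub>v v) = (P (T t) * P u) *\<^sub>v v"
      using assoc_mult_mat_vec[OF c(3) c(1) v_carrier] by simp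
    also have "P (T t) * P u = P ?u * P (T t)"
      using P_mult[OF T_GL[OF t] uG] P_mult[OF u'G T_GL[OF t]] torus_conj_mult[OF t uc] by (simp add: T_def)
    also have "(P ?u * P (T t)) *\<^sub>v v = P ?u *\<^sub>v (mono_at n wt t \<cdot>\<^sub>v v)"
      using assoc_mult_mat_vec[OF c(2) c(3) v_carrier] by (simp add: T_v[OF t])
    also have "\<dots> = mono_at n wt t \<cdot>\<^sub>v (P ?u *\<^sub>v v)"
      by (rule mult_mat_vec[OF c(2) v_carrier])
    finally have "(P (T t) *\<^sub>v (P u *\<^sub>v v)) $ a = mono_at n wt t * (P ?u *\<^sub>v v) $ a"
      using a c(2) by simp
    also have "(P ?u *\<^sub>v v) $ a = leval n ?q t"
      unfolding mult_v_index[OF c(2) v_carrier a] leval_sum leval_lscale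
      by (intro sum.cong refl) (simp add: q(2)[OF _ t] mult.commute)
    finally show ?thesis .
  qed
  ultimately show ?thesis by blast
qed

text \<open>Write the \<open>i\<close>-th basis vector as a combination of vectors \<open>u v\<close> with \<open>u\<close> lower unitriangular;
  \<open>R\<close> is the sum of its coefficients.\<close>

lemma torus_entry:
  assumes i: "i < d"
  shows "\<exists>R. \<forall>a<d. \<exists>Q. near_const n (R * v $ a) Q \<and>
    (\<forall>t\<in>torus n. P (T t) $$ (a, i) = mono_at n wt t * leval n Q t)"
proof -
  let ?X = "{P u *\<^sub>v v | u. lower_unitriangular n u}"
  have X: "?X \<subseteq> carrier_vec d"
    using mult_mat_vec_carrier[OF P_carrier[OF lower_unitriangular_GL] v_carrier] by blast
  have sep: "\<phi> $ i = 0" if "\<phi> \<in> carrier_vec d" "\<And>x. x \<in> ?X \<Longrightarrow> \<phi> \<bullet> x = 0" for \<phi>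
    using lower_orbit_separates[OF that(1) _ i] that(2) by blast
  obtain Y :: "complex vec set" and r
    where Y: "finite Y" "Y \<subseteq> ?X" "\<And>b. b < d \<Longrightarrow> (\<Sum>y\<in>Y. r y * y $ b) = (if b = i then 1 else 0)"
    by (rule unit_vec_in_span[OF X i sep]) (assumption | blast)+
  have ex: "\<exists>Q. near_const n ((\<Sum>y\<in>Y. r y) * v $ a) Q \<and>
    (\<forall>t\<in>torus n. P (T t) $$ (a, i) = mono_at n wt t * leval n Q t)" if a: "a < d" for a
  proof -
    have "\<exists>q. near_const n (v $ a) q \<and> (\<forall>t\<in>torus n. (P (T t) *\<^sub>v y) $ a = mono_at n wt t * leval n q t)"
      if "y \<in> Y" for y
    proof -
      obtain u where "lower_unitriangular n u" "y = P u *\<^sub>v v"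
        using Y(2) \<open>y \<in> Y\<close> by blast
      then show ?thesis
        using lower_orbit_coordinate[OF _ a] by blast
    qed
    then obtain q where q: "\<And>y. y \<in> Y \<Longrightarrow> near_const n (v $ a) (q y)"
      "\<And>y t. y \<in> Y \<Longrightarrow> t \<in> torus n \<Longrightarrow> (P (T t) *\<^sub>v y) $ a = mono_at n wt t * leval n (q y) t"
      by metis
    let ?Q = "\<Sum>y\<in>Y. lscale (r y) (q y)"
    have "near_const n (\<Sum>y\<in>Y. r y * v $ a) ?Q"
      by (intro near_const_sum near_const_lscale q(1) Y(1))
    then have "near_const n ((\<Sum>y\<in>Y. r y) * v $ a) ?Q"
      by (simp add: sum_distrib_right)
    moreover have "P (T t) $$ (a, i) = mono_at n wt t * leval n ?Q t" if t: "t \<in> torus n" for t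
    proof -
      note c = P_carrier[OF T_GL[OF t]]
      have "P (T t) $$ (a, i) = (\<Sum>b<d. if b = i then P (T t) $$ (a, i) else 0)"
        using i by simp
      also have "\<dots> = (\<Sum>b<d. P (T t) $$ (a, b) * (\<Sum>y\<in>Y. r y * y $ b))"
        by (intro sum.cong refl) (simp add: Y(3))
      also have "\<dots> = (\<Sum>y\<in>Y. r y * (\<Sum>b<d. P (T t) $$ (a, b) * y $ b))"
        unfolding sum_distrib_left by (subst sum.swap) (simp add: mult_ac)
      also have "\<dots> = (\<Sum>y\<in>Y. r y * (P (T t) *\<^sub>v y) $ a)"
        using Y(2) X by (intro sum.cong refl) (subst mult_v_index[OF c _ a], auto)
      also have "\<dots> = mono_at n wt t * leval n ?Q t"
        unfolding leval_sum leval_lscale sum_distrib_left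
        by (intro sum.cong refl) (simp add: q(2)[OF _ t])
      finally show ?thesis .
    qed
    ultimately show ?thesis by blast
  qed
  then show ?thesis by blast
qed

text \<open>The diagonal entries give \<open>t\<^sup>\<lambda>\<close> times a polynomial with constant term \<open>\<Sum>\<^sub>i R\<^sub>i v\<^sub>i\<close>. That this is 1
  follows from \<open>T v = t\<^sup>\<lambda> v\<close>: comparing the constant terms on both sides gives
  \<open>(\<Sum>\<^sub>i R\<^sub>i v\<^sub>i) v = v\<close>.\<close>

lemma character_leading:
  obtains p where "leading n wt p" "\<And>t. t \<in> torus n \<Longrightarrow> tr (P (T t)) = leval n p t"
proof -
  obtain R where "\<And>i. i < d \<Longrightarrow> \<forall>a<d. \<exists>Q. near_const n (R i * v $ a) Q \<and>
    (\<forall>t\<in>torus n. P (T t) $$ (a, i) = mono_at n wt t * leval n Q t)"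
    using torus_entry by metis
  then obtain Q where Q: "\<And>i a. i < d \<Longrightarrow> a < d \<Longrightarrow> near_const n (R i * v $ a) (Q i a)"
    "\<And>i a t. i < d \<Longrightarrow> a < d \<Longrightarrow> t \<in> torus n \<Longrightarrow> P (T t) $$ (a, i) = mono_at n wt t * leval n (Q i a) t"
    by metis
  obtain a where a: "a < d" "v $ a \<noteq> 0"
    using v_nonzero v_carrier by (metis carrier_vecD eq_vecI index_zero_vec)
  let ?S = "\<Sum>i<d. lscale (v $ i) (Q i a)"
  have nS: "near_const n (\<Sum>i<d. v $ i * (R i * v $ a)) ?S"
    by (intro near_const_sum near_const_lscale Q(1) a) auto
  \<comment> \<open>The coordinate \<open>a\<close> of \<open>T v = t\<^sup>\<lambda> v\<close>, divided by \<open>t\<^sup>\<lambda>\<close>.\<close>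
  have "?S = Poly_Mapping.single 0 (v $ a)"
  proof (rule laurent_eqI)
    fix t assume "t \<in> regular n"
    then have t: "t \<in> torus n"
      by (rule regular_torus)
    have "(P (T t) *\<^sub>v v) $ a = (\<Sum>i<d. P (T t) $$ (a, i) * v $ i)"
      by (rule mult_v_index[OF P_carrier[OF T_GL[OF t]] v_carrier a(1)])
    also have "\<dots> = mono_at n wt t * leval n ?S t"
      unfolding leval_sum leval_lscale sum_distrib_left
      by (intro sum.cong refl) (simp add: Q(2)[OF _ a(1) t])
    finally have "mono_at n wt t * v $ a = mono_at n wt t * leval n ?S t"
      using a v_carrier by (simp add: T_v[OF t])
    then have "leval n ?S t = v $ a"
      using mult_left_cancel[OF mono_at_nonzero[OF t]] by metis
    then show "leval n ?S t = leval n (Poly_Mapping.single 0 (v $ a)) t"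
      by (simp only: leval_single) (simp add: mono_at_def)
  next
    show "bounded_exp n \<nu>" if "\<nu> \<in> supp ?S" for \<nu>
      using near_const_bounded[OF nS that] .
    show "bounded_exp n \<nu>" if "\<nu> \<in> supp (Poly_Mapping.single 0 (v $ a))" for \<nu>
      using that a(2) by (simp add: bounded_exp_def)
  qed
  then have "(\<Sum>i<d. v $ i * (R i * v $ a)) = v $ a"
    using near_const_coef[OF nS] by simp
  moreover have "(\<Sum>i<d. R i * v $ i) * v $ a = (\<Sum>i<d. v $ i * (R i * v $ a))"
    unfolding sum_distrib_right by (intro sum.cong refl) simp
  ultimately have "(\<Sum>i<d. R i * v $ i) * v $ a = 1 * v $ a"
    by simp
  then have R: "(\<Sum>i<d. R i * v $ i) = 1"
    using a(2) by simp
  let ?q = "\<Sum>i<d. Q i i"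
  have "near_const n (\<Sum>i<d. R i * v $ i) ?q"
    by (intro near_const_sum Q(1)) auto
  then have q: "leading n 0 ?q"
    unfolding leading_0_iff R .
  show thesis
  proof
    have "leading n (wt + 0) (Poly_Mapping.single wt 1 * ?q)"
      by (rule leading_mult[OF leading_single[OF bounded_wt] q])
    then show "leading n wt (Poly_Mapping.single wt 1 * ?q)"
      by (simp only: add_0_right)
    fix t assume t: "t \<in> torus n"
    have "tr (P (T t)) = (\<Sum>i<d. mono_at n wt t * leval n (Q i i) t)"
      unfolding tr_def using P_carrier[OF T_GL[OF t]] by (auto simp: Q(2)[OF _ _ t] intro!: sum.cong)
    then show "tr (P (T t)) = leval n (Poly_Mapping.single wt 1 * ?q) t"
      by (simp only: leval_mult[OF t] leval_single leval_sum sum_distrib_left mult_1_left)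
  qed
qed

section \<open>The Weyl character formula\<close>

definition perm_mat :: "(nat \<Rightarrow> nat) \<Rightarrow> complex mat" where
  "perm_mat \<sigma> = mat n n (\<lambda>(i, j). if \<sigma> i = j then 1 else 0)"

lemma perm_mat_GL:
  assumes "\<sigma> permutes {..<n}"
  shows "perm_mat \<sigma> \<in> carrier (GL n)"
proof -
  have s: "\<sigma> permutes {0..<n}"
    using assms by (simp add: atLeast0LessThan)
  have "perm_mat \<sigma> = mat n n (\<lambda>(i, j). 1\<^sub>m n $$ (\<sigma> i, j))"
    using permutes_in_image[OF s] by (intro eq_matI) (auto simp: perm_mat_def)
  then have "det (perm_mat \<sigma>) = of_int (sign \<sigma>) * det (1\<^sub>m n)"
    using det_permute_rows[OF one_carrier_mat s] by simp
  then have "det (perm_mat \<sigma>) \<noteq> 0"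
    by (simp add: sign_def)
  then show ?thesis
    by (simp add: in_GL_iff perm_mat_def)
qed

text \<open>A permutation matrix conjugates \<open>diag(t)\<close> to \<open>diag(t \<circ> \<sigma>)\<close>, and the trace is a class function.\<close>

lemma character_permute:
  assumes \<sigma>: "\<sigma> permutes {..<n}" and t: "t \<in> torus n"
  shows "tr (P (T (t \<circ> \<sigma>))) = tr (P (T t))"
proof -
  let ?Q = "perm_mat \<sigma>"
  have QG: "?Q \<in> carrier (GL n)"
    by (rule perm_mat_GL[OF \<sigma>])
  obtain h where h: "h \<in> carrier (GL n)" "?Q * h = 1\<^sub>m n"
    using GL_inverse[OF QG] by blast
  have t': "t \<circ> \<sigma> \<in> torus n"
    using t permutes_in_image[OF \<sigma>] by (simp add: torus_def)
  note c = P_carrier[OF QG] P_carrier[OF h(1)] P_carrier[OF T_GL[OF t]] P_carrier[OF T_GL[OF t']]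
  have qc: "?Q \<in> carrier_mat n n"
    by (simp add: perm_mat_def)
  have "?Q * T t = T (t \<circ> \<sigma>) * ?Q"
    unfolding T_def mat_diag_mult_left[OF qc] mat_diag_mult_right[OF qc]
    by (intro eq_matI) (auto simp: perm_mat_def)
  then have "P ?Q * P (T t) = P (T (t \<circ> \<sigma>)) * P ?Q"
    using P_mult[OF QG T_GL[OF t]] P_mult[OF T_GL[OF t'] QG] by simp
  then have "P ?Q * P (T t) * P h = P (T (t \<circ> \<sigma>)) * (P ?Q * P h)"
    using assoc_mult_mat[OF c(4) c(1) c(2)] by simp
  also have "\<dots> = P (T (t \<circ> \<sigma>))"
    using P_inverse[OF QG h] right_mult_one_mat[OF c(4)] by simp
  finally have "tr (P (T (t \<circ> \<sigma>))) = tr (P ?Q * P (T t) * P h)"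
    by simp
  also have "\<dots> = tr (P h * (P ?Q * P (T t)))"
    by (rule tr_comm[OF mult_carrier_mat[OF c(1) c(3)] c(2)])
  also have "P h * (P ?Q * P (T t)) = (P h * P ?Q) * P (T t)"
    using assoc_mult_mat[OF c(2) c(1) c(3)] by simp
  also have "P h * P ?Q = 1\<^sub>m d"
    by (rule mat_mult_left_right_inverse[OF c(1) c(2) P_inverse[OF QG h]])
  finally show ?thesis
    using left_mult_one_mat[OF c(3)] by (simp add: comp_def)
qed

lemma eventually_torus_scale:
  assumes t: "t \<in> torus n"
  shows "\<forall>\<^sub>F s in nhds 0. t(i := t i * (1 + s)) \<in> torus n"
proof -
  have "((\<lambda>s. 1 + s) \<longlongrightarrow> (1 :: complex)) (nhds 0)"
    by (rule tendsto_eq_intros filterlim_ident | simp)+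
  then have "\<forall>\<^sub>F s in nhds 0. 1 + s \<noteq> (0 :: complex)"
    by (rule tendsto_imp_eventually_ne) simp
  then show ?thesis
    by (rule eventually_mono) (use t in \<open>auto simp: torus_def\<close>)
qed

lemma tr_E_diag:
  assumes p: "\<And>t. t \<in> torus n \<Longrightarrow> tr (P (T t) * A) = leval n p t"
    and A: "A \<in> carrier_mat d d" and i: "i < n" and t: "t \<in> torus n"
  shows "tr (P (T t) * (E i i * A)) = leval n (ldiff i p) t"
proof -
  note c = P_carrier[OF T_GL[OF t]]
  let ?l = "\<lambda>s. line n (unit_mat n i i) s"
  have "mderiv d (\<lambda>s. P (T t) * (P (?l s) * A)) (P (T t) * (E i i * A))"
    unfolding E_def by (intro mderiv_mult_left mderiv_mult_right mderiv_P c A)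
  then have "((\<lambda>s. tr (P (T t) * (P (?l s) * A))) has_field_derivative tr (P (T t) * (E i i * A))) (at 0)"
    by (rule mderiv_tr)
  then have "((\<lambda>s. leval n p (t(i := t i * (1 + s)))) has_field_derivative tr (P (T t) * (E i i * A))) (at 0)"
  proof (rule DERIV_eventually_eq)
    show "\<forall>\<^sub>F s in nhds 0. leval n p (t(i := t i * (1 + s))) = tr (P (T t) * (P (?l s) * A))"
      using eventually_line_GL[of n "unit_mat n i i"] eventually_torus_scale[OF t, of i]
    proof eventually_elim
      case (elim s)
      have "T t * ?l s = T (t(i := t i * (1 + s)))"
        unfolding T_def mat_diag_mult_left[OF line_carrier]
        by (intro eq_matI) (auto simp: line_def unit_mat_def mat_diag_def)
      then have "P (T (t(i := t i * (1 + s)))) * A = P (T t) * P (?l s) * A"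
        using P_mult[OF T_GL[OF t] elim(1)] by simp
      then show ?case
        using p[OF elim(2)] assoc_mult_mat[OF c P_carrier[OF elim(1)] A] by simp
    qed
  qed
  then show ?thesis
    using leval_ldiff[OF t i] by (rule DERIV_unique)
qed

text \<open>With \<open>x = tr (T E i j E j i)\<close>, moving \<open>T\<close> past \<open>E i j\<close> and rotating the trace gives
  \<open>x = (t\<^sub>i / t\<^sub>j) tr (T E j i E i j)\<close>, while the commutator relation gives
  \<open>tr (T E j i E i j) = x - y\<close> with \<open>y = tr (T E i i) - tr (T E j j)\<close>. Solve for \<open>x\<close>.\<close>

lemma tr_E_off_diag:
  assumes t: "t \<in> regular n" and ij: "i < n" "j < n" "i \<noteq> j"
  shows "tr (P (T t) * (E i j * E j i)) = t i / (t i - t j) * (tr (P (T t) * E i i) - tr (P (T t) * E j j))"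
proof -
  have tt: "t \<in> torus n"
    by (rule regular_torus[OF t])
  note c = P_carrier[OF T_GL[OF tt]]
  note mc = mult_carrier_mat[OF E_carrier E_carrier]
  let ?P = "P (T t)"
  let ?x = "tr (?P * (E i j * E j i))" and ?y = "tr (?P * E i i) - tr (?P * E j j)"
  have tj: "t j \<noteq> 0"
    using tt ij by (simp add: torus_def)
  have ne: "t i - t j \<noteq> 0"
    using t ij by (auto simp: regular_def inj_on_def)
  have "?P * (E i j * E j i) = (?P * E i j) * E j i"
    using assoc_mult_mat[OF c E_carrier E_carrier] by simp
  also have "\<dots> = (t i / t j) \<cdot>\<^sub>m (E i j * ?P * E j i)"
    unfolding P_T_E[OF tt ij(1,2)] by (rule mult_smult_assoc_mat[OF mult_carrier_mat[OF E_carrier c] E_carrier])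
  finally have "?x = t i / t j * tr (E i j * ?P * E j i)"
    using tr_smult[OF mult_carrier_mat[OF mult_carrier_mat[OF E_carrier c] E_carrier]] by simp
  also have "tr (E i j * ?P * E j i) = tr (?P * (E j i * E i j))"
    using assoc_mult_mat[OF E_carrier c E_carrier] assoc_mult_mat[OF c E_carrier E_carrier]
      tr_comm[OF E_carrier mult_carrier_mat[OF c E_carrier]] by simp
  finally have x1: "?x = t i / t j * tr (?P * (E j i * E i j))" .
  have "?P * (E i j * E j i) = ?P * (E j i * E i j) + (?P * E i i - ?P * E j j)"
    unfolding bracket[OF ij] mult_minus_distrib_mat[OF c E_carrier E_carrier, symmetric]
    by (rule mult_add_distrib_mat[OF c mc]) auto
  then have "?x = tr (?P * (E j i * E i j)) + ?y"
    using tr_add[OF mult_carrier_mat[OF c mc] minus_carrier_mat[OF mult_carrier_mat[OF c E_carrier]]]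
      tr_minus[OF mult_carrier_mat[OF c E_carrier] mult_carrier_mat[OF c E_carrier]] by simp
  then have "tr (?P * (E j i * E i j)) = ?x - ?y"
    by (simp only: add_diff_cancel_right')
  with x1 have "?x = t i / t j * (?x - ?y)"
    by (simp only:)
  then have "?x * t j = t i / t j * (?x - ?y) * t j"
    by (rule arg_cong)
  also have "\<dots> = t i * (?x - ?y)"
    using tj by simp
  finally have "?x * t j = t i * (?x - ?y)" .
  then have "?x * (t i - t j) = t i * ?y"
    by (simp add: algebra_simps)
  then show ?thesis
    using ne by (simp add: field_simps)
qed

text \<open>The product \<open>J\<close> of the Vandermonde polynomial and the character is alternating, has leading
  exponent \<open>\<rho> + \<lambda>\<close>, and all its exponents have the length of \<open>\<rho> + \<lambda>\<close>.\<close>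

theorem Weyl_character_formula:
  assumes dom: "strictly_decreasing n (rho_exp n + wt)" and t: "t \<in> torus n"
  shows "(\<Prod>(i, j)\<in>pairs n. t i - t j) * tr (P (T t)) = det (mat n n (\<lambda>(i, j). t i powi (rho_exp n + wt) j))"
proof -
  obtain p where lead: "leading n wt p" and p: "\<And>t. t \<in> torus n \<Longrightarrow> tr (P (T t)) = leval n p t"
    by (rule character_leading) blast
  let ?l = "rho_exp n + wt"
  let ?J = "vandermonde n * p"
  have leadJ: "leading n ?l ?J"
    by (rule leading_mult[OF leading_vandermonde lead])
  have antiJ: "alternating n ?J"
    unfolding alternating_def
  proof (intro allI impI)
    fix i t assume i: "Suc i < n" and t: "t \<in> regular n"
    have tt: "t \<in> torus n"
      by (rule regular_torus[OF t])
    have t': "t \<circ> adjacent_swap i \<in> torus n"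
      using tt i by (simp add: torus_def adjacent_swap_bound)
    have "leval n p (t \<circ> adjacent_swap i) = leval n p t"
      using character_permute[OF adjacent_swap_permutes[OF i] tt] by (simp add: p tt t')
    moreover have "leval n (vandermonde n) (t \<circ> adjacent_swap i) = - leval n (vandermonde n) t"
      using alternating_vandermonde[of n] i t by (simp add: alternating_def)
    ultimately show "leval n ?J (t \<circ> adjacent_swap i) = - leval n ?J t"
      by (simp add: tt t')
  qed
  \<comment> \<open>The trace of \<open>T\<close> times the Casimir operator, computed as a scalar and term by term.\<close>
  have lap: "leval n (laplacian n ?J) t = of_int (norm_sq n ?l) * leval n ?J t" if t: "t \<in> regular n" for t
  proof -
    have tt: "t \<in> torus n"
      by (rule regular_torus[OF t])
    have d1: "tr (P (T t) * E i i) = leval n (ldiff i p) t" if "i < n" "t \<in> torus n" for i t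
    proof -
      have "tr (P (T t) * (E i i * 1\<^sub>m d)) = leval n (ldiff i p) t"
      proof (rule tr_E_diag[OF _ one_carrier_mat that])
        show "tr (P (T t) * 1\<^sub>m d) = leval n p t" if "t \<in> torus n" for t
          using p[OF that] right_mult_one_mat[OF P_carrier[OF T_GL[OF that]]] by simp
      qed
      then show ?thesis
        using right_mult_one_mat[OF E_carrier] by simp
    qed
    have d2: "tr (P (T t) * (E i i * E i i)) = leval n (ldiff i (ldiff i p)) t" if "i < n" for i
      by (rule tr_E_diag[OF d1 E_carrier that tt]) (use that in auto)
    have "casimir_value * leval n p t = tr (P (T t) * Casimir)"
      unfolding Casimir_scalar p[OF tt, symmetric]
      using P_carrier[OF T_GL[OF tt]] mult_smult_distrib[OF P_carrier[OF T_GL[OF tt]] one_carrier_mat]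
        tr_smult[OF P_carrier[OF T_GL[OF tt]]] by simp
    also have "\<dots> = (\<Sum>i<n. \<Sum>j<n. tr (P (T t) * (E i j * E j i)))"
      by (rule tr_mult_Casimir[OF P_carrier[OF T_GL[OF tt]]])
    also have "\<dots> = (\<Sum>i<n. leval n (ldiff i (ldiff i p)) t
        + (\<Sum>j\<in>{..<n} - {i}. t i / (t i - t j) * (leval n (ldiff i p) t - leval n (ldiff j p) t)))"
    proof (rule sum.cong[OF refl])
      fix i assume "i \<in> {..<n}"
      then have i: "i < n" by simp
      have "(\<Sum>j<n. tr (P (T t) * (E i j * E j i)))
         = tr (P (T t) * (E i i * E i i)) + (\<Sum>j\<in>{..<n} - {i}. tr (P (T t) * (E i j * E j i)))"
        using i by (subst sum.remove[of _ i]) auto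
      also have "(\<Sum>j\<in>{..<n} - {i}. tr (P (T t) * (E i j * E j i)))
         = (\<Sum>j\<in>{..<n} - {i}. t i / (t i - t j) * (leval n (ldiff i p) t - leval n (ldiff j p) t))"
        by (intro sum.cong refl) (use i in \<open>auto simp: tr_E_off_diag[OF t] d1 tt\<close>)
      finally show "(\<Sum>j<n. tr (P (T t) * (E i j * E j i))) = leval n (ldiff i (ldiff i p)) t
        + (\<Sum>j\<in>{..<n} - {i}. t i / (t i - t j) * (leval n (ldiff i p) t - leval n (ldiff j p) t))"
        by (simp add: d2[OF i])
    qed
    finally have radial: "casimir_value * leval n p t = (\<Sum>i<n. leval n (ldiff i (ldiff i p)) t)
        + (\<Sum>i<n. \<Sum>j\<in>{..<n} - {i}. t i / (t i - t j) * (leval n (ldiff i p) t - leval n (ldiff j p) t))"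
      by (simp only: sum.distrib)
    have "casimir_value = of_int (\<Sum>i<n. \<Sum>j<n. if i = j then wt i ^ 2 else if i < j then wt i - wt j else 0)"
      unfolding casimir_value_def of_int_sum by (intro sum.cong refl) auto
    then have "of_int (norm_sq n (rho_exp n)) + casimir_value + (of_nat n - 1) * of_int (partial_sum n wt) = (of_int (norm_sq n ?l) :: complex)"
      unfolding norm_sq_shift[symmetric] by simp
    then show ?thesis
      using laplacian_vandermonde_mult[OF t lead radial] by simp
  qed
  have "laplacian n ?J = lscale (of_int (norm_sq n ?l)) ?J"
  proof (rule laurent_eqI)
    show "leval n (laplacian n ?J) t = leval n (lscale (of_int (norm_sq n ?l)) ?J) t" if "t \<in> regular n" for t
      using lap[OF that] by (simp add: leval_lscale)
    have b: "bounded_exp n \<nu>" if "\<nu> \<in> supp ?J" for \<nu>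
      using leading_lower[OF leadJ that] by (simp add: lower_def)
    show "bounded_exp n \<nu>" if "\<nu> \<in> supp (laplacian n ?J)" for \<nu>
      using b that by (auto simp: in_keys_iff coef_laplacian)
    show "bounded_exp n \<nu>" if "\<nu> \<in> supp (lscale (of_int (norm_sq n ?l)) ?J)" for \<nu>
      using b that by (auto simp: in_keys_iff coef_lscale)
  qed
  then have norm: "norm_sq n \<nu> = norm_sq n ?l" if "\<nu> \<in> supp ?J" for \<nu>
  proof -
    assume e: "laplacian n ?J = lscale (of_int (norm_sq n ?l)) ?J"
    have "of_int (norm_sq n \<nu>) * coef ?J \<nu> = of_int (norm_sq n ?l) * coef ?J \<nu>"
      using arg_cong[OF e, of "\<lambda>p. coef p \<nu>"] by (simp only: coef_laplacian coef_lscale)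
    then show ?thesis
      using that by (simp add: in_keys_iff)
  qed
  have "?J = alternant n ?l"
  proof (rule alternating_eq_alternant[OF leadJ antiJ dom])
    fix \<nu> assume \<nu>: "\<nu> \<in> supp ?J" and d: "strictly_decreasing n \<nu>"
    show "\<nu> = ?l"
      using leadJ by (intro eq_if_lower_and_norm_eq[OF leading_lower[OF leadJ \<nu>] _ dom d norm[OF \<nu>]]) (simp add: leading_def)
  qed
  then have "leval n ?J t = det (mat n n (\<lambda>(i, j). t i powi ?l j))"
    unfolding leval_alternant_det[symmetric] by (rule arg_cong)
  then show ?thesis
    unfolding leval_mult[OF t] leval_vandermonde[OF t] p[OF t] .
qed

end

section \<open>Laplace expansion along several rows\<close>

lemma shuffle_perm_image:
  assumes "S \<subseteq> {..<n}" "card S = k"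
  shows "shuffle_perm n S ` {..<k} = S"
proof -
  have fin: "finite S"
    using assms(1) finite_subset by blast
  have kn: "k \<le> n"
    using card_mono[OF _ assms(1)] assms(2) by simp
  have "shuffle_perm n S i = sorted_list_of_set S ! i" if "i < k" for i
    using that kn assms(2) by (simp add: shuffle_perm_def nth_append)
  then have "shuffle_perm n S ` {..<k} = (!) (sorted_list_of_set S) ` {..<length (sorted_list_of_set S)}"
    using assms(2) by (intro image_cong) auto
  also have "\<dots> = set (sorted_list_of_set S)"
    by (auto simp: set_conv_nth)
  finally show ?thesis
    using fin by simp
qed

lemma det_block_diagonal:
  fixes N :: "complex mat"
  assumes N: "N \<in> carrier_mat n n" and k: "k \<le> n"
    and z: "\<And>i j. i < n \<Longrightarrow> j < n \<Longrightarrow> (i < k) \<noteq> (j < k) \<Longrightarrow> N $$ (i, j) = 0"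
  shows "det N = det (mat k k (\<lambda>(i, j). N $$ (i, j))) * det (mat (n - k) (n - k) (\<lambda>(i, j). N $$ (k + i, k + j)))"
proof -
  let ?A = "mat k k (\<lambda>(i, j). N $$ (i, j))" and ?D = "mat (n - k) (n - k) (\<lambda>(i, j). N $$ (k + i, k + j))"
  have "N = four_block_mat ?A (0\<^sub>m k (n - k)) (0\<^sub>m (n - k) k) ?D"
  proof (rule eq_matI)
    fix i j assume "i < dim_row (four_block_mat ?A (0\<^sub>m k (n - k)) (0\<^sub>m (n - k) k) ?D)"
      "j < dim_col (four_block_mat ?A (0\<^sub>m k (n - k)) (0\<^sub>m (n - k) k) ?D)"
    then have "i < n" "j < n"
      using k by auto
    then show "N $$ (i, j) = four_block_mat ?A (0\<^sub>m k (n - k)) (0\<^sub>m (n - k) k) ?D $$ (i, j)"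
      using z[of i j] k by auto
  qed (use N k in auto)
  also have "det \<dots> = det ?A * det ?D"
    by (rule det_four_block_mat_lower_left_zero) auto
  finally show ?thesis .
qed

text \<open>Group the permutations \<open>p\<close> in the Leibniz formula by the image \<open>S\<close> of the first \<open>k\<close> indices. Those
  with image \<open>S\<close> are the compositions of the shuffle of \<open>S\<close> with the permutations that preserve
  the first \<open>k\<close> indices, and the sum over the latter is the determinant of a block diagonal
  matrix.\<close>

theorem Laplace_expansion_rows:
  fixes A :: "complex mat"
  assumes A: "A \<in> carrier_mat n n" and k: "k \<le> n"
  shows "det A = (\<Sum>S | S \<subseteq> {..<n} \<and> card S = k. of_int (shuffle_sign n S)
    * det (mat k k (\<lambda>(i, j). A $$ (i, shuffle_perm n S j)))
    * det (mat (n - k) (n - k) (\<lambda>(i, j). A $$ (k + i, shuffle_perm n S (k + j)))))"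
proof -
  let ?PP = "{p. p permutes {..<n}}"
  let ?SS = "{S. S \<subseteq> {..<n} \<and> card S = k}"
  let ?f = "\<lambda>p. of_int (sign p) * (\<Prod>i<n. A $$ (i, p i))"
  have finP: "finite ?PP"
    by (simp add: finite_permutations)
  have finS: "finite ?SS"
    by (rule finite_subset[of _ "Pow {..<n}"]) auto
  have "det A = (\<Sum>p\<in>?PP. ?f p)"
    using det_def'[OF A] by (simp add: atLeast0LessThan)
  also have "\<dots> = (\<Sum>S\<in>?SS. \<Sum>p\<in>{p \<in> ?PP. p ` {..<k} = S}. ?f p)"
  proof (rule sum.group[symmetric, OF finP finS])
    show "(\<lambda>p. p ` {..<k}) ` ?PP \<subseteq> ?SS"
    proof
      fix S assume "S \<in> (\<lambda>p. p ` {..<k}) ` ?PP"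
      then obtain p where p: "p permutes {..<n}" "S = p ` {..<k}"
        by blast
      have "p ` {..<k} \<subseteq> p ` {..<n}"
        using k by (intro image_mono) auto
      then show "S \<in> ?SS"
        using p permutes_image[OF p(1)] card_image[OF permutes_inj_on[OF p(1)], of "{..<k}"] by simp
    qed
  qed
  also have "\<dots> = (\<Sum>S\<in>?SS. of_int (shuffle_sign n S)
    * det (mat k k (\<lambda>(i, j). A $$ (i, shuffle_perm n S j)))
    * det (mat (n - k) (n - k) (\<lambda>(i, j). A $$ (k + i, shuffle_perm n S (k + j)))))"
  proof (rule sum.cong[OF refl])
    fix S assume "S \<in> ?SS"
    then have S: "S \<subseteq> {..<n}" "card S = k"
      by auto
    let ?\<tau> = "shuffle_perm n S"
    let ?\<tau>i = "Hilbert_Choice.inv ?\<tau>"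
    have \<tau>: "?\<tau> permutes {..<n}"
      by (rule shuffle_perm_permutes[OF S(1)])
    have \<tau>k: "?\<tau> ` {..<k} = S"
      by (rule shuffle_perm_image[OF S])
    let ?Q = "{q \<in> ?PP. q ` {..<k} = {..<k}}"
    let ?N = "mat n n (\<lambda>(i, j). if (i < k) = (j < k) then A $$ (i, ?\<tau> j) else 0)"
    \<comment> \<open>Composition with the shuffle of \<open>S\<close> identifies the permutations preserving the first \<open>k\<close> indices with those mapping them onto \<open>S\<close>.\<close>
    have "bij_betw ((\<circ>) ?\<tau>) ?Q {p \<in> ?PP. p ` {..<k} = S}"
    proof (rule bij_betwI[where g = "(\<circ>) ?\<tau>i"])
      show "(\<circ>) ?\<tau> \<in> ?Q \<rightarrow> {p \<in> ?PP. p ` {..<k} = S}"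
      proof
        fix q assume "q \<in> ?Q"
        then have q: "q permutes {..<n}" "q ` {..<k} = {..<k}"
          by auto
        have "(?\<tau> \<circ> q) ` {..<k} = S"
          unfolding image_comp[symmetric] q(2) \<tau>k ..
        then show "?\<tau> \<circ> q \<in> {p \<in> ?PP. p ` {..<k} = S}"
          using permutes_compose[OF q(1) \<tau>] by simp
      qed
      show "(\<circ>) ?\<tau>i \<in> {p \<in> ?PP. p ` {..<k} = S} \<rightarrow> ?Q"
      proof
        fix p assume "p \<in> {p \<in> ?PP. p ` {..<k} = S}"
        then have p: "p permutes {..<n}" "p ` {..<k} = S"
          by auto
        have "(?\<tau>i \<circ> p) ` {..<k} = ?\<tau>i ` (?\<tau> ` {..<k})"
          unfolding image_comp[symmetric] p(2) \<tau>k ..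
        also have "\<dots> = {..<k}"
          using permutes_inv_o(2)[OF \<tau>] by (simp add: image_comp)
        finally show "?\<tau>i \<circ> p \<in> ?Q"
          using permutes_compose[OF p(1) permutes_inv[OF \<tau>]] by simp
      qed
      show "?\<tau>i \<circ> (?\<tau> \<circ> q) = q" if "q \<in> ?Q" for q
        using permutes_inv_o(2)[OF \<tau>] by (simp add: comp_assoc[symmetric])
      show "?\<tau> \<circ> (?\<tau>i \<circ> p) = p" if "p \<in> {p \<in> ?PP. p ` {..<k} = S}" for p
        using permutes_inv_o(1)[OF \<tau>] by (simp add: comp_assoc[symmetric])
    qed
    then have "(\<Sum>p\<in>{p \<in> ?PP. p ` {..<k} = S}. ?f p) = (\<Sum>q\<in>?Q. ?f (?\<tau> \<circ> q))"
      by (rule sum.reindex_bij_betw[symmetric])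
    also have "\<dots> = (\<Sum>q\<in>?Q. of_int (shuffle_sign n S) * (of_int (sign q) * (\<Prod>i<n. ?N $$ (i, q i))))"
    proof (rule sum.cong[OF refl])
      fix q assume q: "q \<in> ?Q"
      then have qp: "q permutes {..<n}" and qk: "q ` {..<k} = {..<k}"
        by auto
      have "sign (?\<tau> \<circ> q) = shuffle_sign n S * sign q"
        unfolding shuffle_sign_def using \<tau> qp permutation_permutes
        by (intro sign_compose) blast+
      moreover have "(\<Prod>i<n. A $$ (i, (?\<tau> \<circ> q) i)) = (\<Prod>i<n. ?N $$ (i, q i))"
      proof (rule prod.cong[OF refl])
        fix i assume "i \<in> {..<n}"
        then have i: "i < n" "q i < n"
          using permutes_in_image[OF qp, of i] by auto
        have "i < k \<longleftrightarrow> q i < k"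
          using qk inj_image_mem_iff[OF permutes_inj[OF qp], of i "{..<k}"] by auto
        then show "A $$ (i, (?\<tau> \<circ> q) i) = ?N $$ (i, q i)"
          using i by simp
      qed
      ultimately show "?f (?\<tau> \<circ> q) = of_int (shuffle_sign n S) * (of_int (sign q) * (\<Prod>i<n. ?N $$ (i, q i)))"
        by (simp add: mult.assoc)
    qed
    also have "\<dots> = of_int (shuffle_sign n S) * (\<Sum>q\<in>?Q. of_int (sign q) * (\<Prod>i<n. ?N $$ (i, q i)))"
      by (rule sum_distrib_left[symmetric])
    also have "(\<Sum>q\<in>?Q. of_int (sign q) * (\<Prod>i<n. ?N $$ (i, q i))) = (\<Sum>q\<in>?PP. of_int (sign q) * (\<Prod>i<n. ?N $$ (i, q i)))"
    proof (rule sum.mono_neutral_left[OF finP])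
      show "\<forall>q\<in>?PP - ?Q. of_int (sign q) * (\<Prod>i<n. ?N $$ (i, q i)) = 0"
      proof
        fix q assume "q \<in> ?PP - ?Q"
        then have q: "q permutes {..<n}" "q ` {..<k} \<noteq> {..<k}"
          by auto
        have "card (q ` {..<k}) = card {..<k}"
          by (rule card_image[OF permutes_inj_on[OF q(1)]])
        then have "\<not> q ` {..<k} \<subseteq> {..<k}"
          using q(2) card_subset_eq[of "{..<k}" "q ` {..<k}"] by auto
        then obtain i where i: "i < k" "\<not> q i < k"
          by auto
        then have "?N $$ (i, q i) = 0"
          using k permutes_in_image[OF q(1), of i] by auto
        then have "(\<Prod>i<n. ?N $$ (i, q i)) = 0"
          using i k by (intro prod_zero) auto
        then show "of_int (sign q) * (\<Prod>i<n. ?N $$ (i, q i)) = 0"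
          by simp
      qed
    qed auto
    also have "\<dots> = det ?N"
      using det_def'[of ?N n] by (simp add: atLeast0LessThan)
    also have "\<dots> = det (mat k k (\<lambda>(i, j). ?N $$ (i, j))) * det (mat (n - k) (n - k) (\<lambda>(i, j). ?N $$ (k + i, k + j)))"
      by (rule det_block_diagonal[OF _ k]) auto
    also have "mat k k (\<lambda>(i, j). ?N $$ (i, j)) = mat k k (\<lambda>(i, j). A $$ (i, ?\<tau> j))"
      using k by (intro eq_matI) auto
    also have "mat (n - k) (n - k) (\<lambda>(i, j). ?N $$ (k + i, k + j)) = mat (n - k) (n - k) (\<lambda>(i, j). A $$ (k + i, ?\<tau> (k + j)))"
      using k by (intro eq_matI) auto
    finally show "(\<Sum>p\<in>{p \<in> ?PP. p ` {..<k} = S}. ?f p) = of_int (shuffle_sign n S)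
      * det (mat k k (\<lambda>(i, j). A $$ (i, ?\<tau> j)))
      * det (mat (n - k) (n - k) (\<lambda>(i, j). A $$ (k + i, ?\<tau> (k + j))))"
      by (simp only: mult.assoc)
  qed
  finally show ?thesis .
qed

section \<open>Specialization to powers of one variable, and dimensions\<close>

definition diff_prod :: "nat \<Rightarrow> (nat \<Rightarrow> int) \<Rightarrow> complex" where
  "diff_prod m l = (\<Prod>(i, j)\<in>pairs m. of_int (l i - l j))"

lemma power_int_diff_quotient:
  "((\<lambda>q :: complex. (q powi a - q powi b) / (q - 1)) \<longlongrightarrow> of_int (a - b)) (at 1)"
proof -
  have "((\<lambda>q :: complex. q powi a - q powi b) has_field_derivative of_int (a - b)) (at 1)"
    by (auto intro!: derivative_eq_intros)
  then show ?thesis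
    unfolding has_field_derivative_iff by simp
qed

text \<open>The \<open>q\<close>-analogue of \<open>diff_prod\<close>: a Vandermonde determinant in the powers \<open>q\<close> to the \<open>l\<^sub>i\<close>.\<close>

definition q_diff_prod :: "nat \<Rightarrow> (nat \<Rightarrow> int) \<Rightarrow> complex \<Rightarrow> complex" where
  "q_diff_prod m l q = (\<Prod>(i, j)\<in>pairs m. q powi l i - q powi l j)"

lemma q_diff_prod_limit:
  "((\<lambda>q. q_diff_prod m l q / (q - 1) ^ card (pairs m)) \<longlongrightarrow> diff_prod m l) (at 1)"
proof -
  have "((\<lambda>q. \<Prod>x\<in>pairs m. (q powi l (fst x) - q powi l (snd x)) / (q - 1)) \<longlongrightarrow> (\<Prod>x\<in>pairs m. of_int (l (fst x) - l (snd x)))) (at (1 :: complex))"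
    by (intro tendsto_prod power_int_diff_quotient)
  then show ?thesis
    by (simp add: diff_prod_def q_diff_prod_def case_prod_beta prod_dividef)
qed

lemma diff_prod_nonzero: "strictly_decreasing m l \<Longrightarrow> diff_prod m l \<noteq> 0"
proof -
  assume l: "strictly_decreasing m l"
  have "(case x of (i, j) \<Rightarrow> of_int (l i - l j)) \<noteq> (0 :: complex)" if "x \<in> pairs m" for x
    using that strictly_decreasing_less[OF l, of "fst x" "snd x"] by (auto simp: pairs_def simp del: of_int_diff)
  then show ?thesis
    unfolding diff_prod_def by (simp add: prod_zero_iff)
qed

text \<open>At the geometric progression \<open>t\<^sub>i = q\<^sup>m\<^sup>-\<^sup>1\<^sup>-\<^sup>i\<close> the transposed alternant of \<open>l\<close> is the Vandermonde
  determinant in the variables \<open>q\<close> to the \<open>l\<^sub>j\<close>.\<close>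

lemma det_principal_specialization:
  assumes q: "q \<noteq> 0"
  shows "det (mat m m (\<lambda>(i, j). (q ^ (m - 1 - i)) powi l j)) = q_diff_prod m l q"
proof -
  have t: "(\<lambda>i. q powi l i) \<in> torus m"
    using q by (simp add: torus_def)
  have "mat m m (\<lambda>(i, j). (q ^ (m - 1 - i)) powi l j) = transpose_mat (mat m m (\<lambda>(i, j). (q powi l i) ^ (m - 1 - j)))"
    by (intro eq_matI) (auto simp: power_int_power power_int_power' mult.commute)
  then show ?thesis
    using vandermonde_det[OF t] det_transpose[of "mat m m (\<lambda>(i, j). (q powi l i) ^ (m - 1 - j))" m]
    by (simp add: q_diff_prod_def)
qed

definition shifted_weight :: "int list \<Rightarrow> nat \<Rightarrow> int" where
  "shifted_weight \<mu> i = (if i < length \<mu> then plus_rho \<mu> ! i else 0)"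

lemma plus_rho_nth: "i < length \<mu> \<Longrightarrow> plus_rho \<mu> ! i = \<mu> ! i + int (length \<mu> - 1 - i)"
  by (simp add: plus_rho_def rho_def rev_nth)

lemma length_plus_rho [simp]: "length (plus_rho \<mu>) = length \<mu>"
  by (simp add: plus_rho_def)

lemma highest_weight_rep_obtain:
  assumes "highest_weight_rep n \<mu> V"
  obtains v where "highest_weight_GL_rep n V \<mu> v"
proof -
  obtain v where "v \<in> carrier_vec (rep.degree V)" "v \<noteq> 0\<^sub>v (rep.degree V)"
    "\<forall>b \<in> carrier (GL n). upper_triangular b \<longrightarrow> action V b *\<^sub>v v = (\<Prod>i<n. (b $$ (i, i)) powi (\<mu> ! i)) \<cdot>\<^sub>v v"
    using assms unfolding highest_weight_rep_def has_highest_weight_def by blast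
  moreover have "algebraic_rep n V" "irreducible_rep n V" "length \<mu> = n"
    using assms unfolding highest_weight_rep_def has_highest_weight_def by blast+
  ultimately have "highest_weight_GL_rep n V \<mu> v"
    by unfold_locales auto
  then show thesis by (rule that)
qed

lemma (in highest_weight_GL_rep) shifted_weight_eq: "shifted_weight lam = rho_exp n + wt"
  using len by (auto simp: shifted_weight_def plus_rho_nth rho_exp_def wt_def fun_eq_iff)

lemma (in highest_weight_GL_rep) character_diag:
  "t \<in> torus n \<Longrightarrow> character V (mat_diag n t) = tr (P (T t))"
  using P_carrier[OF T_GL, of t] by (auto simp: character_def tr_def T_def)

lemma character_Weyl:
  assumes V: "highest_weight_rep n \<mu> V" and dom: "strictly_decreasing n (shifted_weight \<mu>)" and t: "t \<in> torus n"
  shows "(\<Prod>(i, j)\<in>pairs n. t i - t j) * character V (mat_diag n t)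
    = det (mat n n (\<lambda>(i, j). t i powi shifted_weight \<mu> j))"
proof -
  obtain v where "highest_weight_GL_rep n V \<mu> v"
    using highest_weight_rep_obtain[OF V] .
  then interpret highest_weight_GL_rep n V \<mu> v .
  show ?thesis
    using Weyl_character_formula[OF _ t] dom by (simp only: shifted_weight_eq character_diag[OF t])
qed

lemma character_permute_diag:
  assumes V: "highest_weight_rep n \<mu> V" and \<sigma>: "\<sigma> permutes {..<n}" and t: "t \<in> torus n"
  shows "character V (mat_diag n (t \<circ> \<sigma>)) = character V (mat_diag n t)"
proof -
  obtain v where "highest_weight_GL_rep n V \<mu> v"
    using highest_weight_rep_obtain[OF V] .
  then interpret highest_weight_GL_rep n V \<mu> v .
  have "t \<circ> \<sigma> \<in> torus n"
    using t permutes_in_image[OF \<sigma>] by (simp add: torus_def)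
  then show ?thesis
    using character_permute[OF \<sigma> t] character_diag t by simp
qed

lemma leval_tendsto:
  assumes "\<And>i. i < n \<Longrightarrow> ((\<lambda>q. f q i) \<longlongrightarrow> t i) F" and t: "t \<in> torus n"
  shows "((\<lambda>q. leval n p (f q)) \<longlongrightarrow> leval n p t) F"
  unfolding leval_def mono_at_def
  by (intro tendsto_sum tendsto_mult tendsto_const tendsto_prod tendsto_power_int)
     (use assms in \<open>auto simp: torus_def\<close>)

text \<open>On the torus the character is a Laurent polynomial and hence continuous.\<close>

lemma character_tendsto:
  assumes V: "highest_weight_rep n \<mu> V" and f: "\<And>i. i < n \<Longrightarrow> ((\<lambda>q. f q i) \<longlongrightarrow> t i) F"
    and ev: "\<forall>\<^sub>F q in F. f q \<in> torus n" and t: "t \<in> torus n"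
  shows "((\<lambda>q. character V (mat_diag n (f q))) \<longlongrightarrow> character V (mat_diag n t)) F"
proof -
  obtain v where "highest_weight_GL_rep n V \<mu> v"
    using highest_weight_rep_obtain[OF V] .
  then interpret highest_weight_GL_rep n V \<mu> v .
  obtain p where p: "\<And>t. t \<in> torus n \<Longrightarrow> tr (P (T t)) = leval n p t"
    using character_leading by blast
  have "((\<lambda>q. leval n p (f q)) \<longlongrightarrow> leval n p t) F"
    by (rule leval_tendsto[OF f t])
  moreover have "\<forall>\<^sub>F q in F. leval n p (f q) = character V (mat_diag n (f q))"
    using ev by eventually_elim (simp add: character_diag p)
  ultimately show ?thesis
    using tendsto_cong[of "\<lambda>q. leval n p (f q)"] by (simp add: character_diag[OF t] p[OF t])
qed

lemma eventually_at_1: "\<forall>\<^sub>F q :: complex in at 1. q \<noteq> 0 \<and> q \<noteq> 1"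
  by (intro eventually_conj eventually_neq_at_within)

lemma diff_prod_rho: "q_diff_prod m (rho_exp m) q = (\<Prod>(i, j)\<in>pairs m. q ^ (m - 1 - i) - q ^ (m - 1 - j))"
  unfolding q_diff_prod_def by (rule prod.cong) (auto simp: pairs_def rho_exp_def simp del: of_nat_diff)

text \<open>At \<open>t\<^sub>i = q\<^sup>m\<^sup>-\<^sup>1\<^sup>-\<^sup>i\<close> both sides of the character formula are products of differences of powers of
  \<open>q\<close>. Divide by the power of \<open>q - 1\<close> that counts the factors and let \<open>q\<close> tend to 1.\<close>

lemma Weyl_dimension_formula:
  assumes V: "highest_weight_rep m \<mu> V" and dom: "strictly_decreasing m (shifted_weight \<mu>)"
  shows "of_nat (rep.degree V) = diff_prod m (shifted_weight \<mu>) / diff_prod m (rho_exp m)"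
proof -
  let ?l = "shifted_weight \<mu>"
  let ?f = "\<lambda>(q :: complex) i. q ^ (m - 1 - i)"
  have lim: "((\<lambda>q. character V (mat_diag m (?f q))) \<longlongrightarrow> character V (mat_diag m (\<lambda>i. 1))) (at 1)"
  proof (rule character_tendsto[OF V])
    show "((\<lambda>q. ?f q i) \<longlongrightarrow> 1) (at 1)" for i
      by (rule tendsto_eq_intros | simp)+
    show "\<forall>\<^sub>F q in at 1. ?f q \<in> torus m"
      using eventually_at_1 by eventually_elim (simp add: torus_def)
  qed (simp add: torus_def)
  have eq: "\<forall>\<^sub>F q in at 1. q_diff_prod m (rho_exp m) q / (q - 1) ^ card (pairs m) * character V (mat_diag m (?f q))
      = q_diff_prod m ?l q / (q - 1) ^ card (pairs m)"
    using eventually_at_1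
  proof eventually_elim
    case (elim q)
    have "q_diff_prod m (rho_exp m) q * character V (mat_diag m (?f q)) = q_diff_prod m ?l q"
      using character_Weyl[OF V dom, of "?f q"] det_principal_specialization[of q m ?l] elim
      by (simp add: torus_def diff_prod_rho)
    then show ?case
      by (metis times_divide_eq_left)
  qed
  have "((\<lambda>q. q_diff_prod m (rho_exp m) q / (q - 1) ^ card (pairs m) * character V (mat_diag m (?f q)))
      \<longlongrightarrow> diff_prod m (rho_exp m) * character V (mat_diag m (\<lambda>i. 1))) (at 1)"
    by (rule tendsto_mult[OF q_diff_prod_limit lim])
  then have "((\<lambda>q. q_diff_prod m ?l q / (q - 1) ^ card (pairs m))
      \<longlongrightarrow> diff_prod m (rho_exp m) * character V (mat_diag m (\<lambda>i. 1))) (at 1)"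
    by (rule Lim_transform_eventually[OF _ eq])
  then have "diff_prod m (rho_exp m) * character V (mat_diag m (\<lambda>i. 1)) = diff_prod m ?l"
    by (rule LIM_unique[OF _ q_diff_prod_limit])
  moreover have "character V (mat_diag m (\<lambda>i. 1)) = of_nat (rep.degree V)"
  proof -
    obtain v where "highest_weight_GL_rep m V \<mu> v"
      using highest_weight_rep_obtain[OF V] .
    then interpret highest_weight_GL_rep m V \<mu> v .
    show ?thesis
      by (simp add: character_def P_one)
  qed
  ultimately show ?thesis
    using diff_prod_nonzero[OF strictly_decreasing_rho_exp[of m]] by (simp add: field_simps)
qed

text \<open>The row operation is multiplication by an upper unitriangular matrix; \<open>k \<le> m\<close> ensures that the
  rows that are subtracted are not among the first \<open>k\<close>.\<close>

lemma det_subtract_rows: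
  fixes A :: "complex mat"
  assumes A: "A \<in> carrier_mat n n" and n: "n = k + m" and km: "k \<le> m"
  shows "det (mat n n (\<lambda>(i, j). if i < k then A $$ (i, j) - A $$ (m + i, j) else A $$ (i, j))) = det A"
proof -
  let ?B = "mat n n (\<lambda>(i, j). (if j = i then 1 else 0) - (if j = m + i \<and> i < k then 1 else 0)) :: complex mat"
  have B: "?B \<in> carrier_mat n n"
    by simp
  have "?B * A = mat n n (\<lambda>(i, j). if i < k then A $$ (i, j) - A $$ (m + i, j) else A $$ (i, j))"
  proof (rule eq_matI)
    fix i j assume "i < dim_row (mat n n (\<lambda>(i, j). if i < k then A $$ (i, j) - A $$ (m + i, j) else A $$ (i, j)))"
      "j < dim_col (mat n n (\<lambda>(i, j). if i < k then A $$ (i, j) - A $$ (m + i, j) else A $$ (i, j)))"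
    then have ij: "i < n" "j < n"
      by auto
    have "(?B * A) $$ (i, j) = (\<Sum>c<n. (if c = i then A $$ (i, j) else 0) - (if c = m + i then (if i < k then A $$ (m + i, j) else 0) else 0))"
      unfolding index_mult_sum[OF B A ij] using ij by (intro sum.cong refl) auto
    then show "(?B * A) $$ (i, j) = mat n n (\<lambda>(i, j). if i < k then A $$ (i, j) - A $$ (m + i, j) else A $$ (i, j)) $$ (i, j)"
      using ij n by (simp add: sum_subtractf)
  qed (use A in auto)
  moreover have "det ?B = 1"
  proof -
    have "det ?B = prod_list (diag_mat ?B)"
      using km by (intro det_upper_triangular[OF _ B]) (auto simp: upper_triangular_def)
    also have "\<dots> = 1"
      unfolding prod_list_diag_prod using km by (intro prod.neutral) auto
    finally show ?thesis .
  qed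
  ultimately show ?thesis
    using det_mult[OF B A] by simp
qed

lemma det_scale_columns:
  fixes c :: "nat \<Rightarrow> complex"
  shows "det (mat k k (\<lambda>(i, j). c j * f i j)) = (\<Prod>j<k. c j) * det (mat k k (\<lambda>(i, j). f i j))"
proof -
  let ?A = "mat k k (\<lambda>(i, j). f i j)"
  have A: "?A \<in> carrier_mat k k"
    by simp
  have "det (mat_diag k c) = prod_list (diag_mat (mat_diag k c))"
    by (rule det_upper_triangular[OF upper_triangular_diag mat_diag_dim])
  then have "det (mat_diag k c) = (\<Prod>j<k. c j)"
    unfolding prod_list_diag_prod by (simp add: mat_diag_def atLeast0LessThan)
  moreover have "mat k k (\<lambda>(i, j). c j * f i j) = ?A * mat_diag k c"
    unfolding mat_diag_mult_right[OF A] by (intro eq_matI) (auto simp: mult.commute)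
  ultimately show ?thesis
    using det_mult[OF A mat_diag_dim] by (simp add: mult.commute)
qed

lemma pairs_split:
  "pairs (k + m) = pairs k \<union> ({..<k} \<times> {k..<k + m}) \<union> (\<lambda>(i, j). (k + i, k + j)) ` pairs m"
proof (intro equalityI subsetI)
  fix x assume "x \<in> pairs (k + m)"
  then obtain i j where x: "x = (i, j)" "i < j" "j < k + m"
    by (auto simp: pairs_def)
  consider "j < k" | "i < k" "k \<le> j" | "k \<le> i"
    by linarith
  then show "x \<in> pairs k \<union> ({..<k} \<times> {k..<k + m}) \<union> (\<lambda>(i, j). (k + i, k + j)) ` pairs m"
  proof cases
    case 3
    then have "x = (\<lambda>(i, j). (k + i, k + j)) (i - k, j - k)" "(i - k, j - k) \<in> pairs m"
      using x by (auto simp: pairs_def)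
    then show ?thesis by blast
  qed (use x in \<open>auto simp: pairs_def\<close>)
qed (auto simp: pairs_def)

lemma prod_pairs_split:
  fixes g :: "nat \<Rightarrow> nat \<Rightarrow> complex"
  shows "(\<Prod>(i, j)\<in>pairs (k + m). g i j)
    = (\<Prod>(i, j)\<in>pairs k. g i j) * (\<Prod>(i, j)\<in>{..<k} \<times> {k..<k + m}. g i j) * (\<Prod>(i, j)\<in>pairs m. g (k + i) (k + j))"
proof -
  have fin: "finite (pairs k \<union> ({..<k} \<times> {k..<k + m}))"
    by simp
  have "(\<Prod>(i, j)\<in>pairs (k + m). g i j)
    = (\<Prod>(i, j)\<in>pairs k \<union> ({..<k} \<times> {k..<k + m}). g i j) * (\<Prod>(i, j)\<in>(\<lambda>(i, j). (k + i, k + j)) ` pairs m. g i j)"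
    unfolding pairs_split by (rule prod.union_disjoint[OF fin finite_imageI[OF finite_pairs]]) (auto simp: pairs_def)
  also have "(\<Prod>(i, j)\<in>pairs k \<union> ({..<k} \<times> {k..<k + m}). g i j)
    = (\<Prod>(i, j)\<in>pairs k. g i j) * (\<Prod>(i, j)\<in>{..<k} \<times> {k..<k + m}. g i j)"
    by (rule prod.union_disjoint[OF finite_pairs]) (auto simp: pairs_def)
  also have "(\<Prod>(i, j)\<in>(\<lambda>(i, j). (k + i, k + j)) ` pairs m. g i j) = (\<Prod>(i, j)\<in>pairs m. g (k + i) (k + j))"
    by (subst prod.reindex) (auto simp: inj_on_def case_prod_beta comp_def)
  finally show ?thesis .
qed

section \<open>The character at the involution\<close>

text \<open>A curve of torus elements that reaches a permutation of the involution at \<open>q = 1\<close>. The entries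
  with a sign come first, as the Laplace expansion is along the first rows.\<close>

definition spec_point :: "nat \<Rightarrow> nat \<Rightarrow> complex \<Rightarrow> nat \<Rightarrow> complex" where
  "spec_point k m q i = (if i < k then - (q ^ (k - 1 - i)) else q ^ (k + m - 1 - i))"

text \<open>Row \<open>i < k\<close> and row \<open>m + i\<close> carry the same power of \<open>q\<close> up to sign. After subtraction, column
  \<open>j\<close> of the upper rows has the factor \<open>(-1)\<^sup>l - 1\<close> with \<open>l = l\<^sub>j\<close>, which is \<open>-2\<close> or 0.\<close>

lemma det_spec_point:
  assumes q: "q \<noteq> 0" and km: "k \<le> m"
  shows "det (mat (k + m) (k + m) (\<lambda>(i, j). spec_point k m q i powi l j))
    = (- 2) ^ k * (\<Sum>S | S \<subseteq> {..<k + m} \<and> card S = k \<and> (\<forall>s\<in>S. odd (l s)).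
        of_int (shuffle_sign (k + m) S)
        * q_diff_prod k (\<lambda>i. l (shuffle_perm (k + m) S i)) q
        * q_diff_prod m (\<lambda>i. l (shuffle_perm (k + m) S (k + i))) q)"
proof -
  let ?n = "k + m"
  define A where "A = mat ?n ?n (\<lambda>(i, j). spec_point k m q i powi l j)"
  define c :: "nat \<Rightarrow> complex" where "c j = (if odd (l j) then - 2 else 0)" for j
  define M where "M = mat ?n ?n (\<lambda>(i, j). if i < k then A $$ (i, j) - A $$ (m + i, j) else A $$ (i, j))"
  have M: "M \<in> carrier_mat ?n ?n" and A: "A \<in> carrier_mat ?n ?n"
    by (simp_all add: M_def A_def)
  have upper: "M $$ (i, j) = c j * (q ^ (k - 1 - i)) powi l j" if "i < k" "j < ?n" for i j
    using that km by (auto simp: M_def A_def spec_point_def c_def power_int_minus_left)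
  have low: "M $$ (k + i, j) = (q ^ (m - 1 - i)) powi l j" if "i < m" "j < ?n" for i j
    using that by (simp add: M_def A_def spec_point_def)
  have prod_c: "(\<Prod>j<k. c (shuffle_perm ?n S j)) = (if \<forall>s\<in>S. odd (l s) then (- 2) ^ k else 0)"
    if "S \<subseteq> {..<?n}" "card S = k" for S
  proof -
    have S: "S = shuffle_perm ?n S ` {..<k}"
      using shuffle_perm_image[OF that] ..
    show ?thesis
    proof (cases "\<forall>s\<in>S. odd (l s)")
      case True
      then have "c (shuffle_perm ?n S j) = - 2" if "j < k" for j
        using that S by (auto simp: c_def)
      with True show ?thesis by simp
    next
      case False
      then obtain s where s: "s \<in> S" "even (l s)"
        by blast
      have "s \<in> shuffle_perm ?n S ` {..<k}"
        using s(1) S by (rule subst[rotated])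
      then obtain j where j: "j < k" "s = shuffle_perm ?n S j"
        by auto
      then have "(\<Prod>j<k. c (shuffle_perm ?n S j)) = 0"
        using s(2) by (intro prod_zero bexI[of _ j]) (auto simp: c_def)
      then show ?thesis
        by (simp only: if_not_P[OF False])
    qed
  qed
  have "det A = det M"
    unfolding M_def by (rule det_subtract_rows[OF A refl km, symmetric])
  also have "\<dots> = (\<Sum>S | S \<subseteq> {..<?n} \<and> card S = k. of_int (shuffle_sign ?n S)
    * det (mat k k (\<lambda>(i, j). M $$ (i, shuffle_perm ?n S j)))
    * det (mat m m (\<lambda>(i, j). M $$ (k + i, shuffle_perm ?n S (k + j)))))"
    using Laplace_expansion_rows[OF M, of k] by simp
  also have "\<dots> = (\<Sum>S | S \<subseteq> {..<?n} \<and> card S = k. if \<forall>s\<in>S. odd (l s) then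
      (- 2) ^ k * (of_int (shuffle_sign ?n S) * q_diff_prod k (\<lambda>i. l (shuffle_perm ?n S i)) q
        * q_diff_prod m (\<lambda>i. l (shuffle_perm ?n S (k + i))) q) else 0)"
  proof (rule sum.cong[OF refl])
    fix S assume "S \<in> {S. S \<subseteq> {..<?n} \<and> card S = k}"
    then have S: "S \<subseteq> {..<?n}" "card S = k"
      by auto
    let ?\<tau> = "shuffle_perm ?n S"
    have \<tau>: "?\<tau> j < ?n" if "j < ?n" for j
      using permutes_in_image[OF shuffle_perm_permutes[OF S(1)], of j] that by simp
    have "mat k k (\<lambda>(i, j). M $$ (i, ?\<tau> j)) = mat k k (\<lambda>(i, j). c (?\<tau> j) * (q ^ (k - 1 - i)) powi l (?\<tau> j))"
      using \<tau> by (intro eq_matI) (auto simp: upper)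
    then have d1: "det (mat k k (\<lambda>(i, j). M $$ (i, ?\<tau> j)))
      = (\<Prod>j<k. c (?\<tau> j)) * q_diff_prod k (\<lambda>i. l (?\<tau> i)) q"
      by (simp only: det_scale_columns det_principal_specialization[OF q])
    have "mat m m (\<lambda>(i, j). M $$ (k + i, ?\<tau> (k + j))) = mat m m (\<lambda>(i, j). (q ^ (m - 1 - i)) powi l (?\<tau> (k + j)))"
      using \<tau> by (intro eq_matI) (auto simp: low)
    then have d2: "det (mat m m (\<lambda>(i, j). M $$ (k + i, ?\<tau> (k + j)))) = q_diff_prod m (\<lambda>i. l (?\<tau> (k + i))) q"
      by (simp only: det_principal_specialization[OF q])
    show "of_int (shuffle_sign ?n S) * det (mat k k (\<lambda>(i, j). M $$ (i, ?\<tau> j)))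
        * det (mat m m (\<lambda>(i, j). M $$ (k + i, ?\<tau> (k + j))))
      = (if \<forall>s\<in>S. odd (l s) then (- 2) ^ k * (of_int (shuffle_sign ?n S) * q_diff_prod k (\<lambda>i. l (?\<tau> i)) q
        * q_diff_prod m (\<lambda>i. l (?\<tau> (k + i))) q) else 0)"
      unfolding d1 d2 prod_c[OF S] by simp
  qed
  also have "\<dots> = (\<Sum>S | S \<subseteq> {..<?n} \<and> card S = k \<and> (\<forall>s\<in>S. odd (l s)).
      (- 2) ^ k * (of_int (shuffle_sign ?n S) * q_diff_prod k (\<lambda>i. l (shuffle_perm ?n S i)) q
        * q_diff_prod m (\<lambda>i. l (shuffle_perm ?n S (k + i))) q))"
  proof (rule sum.mono_neutral_cong_right)
    show "finite {S. S \<subseteq> {..<?n} \<and> card S = k}"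
      by (rule finite_subset[of _ "Pow {..<?n}"]) auto
  qed auto
  finally show ?thesis
    by (simp only: A_def sum_distrib_left)
qed

lemma vandermonde_spec_point:
  "(\<Prod>(i, j)\<in>pairs (k + m). spec_point k m q i - spec_point k m q j)
    = (- 1) ^ card (pairs k) * q_diff_prod k (rho_exp k) q
      * (\<Prod>(i, j)\<in>{..<k} \<times> {k..<k + m}. - (q ^ (k - 1 - i)) - q ^ (k + m - 1 - j))
      * q_diff_prod m (rho_exp m) q"
proof -
  have "(\<Prod>(i, j)\<in>pairs k. spec_point k m q i - spec_point k m q j)
    = (\<Prod>x\<in>pairs k. (- 1) * (q ^ (k - 1 - fst x) - q ^ (k - 1 - snd x)))"
    by (rule prod.cong) (auto simp: pairs_def spec_point_def)
  also have "\<dots> = (- 1) ^ card (pairs k) * q_diff_prod k (rho_exp k) q"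
    unfolding prod.distrib diff_prod_rho by (simp add: case_prod_beta)
  finally have 1: "(\<Prod>(i, j)\<in>pairs k. spec_point k m q i - spec_point k m q j)
    = (- 1) ^ card (pairs k) * q_diff_prod k (rho_exp k) q" .
  have 2: "(\<Prod>(i, j)\<in>{..<k} \<times> {k..<k + m}. spec_point k m q i - spec_point k m q j)
    = (\<Prod>(i, j)\<in>{..<k} \<times> {k..<k + m}. - (q ^ (k - 1 - i)) - q ^ (k + m - 1 - j))"
    by (rule prod.cong) (auto simp: spec_point_def)
  have 3: "(\<Prod>(i, j)\<in>pairs m. spec_point k m q (k + i) - spec_point k m q (k + j)) = q_diff_prod m (rho_exp m) q"
    unfolding diff_prod_rho by (rule prod.cong) (auto simp: spec_point_def)
  show ?thesis
    unfolding prod_pairs_split 1 2 3 ..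
qed

lemma q_diff_prod_limit2:
  "((\<lambda>q. q_diff_prod k l q * q_diff_prod m l' q / (q - 1) ^ (card (pairs k) + card (pairs m)))
    \<longlongrightarrow> diff_prod k l * diff_prod m l') (at 1)"
  using tendsto_mult[OF q_diff_prod_limit[of k l] q_diff_prod_limit[of m l']]
  by (simp add: power_add)

text \<open>Weyl's dimension polynomial in the shifted weight \<open>l = \<mu> + \<rho>\<close>.\<close>

definition weyl_dim :: "nat \<Rightarrow> (nat \<Rightarrow> int) \<Rightarrow> complex" where
  "weyl_dim m l = diff_prod m l / diff_prod m (rho_exp m)"

text \<open>The Vandermonde product at \<open>spec_point k m q\<close> splits into two products of differences, within
  the entries with and without a sign, and \<open>k m\<close> mixed factors that tend to \<open>-2\<close>. The former have
  exactly the order of vanishing of every term of the expanded determinant.\<close>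

lemma character_involution:
  assumes V: "highest_weight_rep (k + m) \<mu> V" and dom: "strictly_decreasing (k + m) (shifted_weight \<mu>)"
    and km: "k \<le> m" and m: "0 < m"
  shows "character V (diag_invol m k) = (- 1) ^ (card (pairs k) + k * m + k)
    * (\<Sum>S | S \<subseteq> {..<k + m} \<and> card S = k \<and> (\<forall>s\<in>S. odd (shifted_weight \<mu> s)).
        of_int (shuffle_sign (k + m) S)
        * weyl_dim k (\<lambda>i. shifted_weight \<mu> (shuffle_perm (k + m) S i))
        * weyl_dim m (\<lambda>i. shifted_weight \<mu> (shuffle_perm (k + m) S (k + i)))) / 2 ^ (k * (m - 1))"
proof -
  let ?n = "k + m" and ?l = "shifted_weight \<mu>"
  let ?O = "{S. S \<subseteq> {..<?n} \<and> card S = k \<and> (\<forall>s\<in>S. odd (?l s))}"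
  let ?N = "card (pairs k) + card (pairs m)"
  let ?e = "\<lambda>S. of_int (shuffle_sign ?n S) :: complex"
  let ?a = "\<lambda>S i. ?l (shuffle_perm ?n S i)" and ?b = "\<lambda>S i. ?l (shuffle_perm ?n S (k + i))"
  define t where "t i = (if i < k then - 1 else 1 :: complex)" for i
  define \<chi> where "\<chi> = character V (mat_diag ?n t)"
  define X where "X q = (\<Prod>(i, j)\<in>{..<k} \<times> {k..<?n}. - (q ^ (k - 1 - i)) - q ^ (?n - 1 - j))" for q :: complex
  have tor: "t \<in> torus ?n"
    by (simp add: t_def torus_def)
  have tor_q: "spec_point k m q \<in> torus ?n" if "q \<noteq> 0" for q
    using that by (simp add: torus_def spec_point_def)
  have lim: "((\<lambda>q. character V (mat_diag ?n (spec_point k m q))) \<longlongrightarrow> \<chi>) (at 1)"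
    unfolding \<chi>_def
  proof (rule character_tendsto[OF V _ _ tor])
    show "((\<lambda>q. spec_point k m q i) \<longlongrightarrow> t i) (at 1)" for i
      by (cases "i < k"; simp add: spec_point_def t_def; (rule tendsto_eq_intros | simp)+)
    show "\<forall>\<^sub>F q in at 1. spec_point k m q \<in> torus ?n"
      using eventually_at_1 by eventually_elim (simp add: tor_q)
  qed
  have limX: "(X \<longlongrightarrow> (- 2) ^ (k * m)) (at 1)"
  proof -
    have "(X \<longlongrightarrow> (\<Prod>(i, j)\<in>{..<k} \<times> {k..<?n}. - (1 ^ (k - 1 - i)) - 1 ^ (?n - 1 - j))) (at 1)"
      unfolding X_def case_prod_beta by (intro tendsto_intros)
    then show ?thesis
      by (simp add: case_prod_beta)
  qed
  have eq: "\<forall>\<^sub>F q in at 1. (- 1) ^ card (pairs k) * X q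
        * (q_diff_prod k (rho_exp k) q * q_diff_prod m (rho_exp m) q / (q - 1) ^ ?N)
        * character V (mat_diag ?n (spec_point k m q))
      = (- 2) ^ k * (\<Sum>S\<in>?O. ?e S * (q_diff_prod k (?a S) q * q_diff_prod m (?b S) q / (q - 1) ^ ?N))"
    using eventually_at_1
  proof eventually_elim
    case (elim q)
    then have q: "q \<noteq> 0" by simp
    have "(- 1) ^ card (pairs k) * q_diff_prod k (rho_exp k) q * X q * q_diff_prod m (rho_exp m) q
        * character V (mat_diag ?n (spec_point k m q))
      = (- 2) ^ k * (\<Sum>S\<in>?O. ?e S * q_diff_prod k (?a S) q * q_diff_prod m (?b S) q)"
      using character_Weyl[OF V dom tor_q[OF q]]
      unfolding vandermonde_spec_point det_spec_point[OF q km] X_def .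
    then have "(- 1) ^ card (pairs k) * q_diff_prod k (rho_exp k) q * X q * q_diff_prod m (rho_exp m) q
        * character V (mat_diag ?n (spec_point k m q)) / (q - 1) ^ ?N
      = (- 2) ^ k * (\<Sum>S\<in>?O. ?e S * q_diff_prod k (?a S) q * q_diff_prod m (?b S) q) / (q - 1) ^ ?N"
      by simp
    then show ?case
      by (simp add: sum_divide_distrib sum_distrib_left mult_ac)
  qed
  have "((\<lambda>q. (- 1) ^ card (pairs k) * X q
        * (q_diff_prod k (rho_exp k) q * q_diff_prod m (rho_exp m) q / (q - 1) ^ ?N)
        * character V (mat_diag ?n (spec_point k m q)))
      \<longlongrightarrow> (- 1) ^ card (pairs k) * (- 2) ^ (k * m) * (diff_prod k (rho_exp k) * diff_prod m (rho_exp m)) * \<chi>) (at 1)"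
    by (intro tendsto_mult tendsto_const limX q_diff_prod_limit2 lim)
  then have "((\<lambda>q. (- 2) ^ k * (\<Sum>S\<in>?O. ?e S * (q_diff_prod k (?a S) q * q_diff_prod m (?b S) q / (q - 1) ^ ?N)))
      \<longlongrightarrow> (- 1) ^ card (pairs k) * (- 2) ^ (k * m) * (diff_prod k (rho_exp k) * diff_prod m (rho_exp m)) * \<chi>) (at 1)"
    by (rule Lim_transform_eventually[OF _ eq])
  moreover have "((\<lambda>q. (- 2) ^ k * (\<Sum>S\<in>?O. ?e S * (q_diff_prod k (?a S) q * q_diff_prod m (?b S) q / (q - 1) ^ ?N)))
      \<longlongrightarrow> (- 2) ^ k * (\<Sum>S\<in>?O. ?e S * (diff_prod k (?a S) * diff_prod m (?b S)))) (at 1)"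
    by (intro tendsto_mult tendsto_const tendsto_sum q_diff_prod_limit2)
  ultimately have main: "(- 1) ^ card (pairs k) * (- 2) ^ (k * m) * (diff_prod k (rho_exp k) * diff_prod m (rho_exp m)) * \<chi>
      = (- 2) ^ k * (\<Sum>S\<in>?O. ?e S * (diff_prod k (?a S) * diff_prod m (?b S)))"
    by (rule LIM_unique)
  define D where "D = diff_prod k (rho_exp k) * diff_prod m (rho_exp m)"
  define Y where "Y = (\<Sum>S\<in>?O. ?e S * weyl_dim k (?a S) * weyl_dim m (?b S))"
  have D: "D \<noteq> 0"
    by (simp add: D_def diff_prod_nonzero strictly_decreasing_rho_exp)
  have "(\<Sum>S\<in>?O. ?e S * (diff_prod k (?a S) * diff_prod m (?b S))) = D * Y"
    unfolding Y_def sum_distrib_left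
    by (intro sum.cong refl) (use D in \<open>simp add: weyl_dim_def D_def\<close>)
  with main have "D * ((- 1) ^ card (pairs k) * (- 2) ^ (k * m) * \<chi>) = D * ((- 2) ^ k * Y)"
    by (simp add: D_def mult_ac)
  then have "(- 1) ^ card (pairs k) * (- 2) ^ (k * m) * \<chi> = (- 2) ^ k * Y"
    using D by simp
  moreover have "(- 2 :: complex) ^ j = (- 1) ^ j * 2 ^ j" for j
    by (simp add: power_mult_distrib[symmetric])
  ultimately have e: "(- 1) ^ card (pairs k) * ((- 1) ^ (k * m) * 2 ^ (k * m)) * \<chi> = (- 1) ^ k * 2 ^ k * Y"
    by simp
  have sq: "(- 1 :: complex) ^ j * ((- 1) ^ j * x) = x" for j x
    by (simp add: mult.assoc[symmetric] power_add[symmetric] flip: mult_2)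
  have "2 ^ (k * m) * \<chi> = (- 1) ^ card (pairs k) * ((- 1) ^ (k * m)
      * ((- 1) ^ card (pairs k) * ((- 1) ^ (k * m) * 2 ^ (k * m)) * \<chi>))"
    using sq[of "card (pairs k)"] sq[of "k * m"] by (simp add: mult_ac)
  also have "\<dots> = (- 1) ^ (card (pairs k) + k * m + k) * (2 ^ k * Y)"
    unfolding e by (simp add: power_add mult_ac)
  finally have "2 ^ (k * m) * \<chi> = (- 1) ^ (card (pairs k) + k * m + k) * (2 ^ k * Y)" .
  moreover have "(2 :: complex) ^ (k * m) = 2 ^ k * 2 ^ (k * (m - 1))"
    using m by (cases m) (simp_all add: power_add)
  ultimately have "2 ^ k * (2 ^ (k * (m - 1)) * \<chi>) = 2 ^ k * ((- 1) ^ (card (pairs k) + k * m + k) * Y)"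
    by (simp only: mult_ac)
  then have "2 ^ (k * (m - 1)) * \<chi> = (- 1) ^ (card (pairs k) + k * m + k) * Y"
    by simp
  then have res: "\<chi> = (- 1) ^ (card (pairs k) + k * m + k) * Y / 2 ^ (k * (m - 1))"
    by (simp add: field_simps)
  have "character V (diag_invol m k) = \<chi>"
  proof -
    \<comment> \<open>This permutation moves the last \<open>k\<close> positions to the front.\<close>
    let ?\<sigma> = "shuffle_perm ?n {m..<?n}"
    let ?u = "\<lambda>i. if i < m then 1 else - 1 :: complex"
    have p: "?\<sigma> permutes {..<?n}"
      by (rule shuffle_perm_permutes) auto
    have c: "{..<?n} - {m..<?n} = {0..<m}"
      by auto
    have "t i = ?u (?\<sigma> i)" if "i < ?n" for i
      using that less_diff_conv2[of k i m] unfolding shuffle_perm_def c by (auto simp: nth_append t_def)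
    then have "mat_diag ?n t = mat_diag ?n (?u \<circ> ?\<sigma>)"
      unfolding mat_diag_def by (intro eq_matI) auto
    then show ?thesis
      unfolding \<chi>_def diag_invol_def using character_permute_diag[OF V p, of ?u]
      by (simp add: torus_def add.commute)
  qed
  then show ?thesis
    unfolding res Y_def .
qed

section \<open>From exponents to weights given by lists\<close>

lemma nths_eq_map: "nths xs A = map ((!) xs) (filter (\<lambda>i. i \<in> A) [0..<length xs])"
proof -
  have z: "zip xs [0..<length xs] = map (\<lambda>i. (xs ! i, i)) [0..<length xs]"
    by (rule nth_equalityI) auto
  show ?thesis
    unfolding nths_def z filter_map by (simp add: comp_def)
qed

lemma filter_upt_eq_sorted_list:
  assumes "S \<subseteq> {..<n}"
  shows "filter (\<lambda>i. i \<in> S) [0..<n] = sorted_list_of_set S"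
proof (rule sorted_distinct_set_unique)
  have "finite S"
    using assms finite_subset by blast
  then show "set (filter (\<lambda>i. i \<in> S) [0..<n]) = set (sorted_list_of_set S)"
    using assms by auto
qed (auto intro: sorted_wrt_filter)

lemma nths_nth:
  assumes "S \<subseteq> {..<length xs}" "i < card S"
  shows "nths xs S ! i = xs ! (sorted_list_of_set S ! i)"
  unfolding nths_eq_map filter_upt_eq_sorted_list[OF assms(1)] using assms by simp

lemma length_nths_card: "S \<subseteq> {..<length xs} \<Longrightarrow> length (nths xs S) = card S"
  unfolding nths_eq_map by (simp add: filter_upt_eq_sorted_list)

lemma shuffle_perm_first:
  "S \<subseteq> {..<n} \<Longrightarrow> i < card S \<Longrightarrow> shuffle_perm n S i = sorted_list_of_set S ! i"
  using card_mono[of "{..<n}" S] by (simp add: shuffle_perm_def nth_append)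

lemma shuffle_perm_second:
  assumes "S \<subseteq> {..<n}" "i < n - card S"
  shows "shuffle_perm n S (card S + i) = sorted_list_of_set ({..<n} - S) ! i"
  using assms by (auto simp: shuffle_perm_def nth_append)

lemma diff_prod_cong: "(\<And>i. i < m \<Longrightarrow> l i = l' i) \<Longrightarrow> diff_prod m l = diff_prod m l'"
  unfolding diff_prod_def by (rule prod.cong) (auto simp: pairs_def)

lemma weyl_dim_cong: "(\<And>i. i < m \<Longrightarrow> l i = l' i) \<Longrightarrow> weyl_dim m l = weyl_dim m l'"
  unfolding weyl_dim_def using diff_prod_cong[of m l l'] by simp

lemma plus_rho_minus_rho [simp]: "plus_rho (minus_rho l) = l"
  by (simp add: plus_rho_eq_iff)

lemma length_minus_rho [simp]: "length (minus_rho l) = length l"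
  by (simp add: minus_rho_def)

lemma degree_minus_rho:
  assumes V: "highest_weight_rep m (minus_rho l) V" and l: "sorted_wrt (>) l"
  shows "of_nat (rep.degree V) = weyl_dim m ((!) l)"
proof -
  have len: "length l = m"
    using V by (simp add: highest_weight_rep_def has_highest_weight_def)
  have e: "shifted_weight (minus_rho l) i = l ! i" if "i < m" for i
    using that len by (simp add: shifted_weight_def)
  have "strictly_decreasing m (shifted_weight (minus_rho l))"
    unfolding strictly_decreasing_def
  proof (intro allI impI)
    fix i assume "Suc i < m"
    then show "shifted_weight (minus_rho l) (Suc i) < shifted_weight (minus_rho l) i"
      using sorted_wrt_nth_less[OF l, of i "Suc i"] len by (simp add: e)
  qed
  then have "of_nat (rep.degree V) = weyl_dim m (shifted_weight (minus_rho l))"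
    unfolding weyl_dim_def by (rule Weyl_dimension_formula[OF V])
  also have "\<dots> = weyl_dim m ((!) l)"
    by (rule weyl_dim_cong[OF e])
  finally show ?thesis .
qed

lemma sorted_wrt_nths: "sorted_wrt R xs \<Longrightarrow> sorted_wrt R (nths xs S)"
proof (induction xs arbitrary: S)
  case (Cons x xs)
  then show ?case
    using set_nths_subset[of xs] by (auto simp: nths_Cons)
qed simp

lemma strictly_decreasing_list_unique:
  assumes "sorted_wrt (>) xs" "sorted_wrt (>) ys" "set xs = set (ys :: int list)"
  shows "xs = ys"
proof -
  have "sorted_wrt (<) (rev xs)" "sorted_wrt (<) (rev ys)"
    using assms by (simp_all add: sorted_wrt_rev)
  then have "rev xs = rev ys"
    using assms(3) by (intro strict_sorted_equal) auto
  then show ?thesis by simp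
qed

lemma decreasing_list_eq:
  assumes "sorted_wrt (>) xs"
  shows "decreasing_list (set xs) = xs"
proof (rule strictly_decreasing_list_unique[OF _ assms])
  show "sorted_wrt (>) (decreasing_list (set xs))"
    by (simp add: decreasing_list_def sorted_wrt_rev)
qed (simp add: decreasing_list_def)

text \<open>Each of the \<open>m choose 2\<close> differences of entries doubles.\<close>

lemma weyl_dim_affine:
  assumes "\<And>i. i < m \<Longrightarrow> l i = 2 * l' i + c"
  shows "weyl_dim m l = 2 ^ (m choose 2) * weyl_dim m l'"
proof -
  have "diff_prod m l = (\<Prod>(i, j)\<in>pairs m. 2 * of_int (l' i - l' j))"
    unfolding diff_prod_def by (rule prod.cong) (auto simp: pairs_def assms)
  also have "\<dots> = 2 ^ card (pairs m) * diff_prod m l'"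
    unfolding diff_prod_def case_prod_beta prod.distrib by simp
  also have "card (pairs m) = m choose 2"
  proof -
    have "card (pairs m) = card (prod.swap ` pairs m)"
      by (rule card_image[symmetric]) auto
    also have "prod.swap ` pairs m = (SIGMA j:{..<m}. {..<j})"
      by (auto simp: pairs_def)
    also have "card \<dots> = (\<Sum>j<m. j)"
      by simp
    also have "\<dots> = m choose 2"
      by (induction m) (simp_all add: numeral_2_eq_2)
    finally show ?thesis .
  qed
  finally show ?thesis
    by (simp add: weyl_dim_def)
qed

text \<open>Collects the powers of 2 in the case of a single odd set.\<close>

lemma choose_two_identity:
  assumes "k \<le> m" "0 < m"
  shows "(k choose 2) + (m choose 2) = ((m - k) choose 2) + k * (m - 1)"
proof -
  obtain r where m: "m = k + r"
    using assms(1) le_Suc_ex by blast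
  have s: "(k + r) choose 2 = (k choose 2) + k * r + (r choose 2)" for k r :: nat
  proof (induction k)
    case (Suc k)
    have "(Suc k + r) choose 2 = (k + r) + ((k + r) choose 2)"
      by (simp add: numeral_2_eq_2)
    moreover have "Suc k choose 2 = k + (k choose 2)"
      by (simp add: numeral_2_eq_2)
    ultimately show ?case
      using Suc by simp
  qed simp
  have t: "2 * (k choose 2) + k = k * k" for k :: nat
    by (induction k) (simp_all add: numeral_2_eq_2)
  have "k * (k + r - 1) + k = k * k + k * r"
    using assms m by (cases k) (simp_all add: algebra_simps)
  then show ?thesis
    using s[of k r] t[of k] by (simp add: m)
qed

lemma kronecker_degree: "rep.degree (tensor_rep V W) = rep.degree V * rep.degree W"
  by (simp add: tensor_rep_def)

section \<open>The three cases\<close>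

locale dominant_weight =
  fixes n k :: nat and lam :: "int list"
  assumes k: "0 < k" "2 * k \<le> n" and len: "length lam = n" and dom: "sorted_wrt (\<ge>) lam"
begin

definition l where "l = plus_rho lam"

lemma length_l: "length l = n"
  by (simp add: l_def len)

lemma l_decreasing: "sorted_wrt (>) l"
  unfolding sorted_wrt_iff_nth_less
proof (intro allI impI)
  fix i j assume "i < j" "j < length l"
  then show "l ! j < l ! i"
    using sorted_wrt_nth_less[OF dom, of i j] by (simp add: l_def plus_rho_nth len)
qed

lemma shifted_l: "i < n \<Longrightarrow> shifted_weight lam i = l ! i"
  by (simp add: shifted_weight_def len l_def)

lemma strictly_decreasing_l: "strictly_decreasing n (shifted_weight lam)"
  unfolding strictly_decreasing_def using sorted_wrt_nth_less[OF l_decreasing] by (simp add: shifted_l length_l)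

lemma inj_l: "inj_on ((!) l) {..<n}"
  using l_decreasing length_l by (intro inj_onI) (metis lessThan_iff linorder_neqE_nat order_less_irrefl sorted_wrt_nth_less)

definition odds where "odds = {s. s < n \<and> odd (l ! s)}"

lemma odds_subset: "odds \<subseteq> {..<n}"
  by (auto simp: odds_def)

lemma finite_odds: "finite odds"
  using odds_subset finite_subset by blast

lemma eta_1: "eta 1 lam = (!) l ` odds"
  using length_l by (auto simp: eta_def odds_def set_conv_nth odd_iff_mod_2_eq_one l_def[symmetric])

lemma eta_0: "eta 0 lam = (!) l ` ({..<n} - odds)"
  using length_l by (auto simp: eta_def odds_def set_conv_nth even_iff_mod_2_eq_zero l_def[symmetric])

lemma card_eta_1: "card (eta 1 lam) = card odds"
  unfolding eta_1 by (rule card_image[OF inj_on_subset[OF inj_l odds_subset]])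

lemma card_eta_0: "card (eta 0 lam) = n - card odds"
proof -
  have "card (eta 0 lam) = card ({..<n} - odds)"
    unfolding eta_0 by (rule card_image[OF inj_on_subset[OF inj_l]]) auto
  then show ?thesis
    using card_Diff_subset[OF finite_odds odds_subset] by simp
qed

lemma card_odds_le: "card odds \<le> n"
  using card_mono[OF _ odds_subset] by simp

lemma odd_subsets_eq: "odd_subsets k lam = {S. S \<subseteq> odds \<and> card S = k}"
proof -
  have "plus_rho lam ! s \<in> eta 1 lam \<longleftrightarrow> odd (l ! s)" if "s < n" for s
    using that length_l by (auto simp: eta_def l_def[symmetric] odd_iff_mod_2_eq_one)
  then show ?thesis
    unfolding odd_subsets_def len odds_def by blast
qed

lemma odd_subsets_shifted:
  "{S. S \<subseteq> {..<n} \<and> card S = k \<and> (\<forall>s\<in>S. odd (shifted_weight lam s))} = odd_subsets k lam"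
  unfolding odd_subsets_eq odds_def using shifted_l by (auto simp: subset_iff)

text \<open>The contributions are: one sign for each pair among the \<open>k\<close> entries with a sign, \<open>k(n - k)\<close> from the
  mixed Vandermonde factors and \<open>k\<close> from the factors \<open>-2\<close> of the rows.\<close>

definition overall_sign :: complex where
  "overall_sign = (- 1) ^ (card (pairs k) + k * (n - k) + k)"

lemma overall_sign: "overall_sign \<in> {1, - 1}"
  unfolding overall_sign_def by (metis insertCI minus_one_power_iff)

lemma character_formula:
  assumes V: "highest_weight_rep n lam V"
  shows "character V (diag_invol (n - k) k) = overall_sign
    * (\<Sum>S\<in>odd_subsets k lam. of_int (shuffle_sign n S)
        * weyl_dim k ((!) (nths l S)) * weyl_dim (n - k) ((!) (nths l ({..<n} - S)))) / 2 ^ (k * (n - k - 1))"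
proof -
  have n: "k + (n - k) = n" and km: "k \<le> n - k" and m: "0 < n - k"
    using k by auto
  have "character V (diag_invol (n - k) k) = overall_sign
    * (\<Sum>S\<in>odd_subsets k lam. of_int (shuffle_sign n S)
        * weyl_dim k (\<lambda>i. shifted_weight lam (shuffle_perm n S i))
        * weyl_dim (n - k) (\<lambda>i. shifted_weight lam (shuffle_perm n S (k + i)))) / 2 ^ (k * (n - k - 1))"
    using character_involution[of k "n - k" lam V] V strictly_decreasing_l km m
    unfolding n overall_sign_def odd_subsets_shifted by simp
  also have "(\<Sum>S\<in>odd_subsets k lam. of_int (shuffle_sign n S)
        * weyl_dim k (\<lambda>i. shifted_weight lam (shuffle_perm n S i))
        * weyl_dim (n - k) (\<lambda>i. shifted_weight lam (shuffle_perm n S (k + i))))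
    = (\<Sum>S\<in>odd_subsets k lam. of_int (shuffle_sign n S)
        * weyl_dim k ((!) (nths l S)) * weyl_dim (n - k) ((!) (nths l ({..<n} - S))))"
  proof (intro sum.cong refl arg_cong2[where f = "(*)"] weyl_dim_cong)
    fix S i assume "S \<in> odd_subsets k lam" and i: "i < k"
    then have S: "S \<subseteq> {..<n}" "card S = k"
      using odds_subset by (auto simp: odd_subsets_eq)
    have "shuffle_perm n S i < n"
      using permutes_in_image[OF shuffle_perm_permutes[OF S(1)], of i] i k by simp
    then show "shifted_weight lam (shuffle_perm n S i) = nths l S ! i"
      using S i by (simp add: shifted_l shuffle_perm_first nths_nth length_l)
  next
    fix S i assume "S \<in> odd_subsets k lam" and i: "i < n - k"
    then have S: "S \<subseteq> {..<n}" "card S = k"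
      using odds_subset by (auto simp: odd_subsets_eq)
    have c: "card ({..<n} - S) = n - k"
      using card_Diff_subset[OF finite_subset[OF S(1)] S(1)] S(2) by simp
    have "shuffle_perm n S (k + i) < n"
      using permutes_in_image[OF shuffle_perm_permutes[OF S(1)], of "k + i"] i k by simp
    then show "shifted_weight lam (shuffle_perm n S (k + i)) = nths l ({..<n} - S) ! i"
      using S i shuffle_perm_second[OF S(1), of i] nths_nth[of "{..<n} - S" l i]
      by (simp add: shifted_l length_l c)
  qed
  finally show ?thesis .
qed

end

context dominant_weight
begin

lemma character_involution_eq_0:
  assumes V: "highest_weight_rep n lam V" and c: "card (eta 0 lam) > n - k"
  shows "character V (diag_invol (n - k) k) = 0"
proof -
  have "card odds < k"
    using c card_odds_le by (simp add: card_eta_0)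
  then have "card S \<noteq> k" if "S \<subseteq> odds" for S
    using card_mono[OF finite_odds that] by simp
  then have "odd_subsets k lam = {}"
    unfolding odd_subsets_eq by blast
  then show ?thesis
    by (simp add: character_formula[OF V])
qed

text \<open>The only odd set consists of all positions with an odd entry. Halving the odd and the even entries
  yields the weights \<open>weight1\<close> and \<open>weight0\<close>.\<close>

lemma character_involution_product:
  assumes V: "highest_weight_rep n lam V"
    and V0: "highest_weight_rep (n - k) (weight0 lam) V0"
    and V1: "highest_weight_rep k (weight1 lam) V1"
    and c: "card (eta 0 lam) = n - k"
  shows "character V (diag_invol (n - k) k)
    = (overall_sign * of_int (shuffle_sign n odds)) * 2 ^ ((n - 2 * k) choose 2)
      * of_nat (rep.degree (tensor_rep V0 V1))"
proof -
  have co: "card odds = k"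
    using c k card_odds_le by (simp add: card_eta_0)
  have O: "odd_subsets k lam = {odds}"
    unfolding odd_subsets_eq using co card_subset_eq[OF finite_odds] by auto
  let ?x = "nths l odds" and ?y = "nths l ({..<n} - odds)"
  have lx: "length ?x = k" and ly: "length ?y = n - k"
    using length_nths_card[of odds l] length_nths_card[of "{..<n} - odds" l] odds_subset co
      card_Diff_subset[OF finite_odds odds_subset] by (simp_all add: length_l)
  have sx: "set ?x = eta 1 lam" and sy: "set ?y = eta 0 lam"
    unfolding eta_1 eta_0 using odds_subset length_l by (auto simp: set_nths)
  have dx: "sorted_wrt (>) ?x" and dy: "sorted_wrt (>) ?y"
    by (rule sorted_wrt_nths[OF l_decreasing])+
  have ox: "odd a" if "a \<in> set ?x" for a
    using that unfolding sx by (simp add: eta_def odd_iff_mod_2_eq_one)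
  have ey: "even a" if "a \<in> set ?y" for a
    using that unfolding sy by (simp add: eta_def even_iff_mod_2_eq_zero)
  let ?x' = "map (\<lambda>b. (b - 1) div 2) ?x" and ?y' = "map (\<lambda>a. a div 2) ?y"
  have dx': "sorted_wrt (>) ?x'"
    unfolding sorted_wrt_map by (rule sorted_wrt_mono_rel[OF _ dx]) (auto dest!: ox elim!: oddE)
  have dy': "sorted_wrt (>) ?y'"
    unfolding sorted_wrt_map by (rule sorted_wrt_mono_rel[OF _ dy]) (auto dest!: ey elim!: evenE)
  have w1: "weight1 lam = minus_rho ?x'" and w0: "weight0 lam = minus_rho ?y'"
    unfolding weight1_def weight0_def sx[symmetric] sy[symmetric]
    using decreasing_list_eq[OF dx'] decreasing_list_eq[OF dy'] by simp_all
  have e1: "weyl_dim k ((!) ?x) = 2 ^ (k choose 2) * of_nat (rep.degree V1)"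
    unfolding degree_minus_rho[OF V1[unfolded w1] dx']
  proof (rule weyl_dim_affine)
    fix i assume "i < k"
    then show "?x ! i = 2 * ?x' ! i + 1"
      using ox[of "?x ! i"] lx by (auto elim!: oddE)
  qed
  have e0: "weyl_dim (n - k) ((!) ?y) = 2 ^ ((n - k) choose 2) * of_nat (rep.degree V0)"
    unfolding degree_minus_rho[OF V0[unfolded w0] dy']
  proof (rule weyl_dim_affine)
    fix i assume "i < n - k"
    then show "?y ! i = 2 * ?y' ! i + 0"
      using ey[of "?y ! i"] ly by (auto elim!: evenE)
  qed
  have "(k choose 2) + ((n - k) choose 2) = ((n - 2 * k) choose 2) + k * (n - k - 1)"
    using choose_two_identity[of k "n - k"] k by (simp add: mult_2)
  then have p: "(2 :: complex) ^ (k choose 2) * 2 ^ ((n - k) choose 2) = 2 ^ ((n - 2 * k) choose 2) * 2 ^ (k * (n - k - 1))"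
    by (simp only: power_add[symmetric])
  have "character V (diag_invol (n - k) k) = overall_sign * of_int (shuffle_sign n odds)
      * (2 ^ (k choose 2) * 2 ^ ((n - k) choose 2)) * of_nat (rep.degree (tensor_rep V0 V1)) / 2 ^ (k * (n - k - 1))"
    unfolding character_formula[OF V] O kronecker_degree by (simp add: e0 e1)
  then show ?thesis
    unfolding p by simp
qed

lemma character_involution_sum:
  assumes V: "highest_weight_rep n lam V"
    and U: "\<And>S. S \<in> odd_subsets k lam \<Longrightarrow> highest_weight_rep k (subset_weight lam S) (U S)"
    and U': "\<And>S. S \<in> odd_subsets k lam \<Longrightarrow> highest_weight_rep (n - k) (subset_weight lam ({..<n} - S)) (U' S)"
  shows "character V (diag_invol (n - k) k) = overall_sign
    * (\<Sum>S\<in>odd_subsets k lam. of_int (shuffle_sign n S) * of_nat (rep.degree (tensor_rep (U S) (U' S))))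
    / 2 ^ (k * (n - k - 1))"
proof -
  have "weyl_dim k ((!) (nths l S)) * weyl_dim (n - k) ((!) (nths l ({..<n} - S)))
      = of_nat (rep.degree (tensor_rep (U S) (U' S)))" if S: "S \<in> odd_subsets k lam" for S
    using degree_minus_rho[OF U[OF S, unfolded subset_weight_def]] degree_minus_rho[OF U'[OF S, unfolded subset_weight_def]]
      sorted_wrt_nths[OF l_decreasing]
    by (simp add: l_def[symmetric] kronecker_degree)
  then show ?thesis
    unfolding character_formula[OF V] by (simp add: mult.assoc)
qed

lemma card_odd_subsets: "card (odd_subsets k lam) = card (eta 1 lam) choose k"
  unfolding odd_subsets_eq card_eta_1 by (rule n_subsets[OF finite_odds])

end

theorem theorem4p1:
  fixes n k :: nat and lam :: "int list"
  assumes "n \<ge> 2" and "0 < k" and "2 * k \<le> n"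
    and "length lam = n" and "sorted_wrt (\<ge>) lam"
    and "card (eta 0 lam) \<ge> card (eta 1 lam)"
  shows
    "(card (eta 0 lam) > n - k \<longrightarrow>
       (\<forall>V. highest_weight_rep n lam V \<longrightarrow> character V (diag_invol (n - k) k) = 0))
     \<and>
     (card (eta 0 lam) = n - k \<longrightarrow>
       (\<exists>\<epsilon> \<in> {1, -1}. \<forall>V V0 V1.
          highest_weight_rep n lam V \<and>
          highest_weight_rep (n - k) (weight0 lam) V0 \<and>
          highest_weight_rep k (weight1 lam) V1 \<longrightarrow>
          character V (diag_invol (n - k) k) =
            \<epsilon> * 2 ^ ((n - 2 * k) choose 2) * of_nat (rep.degree (tensor_rep V0 V1))))
     \<and>
     (card (eta 0 lam) < n - k \<longrightarrow>
       card (odd_subsets k lam) = card (eta 1 lam) choose k \<and>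
       (\<exists>\<epsilon> \<in> {1, -1}. \<forall>V U U'.
          highest_weight_rep n lam V \<and>
          (\<forall>S \<in> odd_subsets k lam.
             highest_weight_rep k (subset_weight lam S) (U S) \<and>
             highest_weight_rep (n - k) (subset_weight lam ({..<n} - S)) (U' S)) \<longrightarrow>
          character V (diag_invol (n - k) k) =
            \<epsilon> * (\<Sum>S \<in> odd_subsets k lam.
                   of_int (shuffle_sign n S) * of_nat (rep.degree (tensor_rep (U S) (U' S))))
              / 2 ^ (k * (n - k - 1))))"
proof -
  interpret dominant_weight n k lam
    using assms by unfold_locales auto
  have s: "overall_sign * of_int (shuffle_sign n odds) \<in> {1, - 1}"
    using overall_sign by (auto simp: shuffle_sign_def sign_def)
  show ?thesis
  proof (intro conjI impI)
    show "\<forall>V. highest_weight_rep n lam V \<longrightarrow> character V (diag_invol (n - k) k) = 0"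
      if "card (eta 0 lam) > n - k"
      using character_involution_eq_0 that by blast
    show "\<exists>\<epsilon>\<in>{1, -1}. \<forall>V V0 V1.
          highest_weight_rep n lam V \<and>
          highest_weight_rep (n - k) (weight0 lam) V0 \<and>
          highest_weight_rep k (weight1 lam) V1 \<longrightarrow>
          character V (diag_invol (n - k) k) =
            \<epsilon> * 2 ^ ((n - 2 * k) choose 2) * of_nat (rep.degree (tensor_rep V0 V1))"
      if "card (eta 0 lam) = n - k"
      using character_involution_product that by (intro bexI[OF _ s]) blast
    show "card (odd_subsets k lam) = card (eta 1 lam) choose k"
      by (rule card_odd_subsets)
    show "\<exists>\<epsilon>\<in>{1, -1}. \<forall>V U U'.
          highest_weight_rep n lam V \<and>
          (\<forall>S \<in> odd_subsets k lam.
             highest_weight_rep k (subset_weight lam S) (U S) \<and>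
             highest_weight_rep (n - k) (subset_weight lam ({..<n} - S)) (U' S)) \<longrightarrow>
          character V (diag_invol (n - k) k) =
            \<epsilon> * (\<Sum>S \<in> odd_subsets k lam.
                   of_int (shuffle_sign n S) * of_nat (rep.degree (tensor_rep (U S) (U' S))))
              / 2 ^ (k * (n - k - 1))"
      by (intro bexI[OF _ overall_sign] allI impI, rule character_involution_sum) blast+
  qed
qed

end
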